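(* Let $n,d$ be positive integers. The following inequality holds: $$\alpha(\mathcal{F}_d)\le 1+\frac{1}{(1-\gamma^2)^{\frac14}}\left(\sum_{j=0}^{d}h_{2j}\sqrt{\frac{4}{\pi(4j+1)}}\right),$$ where $\gamma$ is the biggest root of the Legendre polynomial $L_{2d}(x_1)$. The root $\gamma$ is known to satisfy $$\gamma=\cos\left(\frac{\beta}{\sqrt{4d^2+2d+1/3}}\left(1-\frac{\beta^2-2}{360(4d^2+2d+1/3)^2}\right)\right)+O(d^{-7}),$$ where $\beta\approx 2.4048$ is the first positive root of the Bessel function $J_0(x)$.
   Context: $h_0:=1$ and $h_m:=\binom{n+m-1}{n-1}-\binom{n+m-3}{n-1}$ for $m\ge1$. The Legendre polynomial of degree $m$ is $L_m(x_1)=\frac{1}{m!\,2^m}\frac{d^m}{dx_1^m}[(x_1^2-1)^m]$. Let $X=S^{n-1}\subseteq\mathbb{R}^n$ be the unit sphere with normalized surface measure $\mu$ (so $\mu(X)=1$). Let $V=\mathrm{Sym}^{2d}(\mathbb{R}^n)$ and $\phi:X\to V$, $\phi(v)=v^{2d}$. The dual $V^*$ is identified with homogeneous polynomials of degree $2d$ in $n$ variables, via $\langle p,v^{2d}\rangle=p(v)$. Let $g\in V^*$ be the form $(x_1^2+\dots+x_n^2)^d$, and let $\overline{x}=\int_X\phi\,d\mu$, so $\langle p,\overline{x}\rangle=\int_{S^{n-1}}p\,d\mu$. Let $C$ be the convex cone generated by $\phi(X)$; its dual $C^*\subseteq V^*$ is the cone of nonnegative forms of degree $2d$ in $n$ variables.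 Let $\mathcal{F}_k$ be the vector space of homogeneous polynomials of degree $2k$ in $n$ variables restricted to $X$ (here used with $k=d$), and let $C^*(\mathcal{F}_k)=\{\lambda\in V^*:\int_X\lambda(\phi(u))q(u)^2d\mu(u)\ge0\ \forall q\in\mathcal{F}_k\}$. Let $\Lambda^\vee=\{\ell\in V^*:\ell(\overline{x})=1\}$, $B^\vee=C^*\cap\Lambda^\vee$ and $B^\vee(\mathcal{F}_k)=C^*(\mathcal{F}_k)\cap\Lambda^\vee$. The scaling constant $\alpha(\mathcal{F}_k)$ is the infimum of the real numbers $\alpha>0$ such that $\frac1\alpha(B^\vee(\mathcal{F}_k)-g)\subseteq B^\vee-g$ ($\infty$ if there are none). (Equivalently: with $C(\mathcal{F}_k)=C^*(\mathcal{F}_k)^*\subseteq V$, $\Lambda=g^{-1}(1)$, $B=C\cap\Lambda$, $B(\mathcal{F}_k)=C(\mathcal{F}_k)\cap\Lambda$, the inclusion $B-\overline{x}\subseteq\alpha(B(\mathcal{F}_k)-\overline{x})$.) $J_0$ is the Bessel function of the first kind of order $0$. *)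

theory Defs
  imports
    "HOL-Analysis.Analysis"
    "HOL-Library.Poly_Mapping"
    "HOL-Library.Landau_Symbols"
    "HOL-Computational_Algebra.Polynomial"
begin

section \<open>Forms and symmetric tensors\<close>

text \<open>
  The monomial $x_{i_1} \cdots x_{i_m}$ is the multiset of indices $\{i_1, \dots, i_m\}$.  With addition
  of multisets as multiplication of monomials, finitely supported maps from multisets to the reals,
  under the convolution product of \<^theory>\<open>HOL-Library.Poly_Mapping\<close>, are the polynomial ring
  $R[x_i : i \in 'n]$, where $n = |'n|$.
\<close>

type_synonym 'n mpoly = "'n multiset \<Rightarrow>\<^sub>0 real"

definition var :: "'n \<Rightarrow> 'n mpoly" where
  "var i = Poly_Mapping.single {#i#} 1"

definition const :: "real \<Rightarrow> 'n mpoly" where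
  "const c = Poly_Mapping.single {#} c"

definition mpoly_eval :: "'n::finite mpoly \<Rightarrow> real ^ 'n \<Rightarrow> real" where
  "mpoly_eval p v = (\<Sum>M\<in>Poly_Mapping.keys p. Poly_Mapping.lookup p M * (\<Prod>i\<in>#M. v $ i))"

definition forms :: "nat \<Rightarrow> 'n mpoly set" where
  "forms m = {p. \<forall>M\<in>Poly_Mapping.keys p. size M = m}"

text \<open>
  An element of $Sym^m(R^n)$ is given by its entries $T_{i_1 \dots i_m}$.  These do not depend on the
  order of the indices, so a symmetric tensor is a function on multisets that vanishes on the
  multisets of size other than $m$.
\<close>

type_synonym 'n symtensor = "'n multiset \<Rightarrow> real"

definition sympow :: "nat \<Rightarrow> real ^ 'n::finite \<Rightarrow> 'n symtensor" where
  "sympow m v = (\<lambda>M. if size M = m then (\<Prod>i\<in>#M. v $ i) else 0)"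

text \<open>
  The pairing through which forms of degree $m$ are the dual space of $Sym^m(R^n)$.  It is determined
  by the lemma after it.
\<close>

definition pairing :: "'n mpoly \<Rightarrow> 'n symtensor \<Rightarrow> real" where
  "pairing p T = (\<Sum>M\<in>Poly_Mapping.keys p. Poly_Mapping.lookup p M * T M)"

lemma pairing_sympow: "p \<in> forms m \<Longrightarrow> pairing p (sympow m v) = mpoly_eval p v"
  by (auto simp: pairing_def mpoly_eval_def sympow_def forms_def intro!: sum.cong)


section \<open>The unit sphere\<close>

abbreviation unit_sphere :: "(real ^ 'n::finite) set" where
  "unit_sphere \<equiv> sphere 0 1"

text \<open>
  Normalized surface measure: the measure of a Borel set $A$ of the sphere is the proportion of the
  volume of the unit ball taken up by the cone $\{t a : a \in A, 0 < t < 1\}$ over $A$.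
\<close>

definition sphere_measure :: "(real ^ 'n::finite) measure" where
  "sphere_measure =
     restrict_space (distr (uniform_measure lborel (ball 0 1)) borel sgn) unit_sphere"


section \<open>The cones and the scaling constant\<close>

definition tensor_cone :: "nat \<Rightarrow> 'n::finite symtensor set" where
  "tensor_cone d =
     {(\<lambda>M. \<Sum>v\<in>S. c v * sympow (2 * d) v M) | (S :: (real ^ 'n) set) c.
        finite S \<and> S \<subseteq> unit_sphere \<and> (\<forall>v\<in>S. c v \<ge> 0)}"

definition dual_cone :: "nat \<Rightarrow> 'n::finite mpoly set" where
  "dual_cone d = {p \<in> forms (2 * d). \<forall>T\<in>tensor_cone d. pairing p T \<ge> 0}"

definition form_space :: "nat \<Rightarrow> (real ^ 'n::finite \<Rightarrow> real) set" where
  "form_space k = {restrict (mpoly_eval q) unit_sphere | q. q \<in> forms (2 * k)}"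

definition dual_cone_approx ::
    "nat \<Rightarrow> (real ^ 'n::finite \<Rightarrow> real) set \<Rightarrow> 'n mpoly set" where
  "dual_cone_approx d F =
     {p \<in> forms (2 * d).
        \<forall>q\<in>F. (\<integral>u. pairing p (sympow (2 * d) u) * (q u)\<^sup>2 \<partial>sphere_measure) \<ge> 0}"

definition barycenter :: "nat \<Rightarrow> 'n::finite symtensor" where
  "barycenter d = (\<lambda>M. \<integral>u. sympow (2 * d) u M \<partial>sphere_measure)"

definition dual_slice :: "nat \<Rightarrow> 'n::finite mpoly set" where
  "dual_slice d = {p \<in> forms (2 * d). pairing p (barycenter d) = 1}"

definition norm_form :: "nat \<Rightarrow> 'n::finite mpoly" where
  "norm_form d = (\<Sum>i\<in>UNIV. var i ^ 2) ^ d"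

definition scaling_const :: "nat \<Rightarrow> (real ^ 'n::finite \<Rightarrow> real) set \<Rightarrow> ereal" where
  "scaling_const d F =
     Inf (ereal ` {\<alpha>. \<alpha> > 0 \<and>
       (\<lambda>p. const (1 / \<alpha>) * (p - norm_form d)) ` (dual_cone_approx d F \<inter> dual_slice d)
         \<subseteq> (\<lambda>p. p - norm_form d) ` (dual_cone d \<inter> dual_slice d)})"


section \<open>The quantities in the bound\<close>

text \<open>
  For $n \ge 1$ and $m \ge 1$ the subtraction $n + m - 3$ is truncated only for $n = m = 1$, where
  both $\binom{-1}{0}$ and $\binom{0}{0}$ equal 1.
\<close>

definition harmonic_dim :: "nat \<Rightarrow> nat \<Rightarrow> real" where
  "harmonic_dim n m =
     (if m = 0 then 1
      else real ((n + m - 1) choose (n - 1)) - real ((n + m - 3) choose (n - 1)))"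

definition Legendre_poly :: "nat \<Rightarrow> real poly" where
  "Legendre_poly m = smult (1 / (fact m * 2 ^ m)) ((pderiv ^^ m) ([:-1, 0, 1:] ^ m))"

definition Bessel_J0 :: "real \<Rightarrow> real" where
  "Bessel_J0 x = suminf (\<lambda>k. (-1) ^ k / (fact k)\<^sup>2 * (x / 2) ^ (2 * k))"

end

theory Submission
  imports "HOL-Probability.Probability" Defs
begin

text \<open>
  The inequality. By duality it is enough to bound from below the values on the sphere of a form
  \<open>p\<close> of degree \<open>2d\<close> that has mean 1 and satisfies \<open>\<integral> p q\<^sup>2 \<ge> 0\<close> for all forms \<open>q\<close> of degree
  \<open>2d\<close>: if always \<open>p(v) \<ge> - c\<close>, then the scaling constant is at most \<open>1 + c\<close>
  (\<open>scaling_const_le\<close>). Let \<open>E\<close> be the space of the forms \<open>q\<close>, as functions on the sphere, and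
  \<open>D\<close> its dimension. Its reproducing kernel \<open>K\<close> is rotation invariant, so \<open>K(v,v) = D\<close> for all
  \<open>v\<close>. Put \<open>R = K(v,_)/D\<close> and \<open>L f = \<integral> p f\<close>, so that \<open>p(v) = D L(R)\<close>. Two inequalities give
  \<open>L(R) \<ge> - 1/2\<close>:

    \<^item> \<open>L((R + 1/2)\<^sup>2) \<ge> 0\<close>, since \<open>E\<close> contains the constants;
    \<^item> \<open>1 + L(R) - 2 L(R\<^sup>2) \<ge> 0\<close>. Convolution with the probability density \<open>D R\<^sup>2\<close>, compressed
      to \<open>E\<close>, is a self-adjoint operator \<open>A\<close> with \<open>0 \<le> A \<le> 1\<close>. The orthogonal projection of
      \<open>1 + R - 2 R\<^sup>2\<close> to \<open>E\<close>, which is all that \<open>L\<close> sees, has at \<open>u\<close> the value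
      \<open>(\<langle>A (K_u - K_v), K_u - K_v\<rangle> + \<langle>(1 - A) (K_u + K_v), K_u + K_v\<rangle>) / (2D)\<close>,
      a nonnegative combination of squares of functions of \<open>u\<close> that lie in \<open>E\<close>.

  Twice the first plus the second is \<open>3 L(R) + 3/2 \<ge> 0\<close>, hence \<open>p(v) \<ge> - D/2\<close>
  (\<open>lower_bound_of_square_positive\<close>, \<open>sphere_lower_bound\<close>). Finally \<open>D\<close> is at most the number of
  monomials of degree \<open>2d\<close>, which is the sum of the \<open>h\<^sub>2\<^sub>j\<close> for \<open>j \<le> d\<close>, and the root \<open>\<gamma>\<close> lies so
  close to 1 that in the claimed bound every \<open>h\<^sub>2\<^sub>j\<close> has a factor of at least \<open>1/2\<close>
  (\<open>dimension_bound\<close>).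

  The root. For \<open>\<epsilon> = 1/(m(m+1))\<close> the polynomial \<open>L\<^sub>m(1 - 2\<epsilon>y)\<close> is the series \<open>legendre_series \<epsilon> y\<close>
  with terms \<open>(-y)^k/(k!)\<^sup>2 \<cdot> \<Prod>j<k. (1 - \<epsilon> j(j+1))\<close>; for \<open>\<epsilon> = 0\<close> it is \<open>J\<^sub>0(2 sqrt y)\<close>. For all these
  \<open>\<epsilon>\<close> it has slope at most \<open>- 1/4\<close> on \<open>[0, 3/2]\<close> and is negative at \<open>3/2\<close>. So it has one root
  \<open>r(\<epsilon>)\<close> there, \<open>\<gamma> = 1 - 2\<epsilon> r(\<epsilon>)\<close> with \<open>m = 2d\<close>, and \<open>\<beta> = 2 sqrt (r 0)\<close>. Expanding the series to second
  order in \<open>\<epsilon>\<close> gives a number that nearly solves the equation, and the slope bound makes it an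
  approximation \<open>r(0) exp(s\<^sub>1\<epsilon> + s\<^sub>2\<epsilon>\<^sup>2)\<close> of \<open>r(\<epsilon>)\<close> with error \<open>O(\<epsilon>\<^sup>3)\<close> (\<open>legendre_root_expansion\<close>). The
  cosine of the claim, expanded in \<open>\<epsilon>\<close>, agrees with this up to \<open>O(\<epsilon>\<^sup>4)\<close>
  (\<open>cos_angle_expansion\<close>). The numerical value of \<open>\<beta>\<close> comes from partial sums of the alternating
  series for \<open>J\<^sub>0\<close>.
\<close>

section \<open>Function systems with a homogeneous reproducing kernel\<close>

text \<open>
  The integrands of the kernel argument all lie in this algebra, so that integrability has to be
  discussed only once.
\<close>

definition bounded_measurable :: "'a measure \<Rightarrow> ('a \<Rightarrow> real) set" where
  "bounded_measurable M = {f \<in> borel_measurable M. \<exists>C. \<forall>x\<in>space M. \<bar>f x\<bar> \<le> C}"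

lemma bounded_measurableI:
  "f \<in> borel_measurable M \<Longrightarrow> (\<And>x. x \<in> space M \<Longrightarrow> \<bar>f x\<bar> \<le> C) \<Longrightarrow> f \<in> bounded_measurable M"
  by (auto simp: bounded_measurable_def)

lemma bounded_measurable_imp_measurable:
  "f \<in> bounded_measurable M \<Longrightarrow> f \<in> borel_measurable M"
  by (simp add: bounded_measurable_def)

lemma bounded_measurable_const [simp, intro]: "(\<lambda>x. c) \<in> bounded_measurable M"
  by (auto simp: bounded_measurable_def)

lemma bounded_measurable_add [simp, intro]:
  assumes "f \<in> bounded_measurable M" "g \<in> bounded_measurable M"
  shows "(\<lambda>x. f x + g x) \<in> bounded_measurable M"
proof -
  obtain C where C: "\<forall>x\<in>space M. \<bar>f x\<bar> \<le> C"
    using assms(1) unfolding bounded_measurable_def by blast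
  obtain D where D: "\<forall>x\<in>space M. \<bar>g x\<bar> \<le> D"
    using assms(2) unfolding bounded_measurable_def by blast
  have "\<bar>f x + g x\<bar> \<le> C + D" if "x \<in> space M" for x
    using bspec[OF C that] bspec[OF D that] by linarith
  then show ?thesis
    using assms[THEN bounded_measurable_imp_measurable] by (intro bounded_measurableI) auto
qed

lemma bounded_measurable_mult [simp, intro]:
  assumes "f \<in> bounded_measurable M" "g \<in> bounded_measurable M"
  shows "(\<lambda>x. f x * g x) \<in> bounded_measurable M"
proof -
  obtain C where C: "\<forall>x\<in>space M. \<bar>f x\<bar> \<le> C"
    using assms(1) unfolding bounded_measurable_def by blast
  obtain D where D: "\<forall>x\<in>space M. \<bar>g x\<bar> \<le> D"
    using assms(2) unfolding bounded_measurable_def by blast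
  have "\<bar>f x * g x\<bar> \<le> C * D" if "x \<in> space M" for x
    using bspec[OF C that] bspec[OF D that] by (simp add: abs_mult mult_mono')
  then show ?thesis
    using assms[THEN bounded_measurable_imp_measurable] by (intro bounded_measurableI) auto
qed

lemma bounded_measurable_sum [simp, intro]:
  assumes "\<And>i. i \<in> I \<Longrightarrow> f i \<in> bounded_measurable M"
  shows "(\<lambda>x. \<Sum>i\<in>I. f i x) \<in> bounded_measurable M"
  using assms
proof (induction I rule: infinite_finite_induct)
  case (insert i I)
  have "(\<lambda>x. f i x + (\<Sum>i\<in>I. f i x)) \<in> bounded_measurable M"
    by (rule bounded_measurable_add) (simp_all add: insert)
  then show ?case by (simp add: insert.hyps)
qed simp_all

lemma bounded_measurable_diff [simp, intro]:
  assumes "f \<in> bounded_measurable M" "g \<in> bounded_measurable M"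
  shows "(\<lambda>x. f x - g x) \<in> bounded_measurable M"
  using bounded_measurable_add[OF assms(1) bounded_measurable_mult[OF bounded_measurable_const assms(2)], of "-1"]
  by simp

lemma bounded_measurable_power [simp, intro]:
  "f \<in> bounded_measurable M \<Longrightarrow> (\<lambda>x. f x ^ k) \<in> bounded_measurable M"
  by (induction k) (simp_all add: bounded_measurable_mult)

lemma bounded_measurable_cong:
  assumes "f \<in> bounded_measurable M" "\<And>x. x \<in> space M \<Longrightarrow> f x = g x"
  shows "g \<in> bounded_measurable M"
  using assms measurable_cong[of M f g] by (auto simp: bounded_measurable_def)

lemma (in finite_measure) bounded_measurable_integrable:
  "f \<in> bounded_measurable M \<Longrightarrow> integrable M f"
  by (auto simp: bounded_measurable_def intro!: integrable_const_bound AE_I2)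

text \<open>
  An orthonormal basis of a finite-dimensional space of functions that contains the constants, over a
  probability space in which any two points are exchanged by a measure-preserving involution that
  maps the function space to itself. That a function lies in the space is expressed by its equality
  with its own orthogonal expansion.
\<close>

locale swappable_orthonormal_family = prob_space M for M :: "'a measure" +
  fixes B :: "('a \<Rightarrow> real) set"
  assumes finite_B: "finite B"
    and B_bounded: "B \<subseteq> bounded_measurable M"
    and orthonormal: "\<And>e f. e \<in> B \<Longrightarrow> f \<in> B \<Longrightarrow> (\<integral>x. e x * f x \<partial>M) = (if e = f then 1 else 0)"
    and one_spanned: "\<And>x. x \<in> space M \<Longrightarrow> (\<Sum>e\<in>B. (\<integral>y. e y \<partial>M) * e x) = 1"
    and swap: "\<And>u v. u \<in> space M \<Longrightarrow> v \<in> space M \<Longrightarrow>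
      \<exists>T. T \<in> measurable M M \<and> distr M M T = M \<and> (\<forall>x\<in>space M. T (T x) = x) \<and> T u = v \<and>
        (\<forall>e\<in>B. \<forall>x\<in>space M. e (T x) = (\<Sum>f\<in>B. (\<integral>y. e (T y) * f y \<partial>M) * f x))"
begin

definition span_of :: "('a \<Rightarrow> real) set" where
  "span_of = {q. \<exists>c. \<forall>x\<in>space M. q x = (\<Sum>e\<in>B. c e * e x)}"

definition kernel :: "'a \<Rightarrow> 'a \<Rightarrow> real" where
  "kernel u v = (\<Sum>e\<in>B. e u * e v)"

lemma member_bounded_measurable [simp, intro]: "e \<in> B \<Longrightarrow> e \<in> bounded_measurable M"
  using B_bounded by auto

lemma bounded_measurable_imp_integrable [simp]: "f \<in> bounded_measurable M \<Longrightarrow> integrable M f"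
  by (rule bounded_measurable_integrable)

lemma kernel_bounded_measurable [simp, intro]: "kernel v \<in> bounded_measurable M"
  unfolding kernel_def[abs_def] by (intro bounded_measurable_sum bounded_measurable_mult) auto

lemma integral_linear_combination:
  assumes "\<And>i. i \<in> I \<Longrightarrow> f i \<in> bounded_measurable M"
  shows "(\<integral>x. (\<Sum>i\<in>I. c i * f i x) \<partial>M) = (\<Sum>i\<in>I. c i * (\<integral>x. f i x \<partial>M))"
  using assms by (subst Bochner_Integration.integral_sum) auto

lemma span_ofI: "(\<And>x. x \<in> space M \<Longrightarrow> q x = (\<Sum>e\<in>B. c e * e x)) \<Longrightarrow> q \<in> span_of"
  by (auto simp: span_of_def)

lemma span_of_const: "(\<lambda>x. a) \<in> span_of"
  by (rule span_ofI[where c = "\<lambda>e. a * (\<integral>y. e y \<partial>M)"])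
     (simp add: one_spanned mult.assoc flip: sum_distrib_left)

lemma span_of_add: "f \<in> span_of \<Longrightarrow> g \<in> span_of \<Longrightarrow> (\<lambda>x. f x + g x) \<in> span_of"
proof -
  assume "f \<in> span_of" "g \<in> span_of"
  then obtain c d where "\<And>x. x \<in> space M \<Longrightarrow> f x = (\<Sum>e\<in>B. c e * e x)"
    "\<And>x. x \<in> space M \<Longrightarrow> g x = (\<Sum>e\<in>B. d e * e x)" by (auto simp: span_of_def)
  then show ?thesis
    by (intro span_ofI[where c = "\<lambda>e. c e + d e"]) (simp add: algebra_simps sum.distrib)
qed

lemma span_of_scale: "f \<in> span_of \<Longrightarrow> (\<lambda>x. a * f x) \<in> span_of"
proof -
  assume "f \<in> span_of"
  then obtain c where "\<And>x. x \<in> space M \<Longrightarrow> f x = (\<Sum>e\<in>B. c e * e x)" by (auto simp: span_of_def)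
  then show ?thesis
    by (intro span_ofI[where c = "\<lambda>e. a * c e"]) (simp add: sum_distrib_left mult.assoc)
qed

lemma span_of_sum:
  "(\<And>i. i \<in> I \<Longrightarrow> f i \<in> span_of) \<Longrightarrow> (\<lambda>x. \<Sum>i\<in>I. f i x) \<in> span_of"
  by (induction I rule: infinite_finite_induct)
     (use span_of_const[of 0] in \<open>auto intro: span_of_add\<close>)

lemma span_of_B: "e \<in> B \<Longrightarrow> e \<in> span_of"
  by (rule span_ofI[where c = "\<lambda>f. if f = e then 1 else 0"]) (simp add: finite_B if_distrib[of "\<lambda>c. c * _"] cong: if_cong)

text \<open>
  In the basis \<open>B\<close>, composition with a measure-preserving involution \<open>T\<close> has a symmetric matrix whose
  square is the identity. Such a matrix is orthogonal, and the kernel is the same for all orthonormal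
  bases of the span.
\<close>

lemma kernel_swap:
  assumes uv: "u \<in> space M" "v \<in> space M"
  obtains T where "T \<in> measurable M M" "distr M M T = M" "T u = v" "T v = u"
    "\<And>x y. x \<in> space M \<Longrightarrow> y \<in> space M \<Longrightarrow> kernel (T x) (T y) = kernel x y"
proof -
  obtain T where T: "T \<in> measurable M M" "distr M M T = M"
    "\<And>x. x \<in> space M \<Longrightarrow> T (T x) = x" "T u = v"
    and exp: "\<And>e x. e \<in> B \<Longrightarrow> x \<in> space M \<Longrightarrow> e (T x) = (\<Sum>f\<in>B. (\<integral>y. e (T y) * f y \<partial>M) * f x)"
    using swap[OF uv] by blast
  have Tsp: "T x \<in> space M" if "x \<in> space M" for x using T(1) that by (auto simp: measurable_def)
  define a where "a e f = (\<integral>y. e (T y) * f y \<partial>M)" for e f :: "'a \<Rightarrow> real"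
  have eT: "e \<in> borel_measurable M" if "e \<in> B" for e
    using that B_bounded by (auto simp: bounded_measurable_def)
  have asym: "a e f = a f e" if "e \<in> B" "f \<in> B" for e f
  proof -
    have "a e f = (\<integral>y. e (T y) * f y \<partial>distr M M T)" by (simp add: a_def T(2))
    also have "\<dots> = (\<integral>y. e (T (T y)) * f (T y) \<partial>M)"
      using T(1) eT that measurable_compose[OF T(1)] by (subst integral_distr) auto
    also have "\<dots> = (\<integral>y. f (T y) * e y \<partial>M)"
      by (intro Bochner_Integration.integral_cong) (auto simp: T(3))
    finally show ?thesis by (simp add: a_def)
  qed
  have "kernel (T x) (T y) = kernel x y" if "x \<in> space M" "y \<in> space M" for x y
  proof -
    have "kernel (T x) (T y) = (\<Sum>e\<in>B. e (T x) * (\<Sum>f\<in>B. a e f * f y))"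
      unfolding kernel_def by (intro sum.cong refl) (use exp[OF _ that(2)] in \<open>simp add: a_def\<close>)
    also have "\<dots> = (\<Sum>f\<in>B. \<Sum>e\<in>B. e (T x) * (a e f * f y))"
      by (simp add: sum_distrib_left) (rule sum.swap)
    also have "\<dots> = (\<Sum>f\<in>B. (\<Sum>e\<in>B. a f e * e (T x)) * f y)"
      by (intro sum.cong refl) (auto simp: sum_distrib_right asym intro!: sum.cong)
    also have "\<dots> = (\<Sum>f\<in>B. f (T (T x)) * f y)"
      by (intro sum.cong refl) (use exp[OF _ Tsp[OF that(1)]] in \<open>simp add: a_def\<close>)
    finally show ?thesis using T(3)[OF that(1)] by (simp add: kernel_def)
  qed
  with T uv show ?thesis using that[of T] by blast
qed

text \<open>
  The diagonal of the kernel is constant because the swaps move any point to any other; its integral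
  is the trace of the identity on the span.
\<close>

lemma kernel_diag: "u \<in> space M \<Longrightarrow> kernel u u = real (card B)"
proof -
  assume u: "u \<in> space M"
  have const: "kernel x x = kernel u u" if "x \<in> space M" for x
    by (rule kernel_swap[OF u that]) (use u in metis)
  have "real (card B) = (\<Sum>e\<in>B. \<integral>x. e x * e x \<partial>M)" by (simp add: orthonormal)
  also have "\<dots> = (\<integral>x. kernel x x \<partial>M)"
    unfolding kernel_def by (subst Bochner_Integration.integral_sum) auto
  also have "\<dots> = (\<integral>x. kernel u u \<partial>M)"
    by (intro Bochner_Integration.integral_cong) (auto simp: const)
  finally show ?thesis by (simp add: prob_space)
qed

text \<open>
  The substitution \<open>w \<mapsto> T w\<close>, where \<open>T\<close> exchanges \<open>u\<close> and \<open>v\<close>, exchanges the two sides.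
\<close>

lemma kernel_cube_sym:
  assumes uv: "u \<in> space M" "v \<in> space M"
  shows "(\<integral>w. (kernel u w)\<^sup>2 * kernel v w \<partial>M) = (\<integral>w. (kernel v w)\<^sup>2 * kernel u w \<partial>M)"
proof -
  obtain T where T: "T \<in> measurable M M" "distr M M T = M" "T u = v" "T v = u"
    "\<And>x y. x \<in> space M \<Longrightarrow> y \<in> space M \<Longrightarrow> kernel (T x) (T y) = kernel x y"
    using kernel_swap[OF uv] by blast
  have [measurable]: "kernel x \<in> borel_measurable M" for x
    using kernel_bounded_measurable[of x] by (auto simp: bounded_measurable_def simp del: kernel_bounded_measurable)
  have "(\<integral>w. (kernel u w)\<^sup>2 * kernel v w \<partial>M) = (\<integral>w. (kernel u w)\<^sup>2 * kernel v w \<partial>distr M M T)"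
    by (simp add: T(2))
  also have "\<dots> = (\<integral>w. (kernel u (T w))\<^sup>2 * kernel v (T w) \<partial>M)"
    using T(1) by (subst integral_distr) auto
  also have "\<dots> = (\<integral>w. (kernel (T v) (T w))\<^sup>2 * kernel (T u) (T w) \<partial>M)"
    by (simp add: T)
  also have "\<dots> = (\<integral>w. (kernel v w)\<^sup>2 * kernel u w \<partial>M)"
    using uv by (intro Bochner_Integration.integral_cong) (auto simp: T(5))
  finally show ?thesis .
qed

text \<open>
  The functional \<open>L f = \<integral> p f\<close> is nonnegative on squares from the span. In the proof \<open>g i j\<close> is the
  orthogonal projection of \<open>i \<cdot> j\<close> to the span, and \<open>W = L ((kernel v)\<^sup>2)\<close>. The operator \<open>A\<close> with
  \<open>\<langle>A q, q\<rangle> = (\<Sum>i j. (\<integral> i j q)\<^sup>2) / D\<close>, where \<open>D = card B\<close>, satisfies \<open>0 \<le> A \<le> 1\<close>; the facts \<open>sq2\<close>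
  and \<open>sq3\<close> are the values of \<open>L\<close>, in the variable \<open>u\<close>, on \<open>D \<langle>A q, q\<rangle>\<close> for \<open>q = K_u - K_v\<close> and on
  \<open>D \<langle>(1 - A) q, q\<rangle>\<close> for \<open>q = K_u + K_v\<close>.
\<close>

theorem lower_bound_of_square_positive:
  assumes p_span: "p \<in> span_of" and p_mean: "(\<integral>x. p x \<partial>M) = 1"
    and sq_pos: "\<And>q. q \<in> span_of \<Longrightarrow> (\<integral>x. p x * (q x)\<^sup>2 \<partial>M) \<ge> 0"
    and v: "v \<in> space M"
  shows "p v \<ge> - real (card B) / 2"
proof -
  define D where "D = real (card B)"
  define L where "L f = (\<integral>x. p x * f x \<partial>M)" for f :: "'a \<Rightarrow> real"
  define I where "I f = (\<integral>x. f x \<partial>M)" for f :: "'a \<Rightarrow> real"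
  obtain c where pc: "\<And>x. x \<in> space M \<Longrightarrow> p x = (\<Sum>e\<in>B. c e * e x)"
    using p_span by (auto simp: span_of_def)
  have pBM: "p \<in> bounded_measurable M"
    by (rule bounded_measurable_cong[of "\<lambda>x. \<Sum>e\<in>B. c e * e x"]) (auto simp: pc)
  \<comment> \<open>integrating against p only sees the orthogonal projection to the span\<close>
  have Lc: "L f = (\<Sum>e\<in>B. c e * I (\<lambda>x. e x * f x))" if "f \<in> bounded_measurable M" for f
  proof -
    have "L f = I (\<lambda>x. \<Sum>e\<in>B. c e * (e x * f x))"
      unfolding L_def I_def
      by (intro Bochner_Integration.integral_cong) (auto simp: pc sum_distrib_right mult.assoc)
    then show ?thesis
      unfolding I_def using that by (subst (asm) integral_linear_combination) auto
  qed
  have LB: "L e = c e" if "e \<in> B" for e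
    using that finite_B by (simp add: Lc I_def orthonormal if_distrib[of "\<lambda>x. _ * x"] cong: if_cong)
  have L_sum: "L (\<lambda>x. \<Sum>i\<in>J. a i * f i x) = (\<Sum>i\<in>J. a i * L (f i))"
    if "\<And>i. i \<in> J \<Longrightarrow> f i \<in> bounded_measurable M" for J :: "'i set" and a f
  proof -
    have "L (\<lambda>x. \<Sum>i\<in>J. a i * f i x) = (\<integral>x. (\<Sum>i\<in>J. a i * (p x * f i x)) \<partial>M)"
      unfolding L_def by (simp add: sum_distrib_left mult_ac)
    then show ?thesis unfolding L_def using that pBM by (subst (asm) integral_linear_combination) auto
  qed
  have L_add: "L (\<lambda>x. f x + g x) = L f + L g"
    if "f \<in> bounded_measurable M" "g \<in> bounded_measurable M" for f g
    unfolding L_def using that pBM by (simp add: distrib_left bounded_measurable_mult)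
  have L_scale: "L (\<lambda>x. a * f x) = a * L f" for a f
    unfolding L_def by (simp add: mult.left_commute)
  have L_const: "L (\<lambda>x. a) = a" for a
    unfolding L_def using p_mean by simp
  have L_expand: "L (\<lambda>x. (f x + a)\<^sup>2) = L (\<lambda>x. (f x)\<^sup>2) + 2 * a * L f + a\<^sup>2"
    if "f \<in> bounded_measurable M" for f a
  proof -
    have "L (\<lambda>x. (f x + a)\<^sup>2) = L (\<lambda>x. (f x)\<^sup>2 + (2 * a * f x + a\<^sup>2))"
      by (simp add: power2_eq_square algebra_simps)
    also have "\<dots> = L (\<lambda>x. (f x)\<^sup>2) + (L (\<lambda>x. 2 * a * f x) + L (\<lambda>x. a\<^sup>2))"
      using that by (subst L_add L_add[of _ "\<lambda>x. a\<^sup>2"]; auto)+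
    finally show ?thesis using L_scale[of "2 * a" f] by (simp add: L_const)
  qed
  have pv: "(\<Sum>k\<in>B. k v * c k) = p v" using pc[OF v] by (simp add: mult.commute)
  have L_kernel: "L (kernel v) = p v"
  proof -
    have "L (kernel v) = (\<Sum>k\<in>B. k v * L k)" unfolding kernel_def[abs_def] by (rule L_sum) auto
    then show ?thesis using pv by (simp add: LB)
  qed
  have sum_sq: "(\<Sum>e\<in>B. (e x)\<^sup>2) = D" if "x \<in> space M" for x
    using kernel_diag[OF that] by (simp add: kernel_def D_def power2_eq_square)
  define G where "G i j k = I (\<lambda>x. i x * j x * k x)" for i j k
  define g where "g i j x = (\<Sum>k\<in>B. G i j k * k x)" for i j x
  have gBM [simp, intro]: "g i j \<in> bounded_measurable M" for i j unfolding g_def[abs_def] by auto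
  have g_span: "g i j \<in> span_of" for i j by (rule span_ofI[where c = "G i j"]) (simp add: g_def)
  have L_g: "L (\<lambda>x. i x * j x) = L (g i j)" if "i \<in> B" "j \<in> B" for i j
  proof -
    have "L (g i j) = (\<Sum>k\<in>B. G i j k * L k)" unfolding g_def[abs_def] by (rule L_sum) auto
    also have "\<dots> = L (\<lambda>x. i x * j x)"
      using that by (subst Lc) (auto simp: LB G_def mult_ac)
    finally show ?thesis by simp
  qed
  define W where "W = L (\<lambda>x. (kernel v x)\<^sup>2)"
  \<comment> \<open>the symmetry of the integral of K_u^2 K_v lets the point v move from the square to the projection\<close>
  have W: "W = (\<Sum>i\<in>B. \<Sum>j\<in>B. g i j v * L (g i j))"
  proof -
    define H where "H u w = I (\<lambda>x. (kernel u x)\<^sup>2 * kernel w x)" for u w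
    have H1: "H v u = (\<Sum>k\<in>B. k u * I (\<lambda>x. k x * (kernel v x)\<^sup>2))" for u
    proof -
      have "H v u = I (\<lambda>x. \<Sum>k\<in>B. k u * (k x * (kernel v x)\<^sup>2))"
        by (simp add: H_def kernel_def[of u] sum_distrib_left sum_distrib_right mult_ac)
      then show ?thesis unfolding I_def by (subst (asm) integral_linear_combination) auto
    qed
    have H2: "H u v = (\<Sum>i\<in>B. \<Sum>j\<in>B. g i j v * (i u * j u))" for u
    proof -
      have "H u v = I (\<lambda>x. \<Sum>(i,j,k)\<in>B\<times>B\<times>B. (i u * j u * k v) * (i x * j x * k x))"
        by (simp add: H_def kernel_def power2_eq_square sum_product sum_distrib_right sum_distrib_left
            mult_ac flip: sum.cartesian_product)
      also have "\<dots> = (\<Sum>(i,j,k)\<in>B\<times>B\<times>B. (i u * j u * k v) * G i j k)"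
        unfolding I_def G_def case_prod_beta by (subst integral_linear_combination) auto
      also have "\<dots> = (\<Sum>i\<in>B. \<Sum>j\<in>B. g i j v * (i u * j u))"
        by (simp add: g_def sum_distrib_left sum_distrib_right mult_ac flip: sum.cartesian_product)
      finally show ?thesis .
    qed
    have "W = (\<Sum>k\<in>B. I (\<lambda>x. k x * (kernel v x)\<^sup>2) * L k)"
      unfolding W_def by (subst Lc) (auto simp: LB mult.commute)
    also have "\<dots> = L (\<lambda>u. H v u)"
    proof -
      have "L (H v) = L (\<lambda>u. \<Sum>k\<in>B. I (\<lambda>x. k x * (kernel v x)\<^sup>2) * k u)"
        by (rule arg_cong[of _ _ L], rule ext) (simp add: H1 mult.commute)
      also have "\<dots> = (\<Sum>k\<in>B. I (\<lambda>x. k x * (kernel v x)\<^sup>2) * L k)"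
        by (rule L_sum) auto
      finally show ?thesis by simp
    qed
    also have "\<dots> = L (\<lambda>u. H u v)"
      unfolding L_def using kernel_cube_sym[OF v]
      by (intro Bochner_Integration.integral_cong) (auto simp: H_def I_def)
    also have "\<dots> = (\<Sum>i\<in>B. \<Sum>j\<in>B. g i j v * L (\<lambda>u. i u * j u))"
    proof -
      have "L (\<lambda>u. \<Sum>j\<in>B. g i j v * (i u * j u)) = (\<Sum>j\<in>B. g i j v * L (\<lambda>u. i u * j u))" if "i \<in> B" for i
        using that by (intro L_sum) auto
      then show ?thesis unfolding H2
        using L_sum[of B "\<lambda>i u. \<Sum>j\<in>B. g i j v * (i u * j u)" "\<lambda>_. 1"] by auto
    qed
    finally show ?thesis by (simp add: L_g)
  qed
  define \<Gamma> where "\<Gamma> = (\<Sum>i\<in>B. \<Sum>j\<in>B. L (\<lambda>x. (g i j x)\<^sup>2))"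
  define \<Gamma>v where "\<Gamma>v = (\<Sum>i\<in>B. \<Sum>j\<in>B. (g i j v)\<^sup>2)"
  have expand: "(\<Sum>i\<in>B. \<Sum>j\<in>B. L (\<lambda>x. (g i j x + s * g i j v)\<^sup>2)) = \<Gamma> + 2 * s * W + s\<^sup>2 * \<Gamma>v" for s
    by (simp add: L_expand \<Gamma>_def \<Gamma>v_def W sum.distrib sum_distrib_left power_mult_distrib mult_ac)
  have sq1: "0 \<le> W + D * p v + D\<^sup>2 / 4"
  proof -
    have "kernel v \<in> span_of" by (rule span_ofI[where c = "\<lambda>e. e v"]) (simp add: kernel_def)
    then have "0 \<le> L (\<lambda>x. (kernel v x + D / 2)\<^sup>2)"
      unfolding L_def by (intro sq_pos span_of_add span_of_const) auto
    then show ?thesis by (simp add: L_expand L_kernel W_def power_divide)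
  qed
  \<comment> \<open>\<open>\<langle>A q, q\<rangle>\<close> is itself a sum of squares; \<open>g i j u - g i j v\<close> is the pairing of \<open>i \<cdot> j\<close> with \<open>K_u - K_v\<close>\<close>
  have sq2: "0 \<le> \<Gamma> - 2 * W + \<Gamma>v"
  proof -
    have "0 \<le> L (\<lambda>x. (g i j x + (- 1) * g i j v)\<^sup>2)" for i j
      unfolding L_def by (intro sq_pos span_of_add g_span span_of_const)
    then have "0 \<le> (\<Sum>i\<in>B. \<Sum>j\<in>B. L (\<lambda>x. (g i j x + (- 1) * g i j v)\<^sup>2))"
      by (intro sum_nonneg)
    then show ?thesis unfolding expand by simp
  qed
  \<comment> \<open>\<open>1 - A\<close> is positive by Bessel's inequality for \<open>i q\<close>, summed over \<open>i\<close> with \<open>\<Sum>i. i\<^sup>2 = D\<close>. To keep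
    squares of functions of \<open>u\<close>, the defect in that inequality is written as the integral over \<open>w\<close> of
    the squares of \<open>\<Sum>k. s i k w \<cdot> (k u + k v)\<close>, where \<open>s i k\<close> is the part of \<open>i \<cdot> k\<close> orthogonal to the span.\<close>
  have sq3: "\<Gamma> + 2 * W + \<Gamma>v \<le> D * (2 * D + 2 * p v)"
  proof -
    define X where "X k x = k x + k v" for k :: "'a \<Rightarrow> real" and x
    define s where "s i k w = i w * k w - g i k w" for i k w
    define Y where "Y k l = L (\<lambda>x. X k x * X l x)" for k l
    have XBM [simp, intro]: "X k \<in> bounded_measurable M" if "k \<in> B" for k
      using that unfolding X_def[abs_def] by auto
    have sBM [simp, intro]: "s i k \<in> bounded_measurable M" if "i \<in> B" "k \<in> B" for i k
      using that unfolding s_def[abs_def] by auto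
    have quad: "L (\<lambda>x. (\<Sum>k\<in>B. a k * X k x)\<^sup>2) = (\<Sum>k\<in>B. \<Sum>l\<in>B. a k * a l * Y k l)" for a
    proof -
      have "L (\<lambda>x. (\<Sum>k\<in>B. a k * X k x)\<^sup>2) = L (\<lambda>x. \<Sum>(k,l)\<in>B\<times>B. (a k * a l) * (X k x * X l x))"
        by (simp add: power2_eq_square sum_product mult_ac flip: sum.cartesian_product)
      also have "\<dots> = (\<Sum>(k,l)\<in>B\<times>B. (a k * a l) * Y k l)"
        unfolding Y_def case_prod_beta by (subst L_sum) auto
      finally show ?thesis by (simp flip: sum.cartesian_product)
    qed
    have g_X: "g i j x + g i j v = (\<Sum>k\<in>B. G i j k * X k x)" for i j x
      by (simp add: g_def X_def distrib_left sum.distrib)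
    have s_int: "I (\<lambda>w. s i k w * s i l w) = I (\<lambda>w. (i w)\<^sup>2 * (k w * l w)) - (\<Sum>j\<in>B. G i j k * G i j l)"
      if "i \<in> B" "k \<in> B" "l \<in> B" for i k l
    proof -
      have sj: "I (\<lambda>w. s i k w * j w) = 0" if "j \<in> B" for j
      proof -
        have "I (\<lambda>w. s i k w * j w) = I (\<lambda>w. i w * k w * j w - (\<Sum>m\<in>B. G i k m * (m w * j w)))"
          by (simp add: s_def g_def algebra_simps sum_distrib_left)
        also have "\<dots> = G i k j - (\<Sum>m\<in>B. G i k m * I (\<lambda>w. m w * j w))"
          unfolding I_def G_def using that \<open>i \<in> B\<close> \<open>k \<in> B\<close>
          by (subst Bochner_Integration.integral_diff, force, force, subst integral_linear_combination) auto
        also have "\<dots> = 0" using that finite_B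
          by (simp add: I_def orthonormal if_distrib[of "\<lambda>x. _ * x"] cong: if_cong)
        finally show ?thesis .
      qed
      have "I (\<lambda>w. s i k w * s i l w) = I (\<lambda>w. s i k w * (i w * l w) - (\<Sum>m\<in>B. G i l m * (s i k w * m w)))"
        by (simp add: s_def[of i l] g_def[of i l] algebra_simps sum_distrib_left)
      also have "\<dots> = I (\<lambda>w. s i k w * (i w * l w)) - (\<Sum>m\<in>B. G i l m * I (\<lambda>w. s i k w * m w))"
        unfolding I_def using that
        by (subst Bochner_Integration.integral_diff, force, force, subst integral_linear_combination) auto
      also have "\<dots> = I (\<lambda>w. s i k w * (i w * l w))" by (simp add: sj)
      also have "\<dots> = I (\<lambda>w. (i w)\<^sup>2 * (k w * l w) - (\<Sum>m\<in>B. G i k m * (i w * l w * m w)))"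
        by (simp add: s_def g_def algebra_simps sum_distrib_left power2_eq_square)
      also have "\<dots> = I (\<lambda>w. (i w)\<^sup>2 * (k w * l w)) - (\<Sum>m\<in>B. G i k m * G i l m)"
        unfolding I_def G_def using that
        by (subst Bochner_Integration.integral_diff, force, force, subst integral_linear_combination) auto
      finally show ?thesis by (simp add: G_def mult_ac)
    qed
    have trace: "(\<Sum>i\<in>B. I (\<lambda>w. (i w)\<^sup>2 * (k w * l w))) = (if k = l then D else 0)"
      if "k \<in> B" "l \<in> B" for k l
    proof -
      have "(\<Sum>i\<in>B. I (\<lambda>w. (i w)\<^sup>2 * (k w * l w))) = I (\<lambda>w. \<Sum>i\<in>B. (i w)\<^sup>2 * (k w * l w))"
        unfolding I_def using that by (subst Bochner_Integration.integral_sum) auto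
      also have "\<dots> = I (\<lambda>w. D * (k w * l w))"
        unfolding I_def
        by (intro Bochner_Integration.integral_cong) (auto simp: sum_sq simp flip: sum_distrib_right)
      finally show ?thesis using that by (simp add: I_def orthonormal)
    qed
    have pos: "0 \<le> (\<Sum>k\<in>B. \<Sum>l\<in>B. I (\<lambda>w. s i k w * s i l w) * Y k l)" if "i \<in> B" for i
    proof -
      have "0 \<le> (\<Sum>k\<in>B. \<Sum>l\<in>B. s i k w * s i l w * Y k l)" for w
      proof -
        have "(\<lambda>x. \<Sum>k\<in>B. s i k w * X k x) \<in> span_of"
          unfolding X_def by (intro span_of_sum span_of_scale span_of_add span_of_B span_of_const)
        then have "0 \<le> L (\<lambda>x. (\<Sum>k\<in>B. s i k w * X k x)\<^sup>2)" unfolding L_def by (rule sq_pos)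
        then show ?thesis by (simp only: quad)
      qed
      then have "0 \<le> I (\<lambda>w. \<Sum>k\<in>B. \<Sum>l\<in>B. s i k w * s i l w * Y k l)"
        unfolding I_def by (intro integral_nonneg_AE AE_I2)
      also have "\<dots> = I (\<lambda>w. \<Sum>(k,l)\<in>B\<times>B. Y k l * (s i k w * s i l w))"
        by (simp add: mult_ac flip: sum.cartesian_product)
      also have "\<dots> = (\<Sum>(k,l)\<in>B\<times>B. Y k l * I (\<lambda>w. s i k w * s i l w))"
        unfolding I_def case_prod_beta using that by (subst integral_linear_combination) auto
      finally show ?thesis by (simp add: mult_ac flip: sum.cartesian_product)
    qed
    have "0 \<le> (\<Sum>i\<in>B. \<Sum>k\<in>B. \<Sum>l\<in>B. I (\<lambda>w. s i k w * s i l w) * Y k l)"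
      by (rule sum_nonneg) (rule pos)
    also have "\<dots> = (\<Sum>i\<in>B. \<Sum>k\<in>B. \<Sum>l\<in>B. I (\<lambda>w. (i w)\<^sup>2 * (k w * l w)) * Y k l)
                  - (\<Sum>i\<in>B. \<Sum>k\<in>B. \<Sum>l\<in>B. (\<Sum>j\<in>B. G i j k * G i j l) * Y k l)"
      by (simp add: s_int left_diff_distrib sum_subtractf)
    also have "(\<Sum>i\<in>B. \<Sum>k\<in>B. \<Sum>l\<in>B. I (\<lambda>w. (i w)\<^sup>2 * (k w * l w)) * Y k l)
      = (\<Sum>k\<in>B. \<Sum>l\<in>B. (\<Sum>i\<in>B. I (\<lambda>w. (i w)\<^sup>2 * (k w * l w))) * Y k l)"
      unfolding sum_distrib_right
      by (rule trans[OF sum.swap], intro sum.cong[OF refl] sum.swap)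
    also have "\<dots> = (\<Sum>k\<in>B. D * Y k k)"
      using finite_B by (simp add: trace if_distrib[of "\<lambda>x. x * _"] cong: if_cong)
    also have "(\<Sum>i\<in>B. \<Sum>k\<in>B. \<Sum>l\<in>B. (\<Sum>j\<in>B. G i j k * G i j l) * Y k l)
      = (\<Sum>i\<in>B. \<Sum>j\<in>B. \<Sum>k\<in>B. \<Sum>l\<in>B. G i j k * G i j l * Y k l)"
      unfolding sum_distrib_right
      by (intro sum.cong[OF refl] trans[OF sum.cong[OF refl sum.swap] sum.swap])
    also have "\<dots> = (\<Sum>i\<in>B. \<Sum>j\<in>B. L (\<lambda>x. (g i j x + 1 * g i j v)\<^sup>2))"
      by (simp add: g_X quad)
    also have "\<dots> = \<Gamma> + 2 * W + \<Gamma>v" unfolding expand by simp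
    also have "(\<Sum>k\<in>B. D * Y k k) = D * (2 * D + 2 * p v)"
    proof -
      have "(\<Sum>k\<in>B. Y k k) = (\<Sum>k\<in>B. L (\<lambda>x. (k x)\<^sup>2) + 2 * (k v * c k) + (k v)\<^sup>2)"
        by (intro sum.cong refl)
           (use L_expand in \<open>simp add: Y_def X_def LB mult_ac flip: power2_eq_square\<close>)
      also have "\<dots> = (\<Sum>k\<in>B. 1 * L (\<lambda>x. (k x)\<^sup>2)) + 2 * p v + D"
        by (simp add: sum.distrib pv sum_sq[OF v] flip: sum_distrib_left)
      also have "(\<Sum>k\<in>B. 1 * L (\<lambda>x. (k x)\<^sup>2)) = L (\<lambda>x. \<Sum>k\<in>B. 1 * (k x)\<^sup>2)"
        by (subst L_sum) auto
      also have "\<dots> = D"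
      proof -
        have "L (\<lambda>x. \<Sum>k\<in>B. 1 * (k x)\<^sup>2) = L (\<lambda>x. D)"
          unfolding L_def by (intro Bochner_Integration.integral_cong) (auto simp: sum_sq)
        then show ?thesis by (simp add: L_const)
      qed
      finally show ?thesis by (simp flip: sum_distrib_left)
    qed
    finally show ?thesis by simp
  qed
  have "D > 0"
  proof -
    have "B \<noteq> {}" using one_spanned[OF v] by auto
    then show ?thesis using finite_B by (simp add: D_def card_gt_0_iff)
  qed
  have "0 \<le> 6 * D * p v + 3 * D\<^sup>2"
    using sq1 sq2 sq3 by (simp add: algebra_simps power2_eq_square)
  also have "\<dots> = 6 * D * (p v + D / 2)" by (simp add: algebra_simps power2_eq_square)
  finally have "0 \<le> p v + D / 2" using \<open>D > 0\<close> by (simp add: zero_le_mult_iff)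
  then show ?thesis by (simp add: D_def)
qed

end


section \<open>Orthogonal invariance of Lebesgue measure\<close>

text \<open>
  Uniqueness of Haar measure. The integral of \<open>indicator A x * indicator B (x + y)\<close> over both
  variables is computed in two ways: the translation \<open>y \<mapsto> x + y\<close> makes it the left-hand side, the
  translation \<open>x \<mapsto> x - y\<close> the right-hand side.
\<close>

lemma translation_invariant_measure_proportional:
  fixes N :: "'a::euclidean_space measure"
  assumes sets_N [measurable_cong]: "sets N = sets borel" and "sigma_finite_measure N"
    and inv: "\<And>a. distr N borel ((+) a) = N"
    and [measurable]: "A \<in> sets borel" "B \<in> sets borel"
  shows "emeasure N A * emeasure lborel B = emeasure N B * emeasure lborel A"
proof -
  interpret N: sigma_finite_measure N by fact
  interpret pair_sigma_finite N lborel ..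
  have reflect: "distr lborel borel (\<lambda>y. x - y) = (lborel :: 'a measure)" for x
    using lborel_affine[of "-1" x] by (simp add: density_1)
  have 1: "(\<integral>\<^sup>+y. indicator B (x + y) \<partial>lborel) = emeasure lborel B" for x
  proof -
    have "emeasure lborel B = (\<integral>\<^sup>+y. indicator B y \<partial>distr lborel borel ((+) x))"
      by (simp add: lborel_distr_plus)
    then show ?thesis by (subst (asm) nn_integral_distr) auto
  qed
  have 2: "(\<integral>\<^sup>+y. indicator A (x - y) \<partial>lborel) = emeasure lborel A" for x
  proof -
    have "emeasure lborel A = (\<integral>\<^sup>+y. indicator A y \<partial>distr lborel borel ((-) x))"
      by (simp add: reflect)
    then show ?thesis by (subst (asm) nn_integral_distr) auto
  qed
  have 3: "(\<integral>\<^sup>+x. indicator A x * indicator B (x + y) \<partial>N) = (\<integral>\<^sup>+x. indicator A (x - y) * indicator B x \<partial>N)" for y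
  proof -
    have "(\<integral>\<^sup>+x. indicator A x * indicator B (x + y) \<partial>N)
        = (\<integral>\<^sup>+x. indicator A x * indicator B (x + y) \<partial>distr N borel ((+) (- y)))"
      by (simp add: inv)
    also have "\<dots> = (\<integral>\<^sup>+x. indicator A (x - y) * indicator B x \<partial>N)"
      by (subst nn_integral_distr) auto
    finally show ?thesis .
  qed
  have "emeasure N A * emeasure lborel B = (\<integral>\<^sup>+x. indicator A x * (\<integral>\<^sup>+y. indicator B (x + y) \<partial>lborel) \<partial>N)"
    by (simp add: 1 nn_integral_multc sets_N)
  also have "\<dots> = (\<integral>\<^sup>+x. (\<integral>\<^sup>+y. indicator A x * indicator B (x + y) \<partial>lborel) \<partial>N)"
    by (simp add: nn_integral_cmult)
  also have "\<dots> = (\<integral>\<^sup>+y. (\<integral>\<^sup>+x. indicator A x * indicator B (x + y) \<partial>N) \<partial>lborel)"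
    by (rule Fubini'[symmetric]) simp
  also have "\<dots> = (\<integral>\<^sup>+y. (\<integral>\<^sup>+x. indicator A (x - y) * indicator B x \<partial>N) \<partial>lborel)"
    by (simp only: 3)
  also have "\<dots> = (\<integral>\<^sup>+x. (\<integral>\<^sup>+y. indicator A (x - y) * indicator B x \<partial>lborel) \<partial>N)"
    by (rule Fubini') simp
  also have "\<dots> = (\<integral>\<^sup>+x. (\<integral>\<^sup>+y. indicator A (x - y) \<partial>lborel) * indicator B x \<partial>N)"
    by (simp add: nn_integral_multc)
  also have "\<dots> = emeasure N B * emeasure lborel A"
    by (simp add: 2 nn_integral_cmult nn_integral_multc sets_N mult.commute)
  finally show ?thesis .
qed

text \<open>
  The image measure is again translation invariant, hence a multiple of Lebesgue measure. The unit
  ball, which \<open>T\<close> preserves, shows that the factor is 1.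
\<close>

lemma lborel_distr_orthogonal:
  fixes T :: "'a::euclidean_space \<Rightarrow> 'a"
  assumes T: "orthogonal_transformation T"
  shows "distr lborel borel T = lborel"
proof -
  have lin: "linear T" and norm_T: "norm (T x) = norm x" for x
    using T by (auto simp: orthogonal_transformation)
  have T_measurable [measurable]: "T \<in> borel_measurable borel"
    using lin by (intro borel_measurable_continuous_onI linear_continuous_on linear_conv_bounded_linear[THEN iffD1])
  let ?N = "distr lborel borel T"
  have ball: "emeasure ?N (ball 0 r) = emeasure lborel (ball 0 r :: 'a set)" for r
  proof -
    have "T -` ball 0 r = (ball 0 r :: 'a set)" by (auto simp: norm_T)
    then show ?thesis by (subst emeasure_distr) auto
  qed
  have sf: "sigma_finite_measure ?N"
  proof
    show "\<exists>A. countable A \<and> A \<subseteq> sets ?N \<and> \<Union> A = space ?N \<and> (\<forall>a\<in>A. emeasure ?N a \<noteq> \<infinity>)"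
    proof (intro exI[of _ "range (\<lambda>n::nat. ball 0 (real n))"] conjI ballI)
      show "\<Union> (range (\<lambda>n::nat. ball (0::'a) (real n))) = space ?N"
        by (auto simp: reals_Archimedean2)
      show "emeasure ?N a \<noteq> \<infinity>" if "a \<in> range (\<lambda>n::nat. ball (0::'a) (real n))" for a
        using that ball emeasure_lborel_ball_finite[where c = "0::'a"] by (auto simp: less_top)
    qed auto
  qed
  have inv: "distr ?N borel ((+) a) = ?N" for a
  proof -
    obtain b where b: "T b = a" using orthogonal_transformation_surj[OF T] by (metis surjD)
    have "distr ?N borel ((+) a) = distr lborel borel (\<lambda>x. T (b + x))"
      by (subst distr_distr) (auto simp: comp_def linear_add[OF lin] b)
    also have "\<dots> = distr (distr lborel borel ((+) b)) borel T"
      by (subst distr_distr) (auto simp: comp_def)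
    finally show ?thesis by (simp add: lborel_distr_plus)
  qed
  show ?thesis
  proof (rule measure_eqI)
    fix A assume "A \<in> sets ?N"
    then have A: "A \<in> sets borel" by simp
    have "emeasure ?N A * emeasure lborel (ball 0 1 :: 'a set) = emeasure ?N (ball 0 1) * emeasure lborel A"
      by (rule translation_invariant_measure_proportional[OF _ sf inv A]) auto
    then have "emeasure lborel (ball 0 1 :: 'a set) * emeasure ?N A = emeasure lborel (ball 0 1 :: 'a set) * emeasure lborel A"
      by (simp only: ball mult.commute)
    moreover have "emeasure lborel (ball 0 1 :: 'a set) \<noteq> 0" 
      using open_not_negligible[of "ball 0 1 :: 'a set"]
      by (auto simp: negligible_iff_null_sets null_sets_completionI null_sets_def)
    moreover have "emeasure lborel (ball 0 1 :: 'a set) < \<infinity>" by (rule emeasure_lborel_ball_finite)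
    ultimately show "emeasure ?N A = emeasure lborel A"
      by (simp add: ennreal_mult_cancel_left less_top[symmetric])
  qed simp
qed

lemma open_null_empty:
  fixes S :: "'a::euclidean_space set"
  assumes "open S" "S \<in> null_sets lborel"
  shows "S = {}"
  using assms open_not_negligible[of S] by (auto simp: negligible_iff_null_sets null_sets_completionI)


section \<open>The normalized measure on the sphere\<close>

lemma borel_measurable_sgn_vec [measurable]:
  "(sgn :: 'a::euclidean_space \<Rightarrow> 'a) \<in> borel_measurable borel"
  unfolding sgn_div_norm[abs_def] by measurable

lemma sgn_orthogonal:
  assumes "orthogonal_transformation T"
  shows "sgn (T x) = T (sgn x)"
  using assms by (simp add: sgn_div_norm orthogonal_transformation linear_scale)

abbreviation unit_ball_measure :: "(real ^ 'n::finite) measure" where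
  "unit_ball_measure \<equiv> uniform_measure lborel (ball 0 1)"

lemma emeasure_unit_ball: 
  "emeasure lborel (ball (0::real ^ 'n::finite) 1) \<noteq> 0" "emeasure lborel (ball (0::real ^ 'n::finite) 1) < \<infinity>"
proof -
  show "emeasure lborel (ball (0::real ^ 'n) 1) \<noteq> 0"
    using open_null_empty[of "ball (0::real ^ 'n) 1"] by (auto simp: null_sets_def)
  show "emeasure lborel (ball (0::real ^ 'n) 1) < \<infinity>"
    by (rule emeasure_lborel_ball_finite)
qed

lemma prob_space_unit_ball: "prob_space (unit_ball_measure :: (real ^ 'n::finite) measure)"
  using emeasure_unit_ball[where 'n='n] by (intro prob_space_uniform_measure) (auto simp: less_top)

lemma space_sphere_measure [simp]: "space (sphere_measure :: (real ^ 'n::finite) measure) = unit_sphere"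
  by (simp add: sphere_measure_def space_restrict_space)

lemma sets_sphere_measure: "sets (sphere_measure :: (real ^ 'n::finite) measure) = sets (restrict_space borel unit_sphere)"
  unfolding sphere_measure_def by (rule sets_restrict_space_cong) simp

lemma emeasure_sphere_measure:
  fixes A :: "(real ^ 'n::finite) set"
  assumes "A \<in> sets sphere_measure"
  shows "emeasure sphere_measure A = emeasure unit_ball_measure (sgn -` A)" "A \<in> sets borel"
proof -
  have "A \<in> sets (restrict_space borel unit_sphere)" using assms sets_sphere_measure by blast
  then have A: "A \<in> sets borel" "A \<subseteq> unit_sphere"
    by (auto simp: sets_restrict_space_iff)
  then show "A \<in> sets borel" by simp
  show "emeasure sphere_measure A = emeasure unit_ball_measure (sgn -` A)"
    unfolding sphere_measure_def using A
    by (subst emeasure_restrict_space) (auto simp: emeasure_distr)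
qed

lemma AE_unit_ball_sgn: "AE x in unit_ball_measure. sgn x \<in> (unit_sphere :: (real ^ 'n::finite) set)"
proof -
  have "AE x in lborel. x \<noteq> (0 :: real ^ 'n)"
    using AE_lborel_singleton by blast
  then have "AE x in lborel. x \<in> ball 0 1 \<longrightarrow> sgn x \<in> (unit_sphere :: (real ^ 'n) set)"
    by eventually_elim (simp add: norm_sgn)
  then show ?thesis by (intro AE_uniform_measureI) auto
qed

lemma prob_space_sphere_measure: "prob_space (sphere_measure :: (real ^ 'n::finite) measure)"
proof
  interpret U: prob_space "unit_ball_measure :: (real ^ 'n) measure" by (rule prob_space_unit_ball)
  have "emeasure (sphere_measure :: (real ^ 'n) measure) (space sphere_measure)
      = emeasure unit_ball_measure (sgn -` (unit_sphere :: (real ^ 'n) set))"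
    using emeasure_sphere_measure(1)[OF sets.top[of "sphere_measure :: (real ^ 'n) measure"]]
    by (simp only: space_sphere_measure)
  also have "\<dots> = emeasure unit_ball_measure (space (unit_ball_measure :: (real ^ 'n) measure))"
    using AE_unit_ball_sgn measurable_sets_borel[OF borel_measurable_sgn_vec borel_closed[OF closed_sphere]]
    by (intro emeasure_eq_AE) auto
  also have "\<dots> = 1" by (rule U.emeasure_space_1)
  finally show "emeasure (sphere_measure :: (real ^ 'n) measure) (space sphere_measure) = 1" .
qed

lemma unit_ball_measure_distr_orthogonal:
  fixes T :: "real ^ 'n::finite \<Rightarrow> real ^ 'n"
  assumes T: "orthogonal_transformation T" and A: "A \<in> sets borel"
  shows "emeasure unit_ball_measure (T -` A) = emeasure unit_ball_measure A"
proof -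
  have lin: "linear T" and norm_T: "norm (T x) = norm x" for x
    using T by (auto simp: orthogonal_transformation)
  have T_measurable [measurable]: "T \<in> borel_measurable borel"
    using lin by (intro borel_measurable_continuous_onI linear_continuous_on linear_conv_bounded_linear[THEN iffD1])
  have TA: "T -` A \<in> sets borel" using A by (rule measurable_sets_borel[OF T_measurable])
  have "emeasure lborel (ball 0 1 \<inter> A) = emeasure (distr lborel borel T) (ball 0 1 \<inter> A)"
    by (simp add: lborel_distr_orthogonal[OF T])
  also have "\<dots> = emeasure lborel (T -` (ball 0 1 \<inter> A))"
    using A by (subst emeasure_distr) auto
  also have "T -` (ball 0 1 \<inter> A) = ball 0 1 \<inter> T -` A" by (auto simp: norm_T)
  finally show ?thesis using A TA by simp
qed

lemma sphere_measure_distr_orthogonal: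
  fixes T :: "real ^ 'n::finite \<Rightarrow> real ^ 'n"
  assumes T: "orthogonal_transformation T"
  shows "T \<in> measurable sphere_measure sphere_measure" "distr sphere_measure sphere_measure T = sphere_measure"
proof -
  have lin: "linear T" and norm_T: "norm (T x) = norm x" for x
    using T by (auto simp: orthogonal_transformation)
  have T_measurable [measurable]: "T \<in> borel_measurable borel"
    using lin by (intro borel_measurable_continuous_onI linear_continuous_on linear_conv_bounded_linear[THEN iffD1])
  have "T \<in> measurable (restrict_space borel unit_sphere) (restrict_space borel unit_sphere)"
    by (intro measurable_restrict_space3) (auto simp: norm_T)
  then show Tm: "T \<in> measurable sphere_measure sphere_measure"
    using measurable_cong_sets[OF sets_sphere_measure sets_sphere_measure] by blast
  show "distr sphere_measure sphere_measure T = sphere_measure"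
  proof (rule measure_eqI)
    fix A assume "A \<in> sets (distr sphere_measure sphere_measure T)"
    then have A: "A \<in> sets sphere_measure" by simp
    note A' = emeasure_sphere_measure[OF A]
    have TA: "T -` A \<inter> unit_sphere \<in> sets sphere_measure"
      using measurable_sets[OF Tm A] by simp
    have "A \<subseteq> unit_sphere" using sets.sets_into_space[OF A] by simp
    then have "T -` A \<inter> unit_sphere = T -` A" by (auto simp: norm_T)
    then have "emeasure (distr sphere_measure sphere_measure T) A = emeasure unit_ball_measure (sgn -` (T -` A))"
      using TA emeasure_sphere_measure(1)[OF TA] by (simp add: emeasure_distr[OF Tm A])
    also have "sgn -` (T -` A) = T -` (sgn -` A)" by (auto simp: sgn_orthogonal[OF T])
    also have "emeasure unit_ball_measure (T -` (sgn -` A)) = emeasure unit_ball_measure (sgn -` A)"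
      using A'(2) by (intro unit_ball_measure_distr_orthogonal[OF T] measurable_sets_borel) auto
    finally show "emeasure (distr sphere_measure sphere_measure T) A = emeasure sphere_measure A"
      by (simp add: A')
  qed simp
qed

lemma continuous_bounded_measurable_sphere:
  fixes f :: "real ^ 'n::finite \<Rightarrow> real"
  assumes "continuous_on UNIV f"
  shows "f \<in> borel_measurable sphere_measure" "\<exists>C. \<forall>x\<in>space sphere_measure. \<bar>f x\<bar> \<le> C"
proof -
  have "f \<in> borel_measurable borel" using assms by (rule borel_measurable_continuous_onI)
  then have "f \<in> borel_measurable (restrict_space borel unit_sphere)"
    by (rule measurable_restrict_space1)
  then show "f \<in> borel_measurable sphere_measure"
    using measurable_cong_sets[OF sets_sphere_measure refl] by blast
  have "compact (f ` unit_sphere)"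
    by (intro compact_continuous_image) (auto intro: continuous_on_subset[OF assms])
  then show "\<exists>C. \<forall>x\<in>space sphere_measure. \<bar>f x\<bar> \<le> C"
    using compact_imp_bounded[of "f ` unit_sphere"] by (auto simp: bounded_iff)
qed

text \<open>
  The points of the punctured unit ball whose radial projection avoids the zeros of \<open>f\<close> form a set
  that is both open and null, hence empty.
\<close>

lemma continuous_AE_zero_sphere:
  fixes f :: "real ^ 'n::finite \<Rightarrow> real"
  assumes f: "continuous_on UNIV f" and ae: "AE u in sphere_measure. f u = 0" and u: "u \<in> unit_sphere"
  shows "f u = 0"
proof -
  have [measurable]: "f \<in> borel_measurable borel" using f by (rule borel_measurable_continuous_onI)
  define S where "S = {x \<in> ball 0 1 - {0}. f (sgn x) \<noteq> 0}"
  have "continuous_on (ball 0 1 - {0}) (\<lambda>x. f (sgn x))"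
    by (rule continuous_on_compose2[OF f]) (auto simp: sgn_div_norm intro!: continuous_intros)
  then have "open ((ball 0 1 - {0}) \<inter> (\<lambda>x. f (sgn x)) -` (- {0}))"
    by (rule continuous_open_preimage) (auto simp: open_Compl)
  also have "(ball 0 1 - {0}) \<inter> (\<lambda>x. f (sgn x)) -` (- {0}) = S" by (auto simp: S_def)
  finally have "open S" .
  have "S \<in> null_sets lborel"
  proof -
    let ?N = "{x \<in> unit_sphere. f x \<noteq> 0}"
    have N: "?N \<in> sets sphere_measure"
    proof -
      have "{x \<in> space sphere_measure. f x \<noteq> 0} \<in> sets sphere_measure"
        using continuous_bounded_measurable_sphere(1)[OF f] by measurable
      then show ?thesis by simp
    qed
    have "emeasure sphere_measure ?N = 0"
      using AE_iff_measurable[OF N, of "\<lambda>x. f x = 0"] ae by simp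
    then have "emeasure unit_ball_measure (sgn -` ?N) = 0" using emeasure_sphere_measure(1)[OF N] by simp
    moreover have [measurable]: "sgn -` ?N \<in> sets borel"
      using emeasure_sphere_measure(2)[OF N] by (intro measurable_sets_borel[OF borel_measurable_sgn_vec])
    ultimately have "emeasure lborel (ball 0 1 \<inter> sgn -` ?N) = 0"
      using emeasure_unit_ball[where 'n='n] by (simp add: ennreal_divide_eq_0_iff less_top[symmetric])
    moreover have S_eq: "S = (ball 0 1 - {0}) \<inter> sgn -` ?N" by (auto simp: S_def norm_sgn)
    moreover have "emeasure lborel S \<le> emeasure lborel (ball 0 1 \<inter> sgn -` ?N)"
      using S_eq by (intro emeasure_mono) auto
    ultimately show ?thesis using \<open>open S\<close> by (auto simp: null_sets_def)
  qed
  then have "u /\<^sub>R 2 \<notin> S" using \<open>open S\<close> open_null_empty by blast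
  moreover have "sgn (u /\<^sub>R 2) = u" using u by (simp add: sgn_div_norm)
  moreover have "u /\<^sub>R 2 \<in> ball 0 1 - {0}" using u by auto
  ultimately show ?thesis by (simp add: S_def)
qed


section \<open>Forms as functions on the sphere\<close>

definition monomial :: "'n multiset \<Rightarrow> real ^ 'n::finite \<Rightarrow> real" where
  "monomial M v = (\<Prod>i\<in>#M. v $ i)"

lemma monomial_add: "monomial (M + N) v = monomial M v * monomial N v"
  by (simp add: monomial_def)

lemma mpoly_eval_superset:
  assumes "finite S" "Poly_Mapping.keys p \<subseteq> S"
  shows "mpoly_eval p v = (\<Sum>M\<in>S. Poly_Mapping.lookup p M * monomial M v)"
  unfolding mpoly_eval_def monomial_def using assms
  by (intro sum.mono_neutral_left) (auto simp: in_keys_iff)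

lemma mpoly_eval_add [simp]: "mpoly_eval (p + q) v = mpoly_eval p v + mpoly_eval q v"
proof -
  let ?S = "Poly_Mapping.keys p \<union> Poly_Mapping.keys q"
  have "Poly_Mapping.keys (p + q) \<subseteq> ?S" by (rule keys_add)
  then show ?thesis
    by (simp add: mpoly_eval_superset[of ?S] lookup_add distrib_right sum.distrib)
qed

lemma mpoly_eval_zero [simp]: "mpoly_eval 0 v = 0"
  by (simp add: mpoly_eval_def)

lemma mpoly_eval_sum: "mpoly_eval (\<Sum>i\<in>I. p i) v = (\<Sum>i\<in>I. mpoly_eval (p i) v)"
  by (induction I rule: infinite_finite_induct) auto

lemma mpoly_eval_single: "mpoly_eval (Poly_Mapping.single M c) v = c * monomial M v"
  by (simp add: mpoly_eval_def monomial_def)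

lemma mpoly_sum_single:
  "p = (\<Sum>M\<in>Poly_Mapping.keys p. Poly_Mapping.single M (Poly_Mapping.lookup p M))"
  by (rule poly_mapping_eqI) (auto simp: lookup_sum lookup_single when_def in_keys_iff)

lemma mpoly_eval_mult [simp]: "mpoly_eval (p * q) v = mpoly_eval p v * mpoly_eval q v"
proof -
  have "p * q = (\<Sum>M\<in>Poly_Mapping.keys p. \<Sum>N\<in>Poly_Mapping.keys q.
      Poly_Mapping.single (M + N) (Poly_Mapping.lookup p M * Poly_Mapping.lookup q N))"
    by (subst mpoly_sum_single[of p], subst mpoly_sum_single[of q])
       (simp add: sum_product mult_single)
  then show ?thesis
    by (simp add: mpoly_eval_sum mpoly_eval_single monomial_add mpoly_eval_superset[OF finite_keys order_refl, of p]
        mpoly_eval_superset[OF finite_keys order_refl, of q] sum_product mult_ac)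
qed

lemma const_one: "const 1 = 1"
  by (simp add: const_def)

lemma mpoly_eval_one [simp]: "mpoly_eval 1 v = 1"
  using mpoly_eval_single[of "{#}" 1 v] by (simp add: monomial_def)

lemma mpoly_eval_power [simp]: "mpoly_eval (p ^ k) v = mpoly_eval p v ^ k"
  by (induction k) auto

lemma mpoly_eval_const [simp]: "mpoly_eval (const c) v = c"
  by (simp add: const_def mpoly_eval_single monomial_def)

lemma mpoly_eval_var [simp]: "mpoly_eval (var i) v = v $ i"
  by (simp add: var_def mpoly_eval_single monomial_def)

lemma forms_zero: "0 \<in> forms m" by (simp add: forms_def)

lemma forms_add: "p \<in> forms m \<Longrightarrow> q \<in> forms m \<Longrightarrow> p + q \<in> forms m"
  using keys_add[of p q] by (auto simp: forms_def)

lemma forms_sum: "(\<And>i. i \<in> I \<Longrightarrow> p i \<in> forms m) \<Longrightarrow> (\<Sum>i\<in>I. p i) \<in> forms m"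
  by (induction I rule: infinite_finite_induct) (auto intro: forms_zero forms_add)

lemma forms_mult: "p \<in> forms m \<Longrightarrow> q \<in> forms k \<Longrightarrow> p * q \<in> forms (m + k)"
  using keys_mult[of p q] by (fastforce simp: forms_def)

lemma forms_const: "const c \<in> forms 0"
  by (auto simp: forms_def const_def split: if_splits)

lemma forms_var: "var i \<in> forms 1"
  by (auto simp: forms_def var_def)

lemma forms_power: "p \<in> forms m \<Longrightarrow> p ^ k \<in> forms (m * k)"
proof (induction k)
  case 0
  then show ?case using forms_const[of 1] by (simp add: const_one)
next
  case (Suc k)
  then show ?case using forms_mult[of p m "p ^ k" "m * k"] by simp
qed

lemma forms_scale: "p \<in> forms m \<Longrightarrow> const c * p \<in> forms m"
  using forms_mult[OF forms_const] by fastforce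

lemma forms_diff: 
  assumes "p \<in> forms m" "q \<in> forms m" shows "p - q \<in> forms m"
proof -
  have "const (-1) + const 1 = (0 :: 'a mpoly)" unfolding const_def single_add[symmetric] by simp
  then have "(const (-1) + 1) * q = 0" by (simp add: const_one)
  then have "- q = const (-1) * q" by (intro minus_unique) (simp add: distrib_right add.commute)
  then have "p - q = p + const (-1) * q" by (metis diff_conv_add_uminus)
  then show ?thesis by (simp only: forms_add[OF assms(1) forms_scale[OF assms(2)]])
qed

lemma mpoly_eval_diff [simp]: "mpoly_eval (p - q) v = mpoly_eval p v - mpoly_eval q v"
  using mpoly_eval_add[of "p - q" q v] by simp

lemma norm_form_form: "(norm_form d :: 'n::finite mpoly) \<in> forms (2 * d)"
proof -
  have "var i ^ 2 \<in> forms 2" for i :: 'n using forms_power[OF forms_var, of i 2] by simp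
  then have "(\<Sum>i\<in>UNIV. var i ^ 2 :: 'n mpoly) \<in> forms 2" by (intro forms_sum)
  then show ?thesis unfolding norm_form_def by (rule forms_power)
qed

lemma mpoly_eval_norm_form: "mpoly_eval (norm_form d) v = (norm v)\<^sup>2 ^ d"
  by (simp add: norm_form_def mpoly_eval_sum norm_vec_def L2_set_def sum_nonneg)

lemma continuous_mpoly_eval: "continuous_on UNIV (mpoly_eval p)"
proof -
  have "continuous_on UNIV (monomial M)" for M :: "'a multiset"
  proof (induction M)
    case empty then show ?case by (simp add: monomial_def[abs_def])
  next
    case (add x M)
    have "monomial (add_mset x M) = (\<lambda>v. v $ x * monomial M v)" by (auto simp: monomial_def)
    then show ?case using add by (auto intro!: continuous_intros)
  qed
  then have "continuous_on UNIV (\<lambda>v. \<Sum>M\<in>Poly_Mapping.keys p. Poly_Mapping.lookup p M * monomial M v)"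
    by (intro continuous_intros)
  then show ?thesis by (simp add: mpoly_eval_def[abs_def] monomial_def)
qed

text \<open>
  Substitute for each variable the linear form that is the corresponding coordinate of \<open>T\<close>.
\<close>

lemma mpoly_eval_linear_change:
  fixes T :: "real ^ 'n::finite \<Rightarrow> real ^ 'n"
  assumes "linear T" "p \<in> forms m"
  shows "\<exists>q\<in>forms m. \<forall>v. mpoly_eval q v = mpoly_eval p (T v)"
proof -
  define l where "l i = (\<Sum>j\<in>UNIV. const (matrix T $ i $ j) * var j)" for i
  have l: "l i \<in> forms 1" "mpoly_eval (l i) v = T v $ i" for i v
  proof -
    show "l i \<in> forms 1" unfolding l_def by (intro forms_sum forms_scale forms_var)
    have "T v $ i = (matrix T *v v) $ i" using assms(1) by (simp add: matrix_works)
    then show "mpoly_eval (l i) v = T v $ i"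
      by (simp add: l_def mpoly_eval_sum matrix_vector_mult_def)
  qed
  have mon: "\<exists>q\<in>forms (size M). \<forall>v. mpoly_eval q v = monomial M (T v)" for M
  proof (induction M)
    case empty
    then show ?case using forms_const[of 1] by (intro bexI[of _ "const 1"]) (auto simp: monomial_def)
  next
    case (add x M)
    then obtain q where q: "q \<in> forms (size M)" "\<forall>v. mpoly_eval q v = monomial M (T v)" by blast
    then have "l x * q \<in> forms (size (add_mset x M))" using forms_mult[OF l(1) q(1)] by simp
    then show ?case using q by (intro bexI[of _ "l x * q"]) (auto simp: monomial_def l)
  qed
  then obtain Q where Q: "\<And>M. Q M \<in> forms (size M)" "\<And>M v. mpoly_eval (Q M) v = monomial M (T v)"
    by metis
  have "(\<Sum>M\<in>Poly_Mapping.keys p. const (Poly_Mapping.lookup p M) * Q M) \<in> forms m"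
    using assms(2) Q(1) by (intro forms_sum forms_scale) (auto simp: forms_def)
  moreover have "mpoly_eval (\<Sum>M\<in>Poly_Mapping.keys p. const (Poly_Mapping.lookup p M) * Q M) v = mpoly_eval p (T v)" for v
    by (simp add: mpoly_eval_sum Q mpoly_eval_def[of p] monomial_def)
  ultimately show ?thesis by blast
qed

definition form_functions :: "nat \<Rightarrow> (real ^ 'n::finite \<Rightarrow> real) set" where
  "form_functions m = mpoly_eval ` forms m"

lemma form_functions_add: "f \<in> form_functions m \<Longrightarrow> g \<in> form_functions m \<Longrightarrow> (\<lambda>x. f x + g x) \<in> form_functions m"
proof -
  assume "f \<in> form_functions m" "g \<in> form_functions m"
  then obtain p q where "p \<in> forms m" "q \<in> forms m" "f = mpoly_eval p" "g = mpoly_eval q"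
    unfolding form_functions_def by blast
  then show ?thesis unfolding form_functions_def
    by (intro image_eqI[of _ _ "p + q"] forms_add) (auto simp: fun_eq_iff)
qed

lemma form_functions_scale: "f \<in> form_functions m \<Longrightarrow> (\<lambda>x. c * f x) \<in> form_functions m"
proof -
  assume "f \<in> form_functions m"
  then obtain p where "p \<in> forms m" "f = mpoly_eval p" unfolding form_functions_def by blast
  then show ?thesis unfolding form_functions_def
    by (intro image_eqI[of _ _ "const c * p"] forms_scale) (auto simp: fun_eq_iff)
qed

lemma form_functions_bounded_measurable: "form_functions m \<subseteq> bounded_measurable sphere_measure"
proof
  fix f :: "real ^ 'n \<Rightarrow> real" assume "f \<in> form_functions m"
  then have "continuous_on UNIV f" by (auto simp: form_functions_def continuous_mpoly_eval)
  then show "f \<in> bounded_measurable sphere_measure"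
    using continuous_bounded_measurable_sphere[of f] by (auto simp: bounded_measurable_def)
qed

text \<open>
  The expansion is required only on \<open>space M\<close>, so that functions which agree there need not be equal.
  A function in the span of its predecessors leaves a remainder of norm zero, which is why only
  \<open>card B \<le> card S\<close> is claimed.
\<close>

lemma gram_schmidt:
  fixes M :: "'a measure" and V :: "('a \<Rightarrow> real) set"
  assumes "prob_space M"
    and V_bm: "V \<subseteq> bounded_measurable M"
    and V_add: "\<And>f g. f \<in> V \<Longrightarrow> g \<in> V \<Longrightarrow> (\<lambda>x. f x + g x) \<in> V"
    and V_scale: "\<And>f c. f \<in> V \<Longrightarrow> (\<lambda>x. c * f x) \<in> V"
    and V_definite: "\<And>f x. f \<in> V \<Longrightarrow> (\<integral>x. f x * f x \<partial>M) = 0 \<Longrightarrow> x \<in> space M \<Longrightarrow> f x = 0"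
    and "finite S" "S \<subseteq> V"
  shows "\<exists>B. finite B \<and> card B \<le> card S \<and> B \<subseteq> V \<and>
    (\<forall>e\<in>B. \<forall>f\<in>B. (\<integral>x. e x * f x \<partial>M) = (if e = f then 1 else 0)) \<and>
    (\<forall>s\<in>S. \<forall>x\<in>space M. s x = (\<Sum>e\<in>B. (\<integral>y. s y * e y \<partial>M) * e x))"
  using \<open>finite S\<close> \<open>S \<subseteq> V\<close>
proof (induction S rule: finite_induct)
  case empty
  then show ?case by (intro exI[of _ "{}"]) auto
next
  case (insert s S)
  interpret prob_space M by fact
  obtain B where B: "finite B" "card B \<le> card S" "B \<subseteq> V"
    and on: "\<And>e f. e \<in> B \<Longrightarrow> f \<in> B \<Longrightarrow> (\<integral>x. e x * f x \<partial>M) = (if e = f then 1 else 0)"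
    and exp: "\<And>s x. s \<in> S \<Longrightarrow> x \<in> space M \<Longrightarrow> s x = (\<Sum>e\<in>B. (\<integral>y. s y * e y \<partial>M) * e x)"
    using insert.IH insert.prems by blast
  have sV: "s \<in> V" and SV: "S \<subseteq> V" using insert.prems by auto
  have bm [simp]: "f \<in> bounded_measurable M" if "f \<in> V" for f using that V_bm by blast
  have bmB [simp]: "f \<in> bounded_measurable M" if "f \<in> B" for f using that B(3) by auto
  have int [simp]: "integrable M f" if "f \<in> bounded_measurable M" for f
    using that by (rule bounded_measurable_integrable)
  have V_zero: "(\<lambda>x. 0) \<in> V" using V_scale[OF sV, of 0] by simp
  have V_sum: "(\<lambda>x. \<Sum>e\<in>A. c e * e x) \<in> V" if "A \<subseteq> B" for c A
  proof -
    have "finite A" using that B(1) by (rule finite_subset)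
    then show ?thesis using that
    proof (induction A rule: finite_induct)
      case (insert a A)
      then have a: "a \<in> V" and A: "(\<lambda>x. \<Sum>e\<in>A. c e * e x) \<in> V" using B(3) by blast+
      have "(\<lambda>x. c a * a x + (\<Sum>e\<in>A. c e * e x)) \<in> V" by (rule V_add[OF V_scale[OF a] A])
      then show ?case by (simp only: sum.insert[OF insert.hyps])
    qed (simp only: sum.empty V_zero)
  qed
  define r where "r x = s x - (\<Sum>e\<in>B. (\<integral>y. s y * e y \<partial>M) * e x)" for x
  have rV: "r \<in> V"
  proof -
    have "(\<lambda>x. s x + (-1) * (\<Sum>e\<in>B. (\<integral>y. s y * e y \<partial>M) * e x)) \<in> V"
      by (rule V_add[OF sV V_scale[OF V_sum[OF order_refl]]])
    then show ?thesis by (simp add: r_def[abs_def])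
  qed
  have int_sum: "(\<integral>x. (\<Sum>e\<in>B. c e * e x) * f x \<partial>M) = (\<Sum>e\<in>B. c e * (\<integral>x. e x * f x \<partial>M))"
    if "f \<in> V" for c f
    using that by (simp add: sum_distrib_right mult.assoc Bochner_Integration.integral_sum)
  have r_orth: "(\<integral>x. r x * f x \<partial>M) = 0" if "f \<in> B" for f
  proof -
    have fV: "f \<in> V" using that B(3) by blast
    have "(\<integral>x. r x * f x \<partial>M) = (\<integral>x. s x * f x - (\<Sum>e\<in>B. (\<integral>y. s y * e y \<partial>M) * e x) * f x \<partial>M)"
      by (simp add: r_def left_diff_distrib)
    also have "\<dots> = (\<integral>x. s x * f x \<partial>M) - (\<integral>x. (\<Sum>e\<in>B. (\<integral>y. s y * e y \<partial>M) * e x) * f x \<partial>M)"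
      using fV sV by (intro Bochner_Integration.integral_diff) auto
    also have "\<dots> = 0"
      using that B(1) by (simp add: int_sum[OF fV] on if_distrib[of "\<lambda>x. _ * x"] cong: if_cong)
    finally show ?thesis .
  qed
  show ?case
  proof (cases "(\<integral>x. r x * r x \<partial>M) = 0")
    case True
    then have "r x = 0" if "x \<in> space M" for x using V_definite[OF rV] that by blast
    then have "s x = (\<Sum>e\<in>B. (\<integral>y. s y * e y \<partial>M) * e x)" if "x \<in> space M" for x
      using that by (simp add: r_def)
    then show ?thesis using B on exp insert.hyps by (intro exI[of _ B]) auto
  next
    case False
    define N where "N = sqrt (\<integral>x. r x * r x \<partial>M)"
    have Npos: "N > 0" "N * N = (\<integral>x. r x * r x \<partial>M)"
    proof -
      have "0 \<le> (\<integral>x. r x * r x \<partial>M)" by (intro integral_nonneg_AE) auto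
      then have "0 < (\<integral>x. r x * r x \<partial>M)" using False by linarith
      then show "N > 0" "N * N = (\<integral>x. r x * r x \<partial>M)" unfolding N_def by simp_all
    qed
    define b where "b x = (1 / N) * r x" for x
    have bV: "b \<in> V" unfolding b_def[abs_def] by (rule V_scale[OF rV])
    have b_orth: "(\<integral>x. b x * f x \<partial>M) = 0" if "f \<in> B" for f
      using r_orth[OF that] by (simp add: b_def)
    have b_orth': "(\<integral>x. f x * b x \<partial>M) = 0" if "f \<in> B" for f
      using b_orth[OF that] by (simp add: mult.commute)
    have bb: "(\<integral>x. b x * b x \<partial>M) = 1"
    proof -
      have "(\<integral>x. b x * b x \<partial>M) = (\<integral>x. (1 / (N * N)) * (r x * r x) \<partial>M)" by (simp add: b_def)
      also have "\<dots> = (1 / (N * N)) * (\<integral>x. r x * r x \<partial>M)" by (rule integral_mult_right_zero)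
      finally show ?thesis using Npos(1) by (simp flip: Npos(2))
    qed
    have "b \<notin> B" using b_orth bb by force
    have sb: "(\<integral>x. s x * b x \<partial>M) = N"
    proof -
      have "(\<integral>x. s x * b x \<partial>M) = (\<integral>x. N * (b x * b x) + (\<Sum>e\<in>B. (\<integral>y. s y * e y \<partial>M) * e x) * b x \<partial>M)"
        using Npos(1) by (intro Bochner_Integration.integral_cong) (auto simp: b_def r_def algebra_simps)
      also have "\<dots> = (\<integral>x. N * (b x * b x) \<partial>M) + (\<integral>x. (\<Sum>e\<in>B. (\<integral>y. s y * e y \<partial>M) * e x) * b x \<partial>M)"
        using bV V_sum by (intro Bochner_Integration.integral_add) auto
      also have "\<dots> = N"
        by (simp add: bb int_sum[OF bV] b_orth')
      finally show ?thesis .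
    qed
    have Sb: "(\<integral>x. t x * b x \<partial>M) = 0" if "t \<in> S" for t
    proof -
      have "(\<integral>x. t x * b x \<partial>M) = (\<integral>x. (\<Sum>e\<in>B. (\<integral>y. t y * e y \<partial>M) * e x) * b x \<partial>M)"
        by (intro Bochner_Integration.integral_cong) (simp_all add: exp[OF that, symmetric])
      then show ?thesis by (simp add: int_sum[OF bV] b_orth')
    qed
    have exp_s: "s x = (\<Sum>e\<in>insert b B. (\<integral>y. s y * e y \<partial>M) * e x)" for x
    proof -
      have "s x = N * b x + (\<Sum>e\<in>B. (\<integral>y. s y * e y \<partial>M) * e x)"
        using Npos(1) by (simp add: b_def r_def)
      then show ?thesis by (simp only: sum.insert[OF B(1) \<open>b \<notin> B\<close>] sb)
    qed
    have exp_S: "t x = (\<Sum>e\<in>insert b B. (\<integral>y. t y * e y \<partial>M) * e x)" if "t \<in> S" "x \<in> space M" for t x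
      by (simp only: sum.insert[OF B(1) \<open>b \<notin> B\<close>] Sb[OF that(1)] exp[OF that, symmetric] mult_zero_left add_0)
    have orth: "(\<integral>x. e x * f x \<partial>M) = (if e = f then 1 else 0)"
      if ef: "e \<in> insert b B" "f \<in> insert b B" for e f
    proof -
      consider "e = b" "f = b" | "e = b" "f \<in> B" | "e \<in> B" "f = b" | "e \<in> B" "f \<in> B"
        using ef by blast
      then show ?thesis
      proof cases
        case 1
        show ?thesis unfolding 1 bb by (simp only: if_True simp_thms)
      next
        case 2
        then have ne: "b \<noteq> f" using \<open>b \<notin> B\<close> by blast
        show ?thesis unfolding 2(1) b_orth[OF 2(2)] by (simp only: ne if_False)
      next
        case 3
        then have ne: "e \<noteq> b" using \<open>b \<notin> B\<close> by blast
        show ?thesis unfolding 3(2) b_orth'[OF 3(1)] by (simp only: ne if_False)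
      next
        case 4
        then show ?thesis by (rule on)
      qed
    qed
    show ?thesis
    proof (intro exI[of _ "insert b B"] conjI ballI)
      show "finite (insert b B)" using B(1) by simp
      show "card (insert b B) \<le> card (insert s S)"
        using B(1,2) \<open>b \<notin> B\<close> insert.hyps by simp
      show "insert b B \<subseteq> V" using bV B(3) by simp
      show "(\<integral>x. e x * f x \<partial>M) = (if e = f then 1 else 0)"
        if "e \<in> insert b B" "f \<in> insert b B" for e f using that by (rule orth)
      show "t x = (\<Sum>e\<in>insert b B. (\<integral>y. t y * e y \<partial>M) * e x)"
        if "t \<in> insert s S" "x \<in> space M" for t x
        using that(1)
      proof
        assume ts: "t = s" show ?thesis unfolding ts by (rule exp_s)
      next
        assume "t \<in> S" then show ?thesis using that(2) by (rule exp_S)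
      qed
    qed
  qed
qed


section \<open>Pointwise bounds for forms that are nonnegative against squares\<close>

lemma form_functions_eq_sum_monomials:
  fixes f :: "real ^ 'n::finite \<Rightarrow> real"
  assumes "f \<in> form_functions m"
  shows "\<exists>c. \<forall>v. f v = (\<Sum>M\<in>multisets_of_size UNIV m. c M * monomial M v)"
proof -
  obtain p where p: "p \<in> forms m" "f = mpoly_eval p" using assms by (auto simp: form_functions_def)
  have "Poly_Mapping.keys p \<subseteq> multisets_of_size UNIV m"
    using p(1) by (auto simp: forms_def multisets_of_size_def)
  then show ?thesis
    using p(2) mpoly_eval_superset[of "multisets_of_size UNIV m" p] by (auto simp: finite_multisets_of_size)
qed

lemma form_functions_continuous: "f \<in> form_functions m \<Longrightarrow> continuous_on UNIV f"
  by (auto simp: form_functions_def continuous_mpoly_eval)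

lemma form_functions_definite:
  fixes f :: "real ^ 'n::finite \<Rightarrow> real"
  assumes f: "f \<in> form_functions m" and zero: "(\<integral>x. f x * f x \<partial>sphere_measure) = 0"
    and u: "u \<in> space sphere_measure"
  shows "f u = 0"
proof (rule continuous_AE_zero_sphere)
  interpret prob_space "sphere_measure :: (real ^ 'n) measure" by (rule prob_space_sphere_measure)
  have "f \<in> bounded_measurable sphere_measure" using f form_functions_bounded_measurable by blast
  then have "integrable sphere_measure (\<lambda>x. f x * f x)"
    by (intro bounded_measurable_integrable bounded_measurable_mult)
  then have "AE x in sphere_measure. f x * f x = 0"
    using zero by (subst (asm) integral_nonneg_eq_0_iff_AE) auto
  then show "AE x in sphere_measure. f x = 0" by simp
  show "continuous_on UNIV f" using f by (rule form_functions_continuous)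
  show "u \<in> unit_sphere" using u by simp
qed

lemma reflection_orthogonal:
  fixes a :: "'a::euclidean_space"
  defines "T \<equiv> (\<lambda>x. x - (2 * (x \<bullet> a) / (a \<bullet> a)) *\<^sub>R a)"
  shows "orthogonal_transformation T" "T (T x) = x"
proof -
  have "linear T" unfolding T_def
    by (rule linearI) (simp_all add: inner_add_left algebra_simps add_divide_distrib)
  moreover have "T v \<bullet> T w = v \<bullet> w" for v w
    by (cases "a = 0") (simp_all add: T_def inner_diff_left inner_diff_right inner_commute field_simps)
  ultimately show "orthogonal_transformation T" by (simp add: orthogonal_transformation_def)
  show "T (T x) = x"
    by (cases "a = 0") (simp_all add: T_def inner_diff_left field_simps scaleR_left_diff_distrib flip: scaleR_add_left)
qed

text \<open>
  Reflect in the hyperplane orthogonal to \<open>u - v\<close>. For \<open>u = v\<close> the convention on division by zero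
  turns the formula into the identity.
\<close>

lemma swapping_reflection:
  fixes u v :: "'a::euclidean_space"
  assumes "norm u = norm v"
  shows "\<exists>T. orthogonal_transformation T \<and> (\<forall>x. T (T x) = x) \<and> T u = v"
proof (intro exI conjI allI)
  let ?T = "\<lambda>x. x - (2 * (x \<bullet> (u - v)) / ((u - v) \<bullet> (u - v))) *\<^sub>R (u - v)"
  show "orthogonal_transformation ?T" "\<And>x. ?T (?T x) = x" by (rule reflection_orthogonal)+
  show "?T u = v"
  proof (cases "u = v")
    case False
    have "u \<bullet> u = v \<bullet> v" using assms by (simp add: norm_eq)
    then have "2 * (u \<bullet> (u - v)) = (u - v) \<bullet> (u - v)"
      by (simp add: inner_diff_left inner_diff_right inner_commute)
    moreover have "(u - v) \<bullet> (u - v) \<noteq> 0" using False by simp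
    ultimately have "2 * (u \<bullet> (u - v)) / ((u - v) \<bullet> (u - v)) = 1" by simp
    then show ?thesis by (simp only: scaleR_one) simp
  qed simp
qed

text \<open>
  The basis comes from the monomials of degree \<open>2d\<close>, whose number bounds its size. The constant 1 is
  the restriction of \<open>norm_form d\<close>, and the swaps are reflections, which map forms to forms.
\<close>

lemma form_functions_orthonormal_family:
  fixes d :: nat
  obtains B :: "(real ^ 'n::finite \<Rightarrow> real) set"
  where "swappable_orthonormal_family sphere_measure B"
    "B \<subseteq> form_functions (2 * d)" "card B \<le> (CARD('n) + 2 * d - 1) choose (2 * d)"
    "\<And>f x. f \<in> form_functions (2 * d) \<Longrightarrow> x \<in> unit_sphere \<Longrightarrow>
      f x = (\<Sum>e\<in>B. (\<integral>y. f y * e y \<partial>sphere_measure) * e x)"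
proof -
  let ?M = "sphere_measure :: (real ^ 'n) measure"
  let ?V = "form_functions (2 * d) :: (real ^ 'n \<Rightarrow> real) set"
  interpret prob_space ?M by (rule prob_space_sphere_measure)
  define S where "S = monomial ` (multisets_of_size (UNIV :: 'n set) (2 * d))"
  have S: "finite S" "card S \<le> (CARD('n) + 2 * d - 1) choose (2 * d)"
    using card_image_le[OF finite_multisets_of_size[OF finite], of monomial UNIV "2 * d"]
    by (simp_all add: S_def finite_multisets_of_size card_multisets_of_size)
  have SV: "S \<subseteq> ?V"
  proof
    fix f assume "f \<in> S"
    then obtain M where M: "size M = 2 * d" "f = monomial M" by (auto simp: S_def multisets_of_size_def)
    have "Poly_Mapping.single M 1 \<in> forms (2 * d)" using M by (auto simp: forms_def)
    moreover have "f = mpoly_eval (Poly_Mapping.single M 1)" using M by (auto simp: mpoly_eval_single)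
    ultimately show "f \<in> ?V" by (auto simp: form_functions_def)
  qed
  obtain B where B: "finite B" "card B \<le> card S" "B \<subseteq> ?V"
    and on: "\<And>e f. e \<in> B \<Longrightarrow> f \<in> B \<Longrightarrow> (\<integral>x. e x * f x \<partial>?M) = (if e = f then 1 else 0)"
    and exp: "\<And>s x. s \<in> S \<Longrightarrow> x \<in> unit_sphere \<Longrightarrow> s x = (\<Sum>e\<in>B. (\<integral>y. s y * e y \<partial>?M) * e x)"
  proof -
    have "\<exists>B. finite B \<and> card B \<le> card S \<and> B \<subseteq> ?V \<and>
      (\<forall>e\<in>B. \<forall>f\<in>B. (\<integral>x. e x * f x \<partial>?M) = (if e = f then 1 else 0)) \<and>
      (\<forall>s\<in>S. \<forall>x\<in>space ?M. s x = (\<Sum>e\<in>B. (\<integral>y. s y * e y \<partial>?M) * e x))"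
    proof (rule gram_schmidt)
      show "\<And>f g. f \<in> ?V \<Longrightarrow> g \<in> ?V \<Longrightarrow> (\<lambda>x. f x + g x) \<in> ?V"
        by (rule form_functions_add)
      show "\<And>f c. f \<in> ?V \<Longrightarrow> (\<lambda>x. c * f x) \<in> ?V"
        by (rule form_functions_scale)
      show "\<And>f x. f \<in> ?V \<Longrightarrow> (\<integral>x. f x * f x \<partial>?M) = 0 \<Longrightarrow> x \<in> space ?M \<Longrightarrow> f x = 0"
        by (rule form_functions_definite)
    qed (rule prob_space_sphere_measure form_functions_bounded_measurable S(1) SV)+
    then show ?thesis using that unfolding space_sphere_measure by blast
  qed
  have bm: "f \<in> bounded_measurable ?M" if "f \<in> ?V" for f
    using that form_functions_bounded_measurable by blast
  have int: "integrable ?M (\<lambda>x. f x * g x)" if "f \<in> ?V" "g \<in> ?V" for f g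
    using that by (intro bounded_measurable_integrable bounded_measurable_mult bm)
  have expV: "f x = (\<Sum>e\<in>B. (\<integral>y. f y * e y \<partial>?M) * e x)" if f: "f \<in> ?V" and x: "x \<in> unit_sphere" for f x
  proof -
    obtain c where c: "\<And>v. f v = (\<Sum>M\<in>multisets_of_size UNIV (2 * d). c M * monomial M v)"
      using form_functions_eq_sum_monomials[OF f] by blast
    have mS: "monomial M \<in> S" if "M \<in> multisets_of_size UNIV (2 * d)" for M :: "'n multiset"
      using that by (auto simp: S_def)
    have fe: "(\<integral>y. f y * e y \<partial>?M) = (\<Sum>M\<in>multisets_of_size UNIV (2 * d). c M * (\<integral>y. monomial M y * e y \<partial>?M))"
      if "e \<in> B" for e
    proof -
      have "(\<integral>y. f y * e y \<partial>?M) = (\<integral>y. (\<Sum>M\<in>multisets_of_size UNIV (2 * d). c M * (monomial M y * e y)) \<partial>?M)"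
        by (simp add: c sum_distrib_right mult.assoc)
      also have "\<dots> = (\<Sum>M\<in>multisets_of_size UNIV (2 * d). c M * (\<integral>y. monomial M y * e y \<partial>?M))"
        using that B(3) mS SV by (subst Bochner_Integration.integral_sum) (auto intro!: int)
      finally show ?thesis .
    qed
    have "f x = (\<Sum>M\<in>multisets_of_size UNIV (2 * d). c M * (\<Sum>e\<in>B. (\<integral>y. monomial M y * e y \<partial>?M) * e x))"
      unfolding c using exp[OF mS x] by (intro sum.cong refl) simp
    also have "\<dots> = (\<Sum>e\<in>B. \<Sum>M\<in>multisets_of_size UNIV (2 * d). c M * (\<integral>y. monomial M y * e y \<partial>?M) * e x)"
      by (subst sum.swap) (simp add: sum_distrib_left mult.assoc)
    also have "\<dots> = (\<Sum>e\<in>B. (\<integral>y. f y * e y \<partial>?M) * e x)"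
      by (intro sum.cong refl) (simp add: fe sum_distrib_right)
    finally show ?thesis .
  qed
  have "swappable_orthonormal_family ?M B"
  proof
    show "finite B" by fact
    show "B \<subseteq> bounded_measurable ?M" using B(3) bm by blast
    show "\<And>e f. e \<in> B \<Longrightarrow> f \<in> B \<Longrightarrow> (\<integral>x. e x * f x \<partial>?M) = (if e = f then 1 else 0)" by (rule on)
    show "(\<Sum>e\<in>B. (\<integral>y. e y \<partial>?M) * e x) = 1" if "x \<in> space ?M" for x
    proof -
      let ?g = "mpoly_eval (norm_form d) :: real ^ 'n \<Rightarrow> real"
      have g1: "?g y = 1" if "y \<in> unit_sphere" for y using that by (simp add: mpoly_eval_norm_form)
      have "?g x = (\<Sum>e\<in>B. (\<integral>y. ?g y * e y \<partial>?M) * e x)"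
        using that norm_form_form by (intro expV) (auto simp: form_functions_def)
      also have "\<dots> = (\<Sum>e\<in>B. (\<integral>y. e y \<partial>?M) * e x)"
        by (intro sum.cong refl arg_cong2[of _ _ _ _ "(*)"] Bochner_Integration.integral_cong) (auto simp: g1)
      finally show ?thesis using g1 that by simp
    qed
    show "\<exists>T. T \<in> measurable ?M ?M \<and> distr ?M ?M T = ?M \<and> (\<forall>x\<in>space ?M. T (T x) = x) \<and> T u = v \<and>
        (\<forall>e\<in>B. \<forall>x\<in>space ?M. e (T x) = (\<Sum>f\<in>B. (\<integral>y. e (T y) * f y \<partial>?M) * f x))"
      if uv: "u \<in> space ?M" "v \<in> space ?M" for u v
    proof -
      have "norm u = norm v" using uv by simp
      then obtain T where T: "orthogonal_transformation T" "\<And>x. T (T x) = x" "T u = v"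
        using swapping_reflection by blast
      have "(\<lambda>x. e (T x)) \<in> ?V" if eB: "e \<in> B" for e
      proof -
        obtain p where p: "p \<in> forms (2 * d)" "e = mpoly_eval p"
          using subsetD[OF B(3) eB] unfolding form_functions_def by (rule imageE)
        obtain q where q: "q \<in> forms (2 * d)" "\<forall>x. mpoly_eval q x = mpoly_eval p (T x)"
          using mpoly_eval_linear_change[OF orthogonal_transformation_linear[OF T(1)] p(1)] by blast
        then have "(\<lambda>x. e (T x)) = mpoly_eval q" by (simp add: p(2) fun_eq_iff)
        then show ?thesis unfolding form_functions_def using q(1) by (rule image_eqI)
      qed
      then have "e (T x) = (\<Sum>f\<in>B. (\<integral>y. e (T y) * f y \<partial>?M) * f x)" if "e \<in> B" "x \<in> space ?M" for e x
        using that expV[of "\<lambda>x. e (T x)" x] by simp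
      then show ?thesis using sphere_measure_distr_orthogonal[OF T(1)] T by blast
    qed
  qed
  moreover have "card B \<le> (CARD('n) + 2 * d - 1) choose (2 * d)" using B(2) S(2) by (rule order_trans)
  ultimately show ?thesis using that[OF _ B(3) _ expV] by blast
qed

lemma pairing_barycenter:
  fixes p :: "'n::finite mpoly"
  assumes "p \<in> forms (2 * d)"
  shows "pairing p (barycenter d) = (\<integral>u. mpoly_eval p u \<partial>sphere_measure)"
proof -
  interpret prob_space "sphere_measure :: (real ^ 'n) measure" by (rule prob_space_sphere_measure)
  have size: "size M = 2 * d" if "M \<in> Poly_Mapping.keys p" for M
    using that assms by (auto simp: forms_def)
  have int: "integrable sphere_measure (\<lambda>u. monomial M u)" if "M \<in> Poly_Mapping.keys p" for M
  proof -
    have "monomial M = mpoly_eval (Poly_Mapping.single M 1)" by (auto simp: mpoly_eval_single)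
    moreover have "Poly_Mapping.single M 1 \<in> forms (2 * d)" using size[OF that] by (auto simp: forms_def)
    ultimately have "monomial M \<in> form_functions (2 * d)" by (auto simp: form_functions_def)
    then show ?thesis using form_functions_bounded_measurable bounded_measurable_integrable by blast
  qed
  have "pairing p (barycenter d) = (\<Sum>M\<in>Poly_Mapping.keys p. Poly_Mapping.lookup p M * (\<integral>u. monomial M u \<partial>sphere_measure))"
    unfolding pairing_def barycenter_def sympow_def monomial_def
    by (intro sum.cong refl) (simp add: size)
  also have "\<dots> = (\<integral>u. (\<Sum>M\<in>Poly_Mapping.keys p. Poly_Mapping.lookup p M * monomial M u) \<partial>sphere_measure)"
    using int by (subst Bochner_Integration.integral_sum) auto
  finally show ?thesis by (simp add: mpoly_eval_def monomial_def)
qed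

theorem sphere_lower_bound:
  fixes p :: "'n::finite mpoly"
  assumes p: "p \<in> dual_cone_approx d (form_space d) \<inter> dual_slice d" and v: "v \<in> unit_sphere"
  shows "mpoly_eval p v \<ge> - real ((CARD('n) + 2 * d - 1) choose (2 * d)) / 2"
proof -
  let ?M = "sphere_measure :: (real ^ 'n) measure"
  obtain B :: "(real ^ 'n \<Rightarrow> real) set" where B: "swappable_orthonormal_family ?M B"
     "B \<subseteq> form_functions (2 * d)" "card B \<le> (CARD('n) + 2 * d - 1) choose (2 * d)"
     "\<And>f x. f \<in> form_functions (2 * d) \<Longrightarrow> x \<in> unit_sphere \<Longrightarrow>
       f x = (\<Sum>e\<in>B. (\<integral>y. f y * e y \<partial>?M) * e x)"
    by (rule form_functions_orthonormal_family[where 'n='n and d=d]) (rule that, assumption+)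
  interpret swappable_orthonormal_family ?M B by fact
  have pf: "p \<in> forms (2 * d)" and p1: "pairing p (barycenter d) = 1"
    and sq: "\<And>q. q \<in> form_space d \<Longrightarrow> (\<integral>u. pairing p (sympow (2 * d) u) * (q u)\<^sup>2 \<partial>?M) \<ge> 0"
    using p by (auto simp: dual_cone_approx_def dual_slice_def)
  have "mpoly_eval p v \<ge> - real (card B) / 2"
  proof (rule lower_bound_of_square_positive)
    show "mpoly_eval p \<in> span_of"
      using pf by (intro span_ofI[OF B(4)]) (auto simp: form_functions_def)
    show "(\<integral>x. mpoly_eval p x \<partial>?M) = 1" using p1 pairing_barycenter[OF pf] by simp
    show "v \<in> space ?M" using v by simp
    fix q :: "real ^ 'n \<Rightarrow> real" assume "q \<in> span_of"
    then obtain c where c: "\<And>x. x \<in> space ?M \<Longrightarrow> q x = (\<Sum>e\<in>B. c e * e x)" by (auto simp: span_of_def)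
    have "\<forall>e\<in>B. \<exists>P. P \<in> forms (2 * d) \<and> e = mpoly_eval P"
      using B(2) unfolding form_functions_def by blast
    then obtain P where P: "\<And>e. e \<in> B \<Longrightarrow> P e \<in> forms (2 * d) \<and> e = mpoly_eval (P e)"
      by (metis (no_types))
    define Q where "Q = (\<Sum>e\<in>B. const (c e) * P e)"
    have "Q \<in> forms (2 * d)" unfolding Q_def using P by (intro forms_sum forms_scale) auto
    then have Q: "restrict (mpoly_eval Q) unit_sphere \<in> form_space d" by (auto simp: form_space_def)
    have "mpoly_eval Q x = q x" if "x \<in> space ?M" for x
      unfolding Q_def c[OF that] mpoly_eval_sum using P by (intro sum.cong refl) auto
    then have "(\<integral>x. mpoly_eval p x * (q x)\<^sup>2 \<partial>?M)
       = (\<integral>u. pairing p (sympow (2 * d) u) * (restrict (mpoly_eval Q) unit_sphere u)\<^sup>2 \<partial>?M)"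
      by (intro Bochner_Integration.integral_cong) (auto simp: pairing_sympow[OF pf])
    then show "(\<integral>x. mpoly_eval p x * (q x)\<^sup>2 \<partial>?M) \<ge> 0" using sq[OF Q] by simp
  qed
  moreover have "real (card B) \<le> real ((CARD('n) + 2 * d - 1) choose (2 * d))" using B(3) by simp
  ultimately show ?thesis by linarith
qed

text \<open>
  The form \<open>(p - norm_form d) / (1 + c) + norm_form d\<close> again has mean 1, and its value
  \<open>1 + (p v - 1) / (1 + c)\<close> at a point \<open>v\<close> of the sphere is nonnegative precisely when \<open>p v \<ge> - c\<close>.
\<close>

lemma scaling_const_le:
  fixes c :: real
  assumes "c \<ge> 0"
    and lower: "\<And>(p :: 'n::finite mpoly) v. p \<in> dual_cone_approx d F \<inter> dual_slice d \<Longrightarrow> v \<in> unit_sphere \<Longrightarrow> mpoly_eval p v \<ge> - c"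
  shows "scaling_const d F \<le> ereal (1 + c)"
proof -
  interpret prob_space "sphere_measure :: (real ^ 'n) measure" by (rule prob_space_sphere_measure)
  let ?g = "norm_form d :: 'n mpoly"
  have int: "integrable sphere_measure (mpoly_eval p)" if "p \<in> forms (2 * d)" for p :: "'n mpoly"
    using that form_functions_bounded_measurable bounded_measurable_integrable
    unfolding form_functions_def by blast
  have g1: "mpoly_eval ?g y = 1" if "y \<in> unit_sphere" for y using that by (simp add: mpoly_eval_norm_form)
  have "(\<lambda>p. const (1 / (1 + c)) * (p - ?g)) ` (dual_cone_approx d F \<inter> dual_slice d)
      \<subseteq> (\<lambda>p. p - ?g) ` (dual_cone d \<inter> dual_slice d)"
  proof (rule image_subsetI)
    fix p assume p: "p \<in> dual_cone_approx d F \<inter> dual_slice d"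
    then have pf: "p \<in> forms (2 * d)" and p1: "pairing p (barycenter d) = 1"
      by (auto simp: dual_slice_def)
    define r where "r = const (1 / (1 + c)) * (p - ?g) + ?g"
    have rf: "r \<in> forms (2 * d)"
      unfolding r_def by (intro forms_add forms_scale forms_diff pf norm_form_form)
    have ev: "mpoly_eval r v = 1 + (mpoly_eval p v - 1) / (1 + c)" if "v \<in> unit_sphere" for v
      by (simp add: r_def g1[OF that])
    have "(\<integral>u. mpoly_eval r u \<partial>sphere_measure) = (\<integral>u. 1 + (mpoly_eval p u - 1) / (1 + c) \<partial>sphere_measure)"
      by (intro Bochner_Integration.integral_cong) (auto simp: ev)
    also have "\<dots> = 1 + ((\<integral>u. mpoly_eval p u \<partial>sphere_measure) - 1) / (1 + c)"
      using int[OF pf] prob_space by simp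
    also have "\<dots> = 1" using p1 pairing_barycenter[OF pf] by simp
    finally have slice: "r \<in> dual_slice d" using rf pairing_barycenter[OF rf] by (simp add: dual_slice_def)
    have pos: "mpoly_eval r v \<ge> 0" if "v \<in> unit_sphere" for v
    proof -
      have "(mpoly_eval p v - 1) / (1 + c) \<ge> (- c - 1) / (1 + c)"
        using lower[OF p that] assms(1) by (intro divide_right_mono) auto
      also have "(- c - 1) / (1 + c) = - 1" using assms(1) by (simp add: field_simps)
      finally show ?thesis using ev[OF that] by simp
    qed
    have "pairing r T \<ge> 0" if T: "T \<in> tensor_cone d" for T
    proof -
      obtain S a where S: "finite S" "S \<subseteq> unit_sphere" "\<forall>v\<in>S. a v \<ge> 0"
        and T: "T = (\<lambda>M. \<Sum>v\<in>S. a v * sympow (2 * d) v M)"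
        using T unfolding tensor_cone_def by blast
      have "pairing r T = (\<Sum>v\<in>S. a v * pairing r (sympow (2 * d) v))"
        unfolding pairing_def T sum_distrib_left by (subst sum.swap) (simp add: mult_ac)
      also have "\<dots> = (\<Sum>v\<in>S. a v * mpoly_eval r v)" by (simp add: pairing_sympow[OF rf])
      also have "\<dots> \<ge> 0" using S pos by (intro sum_nonneg mult_nonneg_nonneg) auto
      finally show ?thesis .
    qed
    then have "r \<in> dual_cone d" using rf by (simp add: dual_cone_def)
    then show "const (1 / (1 + c)) * (p - ?g) \<in> (\<lambda>p. p - ?g) ` (dual_cone d \<inter> dual_slice d)"
      using slice by (intro image_eqI[of _ _ r]) (auto simp: r_def)
  qed
  then show ?thesis
    unfolding scaling_const_def using assms(1) by (intro Inf_lower) auto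
qed


section \<open>Legendre polynomials near the endpoint as a deformed Bessel series\<close>

text \<open>
  For \<open>\<epsilon> = 1/(m(m+1))\<close> and \<open>k \<le> m\<close> this is \<open>\<epsilon>^k (m+k)! / (m-k)!\<close>, because
  \<open>m(m+1) - j(j+1) = (m-j)(m+j+1)\<close>; for \<open>k > m\<close> it is 0.
\<close>

definition legendre_weight :: "real \<Rightarrow> nat \<Rightarrow> real" where
  "legendre_weight \<epsilon> k = (\<Prod>j<k. 1 - \<epsilon> * (real j * (real j + 1)))"

text \<open>
  For \<open>\<epsilon> = 0\<close> the Bessel function \<open>J\<^sub>0(2 sqrt y)\<close>, for \<open>\<epsilon> = 1/(m(m+1))\<close> the Legendre polynomial of
  degree \<open>m\<close> at \<open>1 - 2\<epsilon>y\<close>.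
\<close>

definition legendre_series :: "real \<Rightarrow> real \<Rightarrow> real" where
  "legendre_series \<epsilon> y = suminf (\<lambda>k. (-1) ^ k * legendre_weight \<epsilon> k / (fact k)\<^sup>2 * y ^ k)"

text \<open>
  For these parameters the weights decrease from 1 and stay nonnegative, so that the alternating
  series can be estimated by its partial sums.
\<close>

definition admissible :: "real \<Rightarrow> bool" where
  "admissible \<epsilon> \<longleftrightarrow> \<epsilon> = 0 \<or> (\<exists>m\<ge>2. \<epsilon> = 1 / (real m * (real m + 1)))"

lemma legendre_weight_0 [simp]: "legendre_weight \<epsilon> 0 = 1"
  by (simp add: legendre_weight_def)

lemma legendre_weight_Suc:
  "legendre_weight \<epsilon> (Suc k) = legendre_weight \<epsilon> k * (1 - \<epsilon> * (real k * (real k + 1)))"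
  by (simp add: legendre_weight_def)

lemma legendre_weight_zero_eps [simp]: "legendre_weight 0 k = 1"
  by (simp add: legendre_weight_def)

lemma legendre_weight_vanish:
  assumes "m \<ge> 1" "k > m"
  shows "legendre_weight (1 / (real m * (real m + 1))) k = 0"
  unfolding legendre_weight_def using assms by (intro prod_zero bexI[of _ m]) auto

lemma admissible_weight:
  assumes "admissible \<epsilon>"
  shows "0 \<le> legendre_weight \<epsilon> k" "legendre_weight \<epsilon> (Suc k) \<le> legendre_weight \<epsilon> k"
    "legendre_weight \<epsilon> k \<le> 1"
proof -
  have nn: "0 \<le> legendre_weight \<epsilon> k \<and> legendre_weight \<epsilon> (Suc k) \<le> legendre_weight \<epsilon> k" for k
  proof (cases "\<epsilon> = 0")
    case False
    then obtain m where m: "m \<ge> 2" "\<epsilon> = 1 / (real m * (real m + 1))"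
      using assms by (auto simp: admissible_def)
    have f: "0 \<le> 1 - \<epsilon> * (real j * (real j + 1)) \<and> 1 - \<epsilon> * (real j * (real j + 1)) \<le> 1" if "j \<le> m" for j
    proof -
      define J P where "J = real j * (real j + 1)" and "P = real m * (real m + 1)"
      have "0 \<le> J" "J \<le> P" "0 < P" unfolding J_def P_def using that m by (auto intro!: mult_mono)
      then have "0 \<le> J / P" "J / P \<le> 1" by auto
      then show ?thesis unfolding J_def[symmetric] m(2) P_def[symmetric] by simp
    qed
    have pos: "0 \<le> legendre_weight \<epsilon> k" if "k \<le> Suc m" for k
      unfolding legendre_weight_def using f that by (intro prod_nonneg) auto
    show ?thesis
    proof (cases "k \<le> m")
      case True
      have "legendre_weight \<epsilon> k * (1 - \<epsilon> * (real k * (real k + 1))) \<le> legendre_weight \<epsilon> k * 1"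
        using f[OF True] pos[of k] True by (intro mult_left_mono) auto
      then show ?thesis using pos[of k] True by (simp add: legendre_weight_Suc)
    next
      case False
      then have "legendre_weight \<epsilon> k = 0" using legendre_weight_vanish[of m k] m by simp
      then show ?thesis by (simp add: legendre_weight_Suc)
    qed
  qed simp
  show "0 \<le> legendre_weight \<epsilon> k" "legendre_weight \<epsilon> (Suc k) \<le> legendre_weight \<epsilon> k"
    using nn by auto
  show "legendre_weight \<epsilon> k \<le> 1"
    by (induction k) (use nn order_trans in \<open>auto\<close>)
qed

lemma admissible_range: "admissible \<epsilon> \<Longrightarrow> 0 \<le> \<epsilon> \<and> \<epsilon> \<le> 1 / 6"
proof -
  assume "admissible \<epsilon>"
  then consider "\<epsilon> = 0" | m where "m \<ge> 2" "\<epsilon> = 1 / (real m * (real m + 1))"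
    by (auto simp: admissible_def)
  then show ?thesis
  proof cases
    case 2
    define P where "P = real m * (real m + 1)"
    have "2 * 3 \<le> P" unfolding P_def using 2(1) by (intro mult_mono) auto
    then have "0 \<le> 1 / P \<and> 1 / P \<le> 1 / 6" by (auto intro!: divide_left_mono)
    then show ?thesis unfolding 2(2) P_def .
  qed simp
qed

text \<open>
  The coefficients of a power series that converges everywhere.
\<close>

definition entire :: "(nat \<Rightarrow> real) \<Rightarrow> bool" where
  "entire a \<longleftrightarrow> (\<forall>x. summable (\<lambda>k. a k * x ^ k))"

lemma entire_inverse_fact_sq: "entire (\<lambda>k. 1 / (fact k)\<^sup>2)"
  unfolding entire_def
proof
  fix x :: real
  have "norm (1 / (fact k)\<^sup>2 * x ^ k) \<le> inverse (fact k) * \<bar>x\<bar> ^ k" for k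
  proof -
    have "(1::real) \<le> fact k" by (rule fact_ge_1)
    then have "1 / (fact k)\<^sup>2 \<le> inverse (fact k :: real)"
      by (simp add: field_simps power2_eq_square)
    then have "1 / (fact k)\<^sup>2 * \<bar>x\<bar> ^ k \<le> inverse (fact k) * \<bar>x\<bar> ^ k" by (rule mult_right_mono) simp
    then show ?thesis by (simp add: abs_mult power_abs)
  qed
  then show "summable (\<lambda>k. 1 / (fact k)\<^sup>2 * x ^ k)"
    by (intro summable_comparison_test'[OF summable_exp[of "\<bar>x\<bar>"], of 0]) auto
qed

lemma entire_comparison:
  assumes "entire b" "\<And>k. \<bar>a k\<bar> \<le> \<bar>b k\<bar>"
  shows "entire a"
  unfolding entire_def
proof
  fix x
  have "summable (\<lambda>k. norm (b k * x ^ k))"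
  proof (rule powser_insidea)
    show "summable (\<lambda>k. b k * (\<bar>x\<bar> + 1) ^ k)" using assms(1) by (simp add: entire_def)
  qed simp
  then show "summable (\<lambda>k. a k * x ^ k)"
    by (rule summable_comparison_test'[of _ 0]) (use assms(2) in \<open>auto simp: abs_mult intro: mult_right_mono\<close>)
qed

lemma entire_mult_index:
  assumes "entire a"
  shows "entire (\<lambda>k. real k * a k)"
  unfolding entire_def
proof
  fix x
  have "summable (\<lambda>k. diffs a k * x ^ k)"
    using assms by (intro termdiff_converges_all) (auto simp: entire_def)
  then have "summable (\<lambda>k. diffs a k * x ^ k * x)" by (rule summable_mult2)
  then have "summable (\<lambda>k. real (Suc k) * a (Suc k) * x ^ Suc k)" by (simp add: diffs_def mult_ac)
  then show "summable (\<lambda>k. real k * a k * x ^ k)" by (subst (asm) summable_Suc_iff)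
qed

lemma entire_power_index: "entire a \<Longrightarrow> entire (\<lambda>k. real k ^ i * a k)"
  by (induction i) (auto dest: entire_mult_index simp: mult_ac)

lemma entire_has_derivative:
  assumes "entire a"
  shows "((\<lambda>x. suminf (\<lambda>k. a k * x ^ k)) has_field_derivative suminf (\<lambda>k. diffs a k * x ^ k)) (at x)"
  using assms by (intro termdiffs_strong_converges_everywhere) (simp add: entire_def)

lemma entire_euler_derivative:
  assumes "entire a"
  shows "x * suminf (\<lambda>k. diffs a k * x ^ k) = suminf (\<lambda>k. real k * a k * x ^ k)"
proof -
  have s: "summable (\<lambda>k. diffs a k * x ^ k)"
    using assms by (intro termdiff_converges_all) (auto simp: entire_def)
  have "x * suminf (\<lambda>k. diffs a k * x ^ k) = suminf (\<lambda>k. real (Suc k) * a (Suc k) * x ^ Suc k)"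
    by (subst suminf_mult[symmetric, OF s]) (simp add: diffs_def mult_ac)
  also have "\<dots> = suminf (\<lambda>k. real k * a k * x ^ k)"
    using suminf_split_head[of "\<lambda>k. real k * a k * x ^ k"] entire_mult_index[OF assms]
    by (simp add: entire_def)
  finally show ?thesis .
qed

lemma entire_legendre:
  assumes "admissible \<epsilon>" shows "entire (\<lambda>k. (-1) ^ k * legendre_weight \<epsilon> k / (fact k)\<^sup>2)"
  by (rule entire_comparison[OF entire_inverse_fact_sq])
     (use admissible_weight[OF assms] in \<open>auto simp: abs_mult divide_right_mono\<close>)

lemma summable_entire: "entire a \<Longrightarrow> summable (\<lambda>k. a k * x ^ k)"
  by (simp add: entire_def)

text \<open>
  The derivative is the negative of an alternating series with decreasing terms, which is at least
  the difference \<open>1 - legendre_weight \<epsilon> 2 * y / 2\<close> of its first two terms.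
\<close>

lemma legendre_series_deriv:
  assumes "admissible \<epsilon>"
  obtains D where "(legendre_series \<epsilon> has_field_derivative D) (at y)"
    "0 \<le> y \<Longrightarrow> y \<le> 3/2 \<Longrightarrow> D \<le> - 1 / 4"
proof
  let ?a = "\<lambda>k. (-1) ^ k * legendre_weight \<epsilon> k / (fact k)\<^sup>2"
  let ?D = "suminf (\<lambda>k. diffs ?a k * y ^ k)"
  show "(legendre_series \<epsilon> has_field_derivative ?D) (at y)"
    unfolding legendre_series_def[abs_def] using entire_has_derivative[OF entire_legendre[OF assms]] by simp
  assume y: "0 \<le> y" "y \<le> 3/2"
  define b where "b k = legendre_weight \<epsilon> (Suc k) * y ^ k / (fact k * fact (Suc k))" for k
  have ab: "diffs ?a k * y ^ k = - ((-1) ^ k * b k)" for k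
    unfolding diffs_def b_def by (simp add: power2_eq_square) 
  have sb: "summable (\<lambda>k. (-1) ^ k * b k)"
  proof -
    have "summable (\<lambda>k. diffs ?a k * y ^ k)"
      using entire_legendre[OF assms] by (intro termdiff_converges_all) (auto simp: entire_def)
    then show ?thesis unfolding ab by (simp add: summable_minus_iff)
  qed
  have b0: "0 \<le> b k" for k unfolding b_def using admissible_weight[OF assms] y by simp
  have bdec: "b (Suc k) \<le> b k" for k
  proof -
    have "b (Suc k) = (legendre_weight \<epsilon> (Suc (Suc k)) * y ^ k / (fact k * fact (Suc k))) * (y / ((real k + 1) * (real k + 2)))"
      by (simp add: b_def field_simps)
    also have "\<dots> \<le> (legendre_weight \<epsilon> (Suc k) * y ^ k / (fact k * fact (Suc k))) * 1"
    proof (intro mult_mono divide_right_mono mult_right_mono)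
      have "1 * 2 \<le> (real k + 1) * (real k + 2)" by (intro mult_mono) auto
      then show "y / ((real k + 1) * (real k + 2)) \<le> 1" 
        using y by (intro divide_le_eq_1[THEN iffD2] disjI1 conjI) linarith+
    qed (use admissible_weight[OF assms] y in auto)
    finally show ?thesis by (simp add: b_def)
  qed
  have blim: "b \<longlonglongrightarrow> 0"
  proof -
    have "(\<lambda>k. norm ((-1) ^ k * b k)) \<longlonglongrightarrow> 0" using summable_LIMSEQ_zero[OF sb] tendsto_norm_zero by blast
    then show ?thesis using b0 by (simp add: abs_mult)
  qed
  have "(\<Sum>k<2*1. (-1) ^ k * b k) \<le> suminf (\<lambda>k. (-1) ^ k * b k)"
    by (rule summable_Leibniz'(2)[OF blim b0 bdec])
  moreover have "(\<Sum>k<2*1. (-1) ^ k * b k) = b 0 - b 1" by (simp add: numeral_2_eq_2)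
  moreover have "b 0 = 1" by (simp add: b_def legendre_weight_Suc)
  moreover have "b 1 \<le> 3 / 4"
  proof -
    have "legendre_weight \<epsilon> 2 * y \<le> 1 * (3/2)"
      using admissible_weight[OF assms] y by (intro mult_mono) auto
    then show ?thesis by (simp add: b_def numeral_2_eq_2 mult_ac)
  qed
  moreover have "?D = - suminf (\<lambda>k. (-1) ^ k * b k)" unfolding ab using sb by (rule suminf_minus)
  ultimately show "?D \<le> - 1 / 4" by simp
qed

text \<open>
  The term for \<open>k = 1\<close> is \<open>- y\<close>, possibly larger than the constant term 1; only from there on do the
  terms decrease. Leibniz' criterion is therefore applied to the series without its constant term.
\<close>

lemma legendre_series_partial_sums:
  assumes "admissible \<epsilon>" "0 \<le> y" "y \<le> 4" "n \<ge> 1"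
  shows "(\<Sum>k<2*n. (-1) ^ k * legendre_weight \<epsilon> k / (fact k)\<^sup>2 * y ^ k) \<le> legendre_series \<epsilon> y"
    "legendre_series \<epsilon> y \<le> (\<Sum>k<2*n+1. (-1) ^ k * legendre_weight \<epsilon> k / (fact k)\<^sup>2 * y ^ k)"
proof -
  let ?a = "\<lambda>k. (-1) ^ k * legendre_weight \<epsilon> k / (fact k)\<^sup>2 * y ^ k"
  define b where "b k = legendre_weight \<epsilon> (Suc k) * y ^ Suc k / (fact (Suc k))\<^sup>2" for k
  have ab: "?a (Suc k) = - ((-1) ^ k * b k)" for k by (simp add: b_def)
  have sa: "summable ?a" using entire_legendre[OF assms(1)] by (rule summable_entire)
  have sb: "summable (\<lambda>k. (-1) ^ k * b k)"
  proof -
    have "summable (\<lambda>k. ?a (Suc k))" using sa by (subst summable_Suc_iff)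
    then show ?thesis unfolding ab by (simp add: summable_minus_iff)
  qed
  have b0: "0 \<le> b k" for k unfolding b_def using admissible_weight[OF assms(1)] assms by simp
  have bdec: "b (Suc k) \<le> b k" for k
  proof -
    have "b (Suc k) = (legendre_weight \<epsilon> (Suc (Suc k)) * y ^ Suc k / (fact (Suc k))\<^sup>2) * (y / (real k + 2)\<^sup>2)"
      by (simp add: b_def power2_eq_square field_simps)
    also have "\<dots> \<le> (legendre_weight \<epsilon> (Suc k) * y ^ Suc k / (fact (Suc k))\<^sup>2) * 1"
    proof (intro mult_mono divide_right_mono mult_right_mono)
      have "2 ^ 2 \<le> (real k + 2)\<^sup>2" by (intro power_mono) auto
      then show "y / (real k + 2)\<^sup>2 \<le> 1" using assms by (simp add: field_simps)
    qed (use admissible_weight[OF assms(1)] assms in auto)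
    finally show ?thesis by (simp add: b_def)
  qed
  have blim: "b \<longlonglongrightarrow> 0"
  proof -
    have "(\<lambda>k. norm ((-1) ^ k * b k)) \<longlonglongrightarrow> 0" using summable_LIMSEQ_zero[OF sb] tendsto_norm_zero by blast
    then show ?thesis using b0 by (simp add: abs_mult)
  qed
  have split: "(\<Sum>k<Suc N. ?a k) = 1 - (\<Sum>k<N. (-1) ^ k * b k)" for N
    by (subst sum.lessThan_Suc_shift) (simp only: ab sum_negf, simp)
  have ser: "legendre_series \<epsilon> y = 1 - suminf (\<lambda>k. (-1) ^ k * b k)"
    unfolding legendre_series_def using suminf_split_head[OF sa] ab suminf_minus[OF sb] by simp
  obtain n' where n': "n = Suc n'" using assms(4) by (cases n) auto
  have "suminf (\<lambda>k. (-1) ^ k * b k) \<le> (\<Sum>k<2*n'+1. (-1) ^ k * b k)"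
    by (rule summable_Leibniz'(4)[OF blim b0 bdec])
  then show "(\<Sum>k<2*n. ?a k) \<le> legendre_series \<epsilon> y"
    using split[of "2 * n' + 1"] by (simp add: ser n')
  have "(\<Sum>k<2*n. (-1) ^ k * b k) \<le> suminf (\<lambda>k. (-1) ^ k * b k)"
    by (rule summable_Leibniz'(2)[OF blim b0 bdec])
  then show "legendre_series \<epsilon> y \<le> (\<Sum>k<2*n+1. ?a k)"
    using split[of "2 * n"] by (simp add: ser)
qed

lemma legendre_series_0 [simp]: "legendre_series \<epsilon> 0 = 1"
  unfolding legendre_series_def by (subst powser_zero) simp

lemma legendre_series_decreasing:
  assumes "admissible \<epsilon>" "0 \<le> x" "x \<le> y" "y \<le> 3/2"
  shows "4 * legendre_series \<epsilon> y + (y - x) \<le> 4 * legendre_series \<epsilon> x"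
proof (cases "x = y")
  case False
  then have xy: "x < y" using assms by simp
  obtain D where D: "\<And>z. (legendre_series \<epsilon> has_field_derivative D z) (at z)"
    "\<And>z. 0 \<le> z \<Longrightarrow> z \<le> 3/2 \<Longrightarrow> D z \<le> - 1 / 4"
  proof -
    have "\<exists>D. (legendre_series \<epsilon> has_field_derivative D) (at z) \<and> (0 \<le> z \<longrightarrow> z \<le> 3/2 \<longrightarrow> D \<le> - 1 / 4)" for z
      by (rule legendre_series_deriv[OF assms(1), of z]) blast
    then show ?thesis using that by metis
  qed
  obtain z where z: "x < z" "z < y" "legendre_series \<epsilon> y - legendre_series \<epsilon> x = (y - x) * D z"
    using MVT2[OF xy, of "legendre_series \<epsilon>" D] D(1) by blast
  have "(y - x) * D z \<le> (y - x) * (- 1 / 4)" using z assms xy by (intro mult_left_mono D(2)) auto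
  then show ?thesis using z(3) by (simp add: field_simps)
qed simp

text \<open>
  The first five terms suffice. The weights for \<open>k = 2\<close> and \<open>k = 3\<close> are polynomials in
  \<open>a = 1 - 2\<epsilon>\<close>, and the one for \<open>k = 4\<close> is at most 1.
\<close>

lemma legendre_series_neg:
  assumes "admissible \<epsilon>" shows "legendre_series \<epsilon> (3/2) < 0"
proof -
  define a where "a = 1 - 2 * \<epsilon>"
  have a: "2/3 \<le> a" "a \<le> 1" using admissible_range[OF assms] by (auto simp: a_def)
  have w: "legendre_weight \<epsilon> 2 = a" "legendre_weight \<epsilon> 3 = a * (3 * a - 2)"
    by (simp_all add: eval_nat_numeral legendre_weight_Suc a_def algebra_simps)
  have w4: "legendre_weight \<epsilon> 4 \<le> 1" by (rule admissible_weight[OF assms])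
  have "legendre_series \<epsilon> (3/2) \<le> (\<Sum>k<2*2+1. (-1) ^ k * legendre_weight \<epsilon> k / (fact k)\<^sup>2 * (3/2) ^ k)"
    using assms by (intro legendre_series_partial_sums) auto
  also have "\<dots> = 1 - 3/2 + a * (9/16) - (3/32) * (a * (3 * a - 2)) + legendre_weight \<epsilon> 4 * (81/9216)"
    using w by (simp add: eval_nat_numeral legendre_weight_Suc a_def fact_numeral power2_eq_square)
  also have "\<dots> \<le> 1 - 3/2 + a * (9/16) - (3/32) * (a * (3 * a - 2)) + 81/9216"
    using w4 by simp
  also have "\<dots> < 0"
  proof -
    have "0 \<le> (1 - a) * (1 - a)" by simp
    then show ?thesis using a by (simp add: algebra_simps)
  qed
  finally show ?thesis .
qed

definition legendre_root :: "real \<Rightarrow> real" where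
  "legendre_root \<epsilon> = (THE y. 0 < y \<and> y < 3/2 \<and> legendre_series \<epsilon> y = 0)"

lemma legendre_root:
  assumes "admissible \<epsilon>"
  shows "0 < legendre_root \<epsilon>" "legendre_root \<epsilon> < 3/2" "legendre_series \<epsilon> (legendre_root \<epsilon>) = 0"
    "\<And>y. 0 \<le> y \<Longrightarrow> y < legendre_root \<epsilon> \<Longrightarrow> legendre_series \<epsilon> y > 0"
proof -
  have "continuous_on UNIV (legendre_series \<epsilon>)"
    using legendre_series_deriv[OF assms] by (metis DERIV_isCont continuous_at_imp_continuous_on)
  then have "\<exists>y\<ge>0. y \<le> 3/2 \<and> legendre_series \<epsilon> y = 0"
    using legendre_series_neg[OF assms]
    by (intro IVT2') (auto intro: continuous_on_subset)
  then obtain r where r: "0 \<le> r" "r \<le> 3/2" "legendre_series \<epsilon> r = 0" by blast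
  have "r \<noteq> 0" using r by auto
  moreover have "r \<noteq> 3/2" using r(3) legendre_series_neg[OF assms] by (metis less_irrefl)
  ultimately have r': "0 < r" "r < 3/2" using r by auto
  have pos: "legendre_series \<epsilon> y > 0" if "0 \<le> y" "y < r" for y
    using legendre_series_decreasing[OF assms, of y r] that r' r by simp
  have neg: "legendre_series \<epsilon> y < 0" if "r < y" "y < 3/2" for y
  proof -
    have "4 * legendre_series \<epsilon> y + (y - r) \<le> 4 * legendre_series \<epsilon> r"
      using that r' by (intro legendre_series_decreasing[OF assms]) auto
    then show ?thesis using r(3) that by linarith
  qed
  have "legendre_root \<epsilon> = r"
    unfolding legendre_root_def
    by (rule the_equality) (use r r' pos neg in \<open>auto, metis less_irrefl linorder_neqE_linordered_idom less_imp_le\<close>)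
  then show "0 < legendre_root \<epsilon>" "legendre_root \<epsilon> < 3/2" "legendre_series \<epsilon> (legendre_root \<epsilon>) = 0"
    "\<And>y. 0 \<le> y \<Longrightarrow> y < legendre_root \<epsilon> \<Longrightarrow> legendre_series \<epsilon> y > 0"
    using r r' pos by auto
qed

text \<open>
  The slope bound turns a small value of the series into a small distance from its root.
\<close>

lemma legendre_root_approx:
  assumes "admissible \<epsilon>" "0 \<le> y" "y \<le> 3/2"
  shows "\<bar>legendre_root \<epsilon> - y\<bar> \<le> 4 * \<bar>legendre_series \<epsilon> y\<bar>"
proof (cases "y \<le> legendre_root \<epsilon>")
  case True
  then have "4 * legendre_series \<epsilon> (legendre_root \<epsilon>) + (legendre_root \<epsilon> - y) \<le> 4 * legendre_series \<epsilon> y"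
    using assms legendre_root[OF assms(1)] by (intro legendre_series_decreasing) auto
  then show ?thesis using True legendre_root(3)[OF assms(1)] by linarith
next
  case False
  then have "4 * legendre_series \<epsilon> y + (y - legendre_root \<epsilon>) \<le> 4 * legendre_series \<epsilon> (legendre_root \<epsilon>)"
    using assms legendre_root[OF assms(1)] by (intro legendre_series_decreasing) auto
  then show ?thesis using False legendre_root(3)[OF assms(1)] by linarith
qed


section \<open>Largest Legendre roots, the first Bessel root and the size of the bound\<close>

lemma admissible_zero: "admissible 0" by (simp add: admissible_def)

lemma Bessel_J0_eq: "Bessel_J0 x = legendre_series 0 (x\<^sup>2 / 4)"
  unfolding Bessel_J0_def legendre_series_def
  by (rule arg_cong[of _ _ suminf]) (simp add: fun_eq_iff power_mult power_divide)

lemma Bessel_J0_first_root: "(LEAST x. 0 < x \<and> Bessel_J0 x = 0) = 2 * sqrt (legendre_root 0)"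
proof (rule Least_equality)
  note r = legendre_root[OF admissible_zero]
  show "0 < 2 * sqrt (legendre_root 0) \<and> Bessel_J0 (2 * sqrt (legendre_root 0)) = 0"
    using r(1,3) by (simp add: Bessel_J0_eq power_mult_distrib)
  fix x :: real assume x: "0 < x \<and> Bessel_J0 x = 0"
  show "2 * sqrt (legendre_root 0) \<le> x"
  proof (rule ccontr)
    assume "\<not> ?thesis"
    then have "x\<^sup>2 < (2 * sqrt (legendre_root 0))\<^sup>2" using x by (intro power_strict_mono) auto
    then have "x\<^sup>2 / 4 < legendre_root 0" using r(1) by (simp add: power_mult_distrib)
    then have "legendre_series 0 (x\<^sup>2 / 4) > 0" by (intro r(4)) auto
    then show False using x by (simp add: Bessel_J0_eq)
  qed
qed

text \<open>
  The two fractions lie between \<open>(2.40475/2)\<^sup>2\<close> and \<open>(2.40485/2)\<^sup>2\<close>; eight and nine terms of the series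
  determine its sign at them.
\<close>

lemma legendre_root_0_bounds: "5783 / 4000 < legendre_root 0" "legendre_root 0 < 72291 / 50000"
proof -
  note r = legendre_root[OF admissible_zero]
  have "0 < (\<Sum>k<2*4. (-1) ^ k * legendre_weight 0 k / (fact k)\<^sup>2 * (5783 / 4000 :: real) ^ k)"
    by (simp add: eval_nat_numeral fact_numeral power2_eq_square)
  also have "\<dots> \<le> legendre_series 0 (5783 / 4000)"
    by (rule legendre_series_partial_sums) (auto simp: admissible_zero)
  finally have 1: "0 < legendre_series 0 (5783 / 4000)" .
  show "5783 / 4000 < legendre_root 0"
  proof (rule ccontr)
    assume neg: "\<not> ?thesis"
    then have "4 * legendre_series 0 (5783 / 4000) + (5783 / 4000 - legendre_root 0) \<le> 4 * legendre_series 0 (legendre_root 0)"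
      using r(1) by (intro legendre_series_decreasing admissible_zero) auto
    then show False using 1 r(3) neg by simp
  qed
  have "legendre_series 0 (72291 / 50000) \<le> (\<Sum>k<2*4+1. (-1) ^ k * legendre_weight 0 k / (fact k)\<^sup>2 * (72291 / 50000 :: real) ^ k)"
    by (rule legendre_series_partial_sums) (auto simp: admissible_zero)
  also have "\<dots> < 0"
    by (simp add: eval_nat_numeral fact_numeral power2_eq_square)
  finally have 2: "legendre_series 0 (72291 / 50000) < 0" .
  show "legendre_root 0 < 72291 / 50000"
  proof (rule ccontr)
    assume neg: "\<not> ?thesis"
    then have "4 * legendre_series 0 (legendre_root 0) + (legendre_root 0 - 72291 / 50000) \<le> 4 * legendre_series 0 (72291 / 50000)"
      using r(2) by (intro legendre_series_decreasing admissible_zero) auto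
    then show False using 2 r(3) neg by simp
  qed
qed

lemma Bessel_J0_first_root_bounds: "\<bar>2 * sqrt (legendre_root 0) - 2.4048\<bar> < 0.00005"
proof -
  have "2.40475 / 2 < sqrt (legendre_root 0)"
    using legendre_root_0_bounds(1) by (intro real_less_rsqrt) (simp add: power2_eq_square)
  moreover have "sqrt (legendre_root 0) < 2.40485 / 2"
    using legendre_root_0_bounds(2) by (intro real_less_lsqrt) (simp_all add: power2_eq_square)
  ultimately show ?thesis unfolding abs_less_iff by (simp add: field_simps)
qed

lemma higher_pderiv_pcompose_linear:
  fixes p :: "real poly"
  shows "(pderiv ^^ n) (pcompose p [:a, b:]) = smult (b ^ n) (pcompose ((pderiv ^^ n) p) [:a, b:])"
proof (induction n)
  case (Suc n)
  then show ?case
    by (simp add: pderiv_smult pderiv_pcompose pderiv_pCons mult_ac)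
qed simp

text \<open>
  The substitution \<open>x = 1 - 2t\<close> turns \<open>(x\<^sup>2 - 1)^m\<close> into \<open>(-4)^m t^m (1 - t)^m\<close>, whose derivatives can
  be read off from the binomial expansion of \<open>(1 - t)^m\<close>.
\<close>

lemma poly_Legendre_poly:
  "poly (Legendre_poly m) (1 - 2 * t) =
    (\<Sum>k\<le>m. (-1) ^ k * (real (m choose k) * fact (m + k) / (fact k * fact m)) * t ^ k)"
proof -
  let ?q = "[:1, -2:] :: real poly"
  let ?P = "[:-1, 0, 1:] ^ m :: real poly"
  let ?S = "\<Sum>k\<le>m. monom (real (m choose k) * (-1) ^ k) (m + k)"
  have "poly (pcompose ?P ?q) x = poly (smult ((-4) ^ m) ?S) x" for x
  proof -
    have "poly (pcompose ?P ?q) x = (4 * x\<^sup>2 - 4 * x) ^ m"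
      by (simp add: poly_pcompose poly_power power2_eq_square algebra_simps)
    also have "4 * x\<^sup>2 - 4 * x = (-4) * (x * (1 - x))" by (simp add: power2_eq_square algebra_simps)
    also have "((-4) * (x * (1 - x))) ^ m = (-4) ^ m * (x ^ m * (- x + 1) ^ m)" by (simp only: power_mult_distrib) simp
    also have "(- x + 1) ^ m = (\<Sum>k\<le>m. real (m choose k) * (- x) ^ k)"
      by (subst binomial_ring) simp
    also have "x ^ m * \<dots> = poly ?S x"
      by (simp add: poly_sum poly_monom sum_distrib_left power_add power_minus[of x] mult_ac)
    finally show ?thesis by simp
  qed
  then have P: "pcompose ?P ?q = smult ((-4) ^ m) ?S" by (simp add: poly_eq_poly_eq_iff[symmetric] fun_eq_iff)
  have D: "poly ((pderiv ^^ m) ?S) t = (\<Sum>k\<le>m. (-1) ^ k * (real (m choose k) * fact (m + k) / fact k) * t ^ k)"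
  proof -
    have "pochhammer (real (Suc k)) m = fact (m + k) / fact k" for k
    proof -
      have "(fact (k + m) :: real) = fact k * pochhammer (real (Suc k)) m"
        using pochhammer_product[of k "k + m" "1 :: real"] by (simp add: pochhammer_fact)
      then show ?thesis by (simp add: add.commute)
    qed
    moreover have "(pderiv ^^ m) (monom c (m + k)) = monom (pochhammer (real (Suc k)) m * c) k" for c :: real and k
      by (rule poly_eqI) (simp add: coeff_higher_pderiv del: of_nat_Suc)
    ultimately show ?thesis
      by (simp add: higher_pderiv_sum poly_sum poly_monom mult_ac del: of_nat_Suc)
  qed
  have "smult ((-2) ^ m) (pcompose ((pderiv ^^ m) ?P) ?q) = smult ((-4) ^ m) ((pderiv ^^ m) ?S)"
    using higher_pderiv_pcompose_linear[of m ?P 1 "-2"] by (simp add: P higher_pderiv_smult)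
  then have "poly (smult ((-2) ^ m) (pcompose ((pderiv ^^ m) ?P) ?q)) t = poly (smult ((-4) ^ m) ((pderiv ^^ m) ?S)) t"
    by simp
  then have "(-2) ^ m * poly ((pderiv ^^ m) ?P) (1 - 2 * t) = (-2) ^ m * (2 ^ m * poly ((pderiv ^^ m) ?S) t)"
    by (simp add: poly_pcompose mult.commute[of t] flip: mult.assoc power_mult_distrib)
  then have "poly ((pderiv ^^ m) ?P) (1 - 2 * t) = 2 ^ m * poly ((pderiv ^^ m) ?S) t" by simp
  then have "poly (Legendre_poly m) (1 - 2 * t) = poly ((pderiv ^^ m) ?S) t / fact m"
    by (simp add: Legendre_poly_def)
  then show ?thesis unfolding D by (simp add: sum_divide_distrib)
qed

lemma poly_Legendre_poly_eq_series:
  assumes "m \<ge> 1" and e: "\<epsilon> = 1 / (real m * (real m + 1))"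
  shows "poly (Legendre_poly m) (1 - 2 * (\<epsilon> * y)) = legendre_series \<epsilon> y"
proof -
  have eps: "\<epsilon> * (real m * (real m + 1)) = 1" using assms by simp
  have w: "legendre_weight \<epsilon> k = \<epsilon> ^ k * (real (m choose k) * fact (m + k) * fact k / fact m)" if "k \<le> m" for k
    using that
  proof (induction k)
    case (Suc k)
    have c: "real (m choose Suc k) * (real k + 1) = real (m choose k) * (real m - real k)"
    proof -
      have "Suc k * (m choose Suc k) = (m - k) * (m choose k)"
        by (metis binomial_absorption binomial_absorb_comp)
      then have "real (Suc k) * real (m choose Suc k) = real (m - k) * real (m choose k)"
        by (metis of_nat_mult)
      then show ?thesis using Suc.prems by (simp add: of_nat_diff mult_ac add.commute)
    qed
    have f: "1 - \<epsilon> * (real k * (real k + 1)) = \<epsilon> * ((real m - real k) * (real m + real k + 1))"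
      using eps by (simp add: algebra_simps)
    have "\<epsilon> ^ Suc k * (real (m choose Suc k) * fact (m + Suc k) * fact (Suc k) / fact m)
        = \<epsilon> ^ k * \<epsilon> * (real (m choose Suc k) * (real k + 1)) * (real m + real k + 1) * fact (m + k) * fact k / fact m"
      by (simp add: algebra_simps)
    also have "\<dots> = legendre_weight \<epsilon> k * (\<epsilon> * ((real m - real k) * (real m + real k + 1)))"
      using Suc by (simp add: c)
    also have "\<dots> = legendre_weight \<epsilon> (Suc k)" by (simp add: legendre_weight_Suc f)
    finally show ?case by simp
  qed simp
  have "legendre_series \<epsilon> y = (\<Sum>k\<le>m. (-1) ^ k * legendre_weight \<epsilon> k / (fact k)\<^sup>2 * y ^ k)"
    unfolding legendre_series_def
    by (rule suminf_finite) (use legendre_weight_vanish[OF assms(1)] e in auto)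
  also have "\<dots> = (\<Sum>k\<le>m. (-1) ^ k * (real (m choose k) * fact (m + k) / (fact k * fact m)) * (\<epsilon> * y) ^ k)"
    by (intro sum.cong refl) (simp add: w power_mult_distrib power2_eq_square mult_ac)
  finally show ?thesis by (simp only: poly_Legendre_poly)
qed

lemma legendre_series_pos_at_nonpos:
  assumes "admissible \<epsilon>" "y \<le> 0"
  shows "legendre_series \<epsilon> y > 0"
proof -
  have nn: "0 \<le> (-1) ^ k * legendre_weight \<epsilon> k / (fact k)\<^sup>2 * y ^ k" for k
  proof -
    have "(-1) ^ k * legendre_weight \<epsilon> k / (fact k)\<^sup>2 * y ^ k = legendre_weight \<epsilon> k / (fact k)\<^sup>2 * (- y) ^ k"
      by (simp add: power_minus[of y])
    also have "0 \<le> \<dots>" using admissible_weight[OF assms(1)] assms(2) by simp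
    finally show ?thesis .
  qed
  have "(\<Sum>k<1. (-1) ^ k * legendre_weight \<epsilon> k / (fact k)\<^sup>2 * y ^ k) \<le> legendre_series \<epsilon> y"
    unfolding legendre_series_def
    by (rule sum_le_suminf[OF summable_entire[OF entire_legendre[OF assms(1)]] _ nn]) simp
  then show ?thesis by simp
qed

text \<open>
  Larger values of \<open>x\<close> correspond to smaller values of \<open>y\<close>, so the largest root belongs to the first
  positive root of the series. For \<open>y \<le> 0\<close>, that is \<open>x \<ge> 1\<close>, all terms of the series are nonnegative
  and the first is 1.
\<close>

lemma Max_root_Legendre_poly:
  assumes "m \<ge> 2" and e: "\<epsilon> = 1 / (real m * (real m + 1))"
  shows "Max {x. poly (Legendre_poly m) x = 0} = 1 - 2 * (\<epsilon> * legendre_root \<epsilon>)"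
proof (rule Max_eqI)
  have ad: "admissible \<epsilon>" using assms by (auto simp: admissible_def)
  have pos: "\<epsilon> > 0" using assms by simp
  have ev: "poly (Legendre_poly m) x = legendre_series \<epsilon> ((1 - x) / (2 * \<epsilon>))" for x
  proof -
    have "1 - 2 * (\<epsilon> * ((1 - x) / (2 * \<epsilon>))) = x" using pos by (simp add: field_simps)
    moreover have "m \<ge> 1" using assms(1) by simp
    ultimately show ?thesis
      using poly_Legendre_poly_eq_series[OF _ e, of "(1 - x) / (2 * \<epsilon>)"] by metis
  qed
  have "poly (Legendre_poly m) 1 = 1" by (simp add: ev)
  then have "Legendre_poly m \<noteq> 0" by auto
  then show "finite {x. poly (Legendre_poly m) x = 0}" by (rule poly_roots_finite)
  show "1 - 2 * (\<epsilon> * legendre_root \<epsilon>) \<in> {x. poly (Legendre_poly m) x = 0}"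
    using legendre_root(3)[OF ad] pos by (simp add: ev)
  fix x assume "x \<in> {x. poly (Legendre_poly m) x = 0}"
  then have x: "legendre_series \<epsilon> ((1 - x) / (2 * \<epsilon>)) = 0" by (simp add: ev)
  have "legendre_root \<epsilon> \<le> (1 - x) / (2 * \<epsilon>)"
  proof (rule ccontr)
    assume "\<not> ?thesis"
    then have "legendre_series \<epsilon> ((1 - x) / (2 * \<epsilon>)) > 0"
      using legendre_root(4)[OF ad] legendre_series_pos_at_nonpos[OF ad] by (meson linear not_le)
    then show False using x by simp
  qed
  then show "x \<le> 1 - 2 * (\<epsilon> * legendre_root \<epsilon>)" using pos by (simp add: field_simps)
qed

lemma harmonic_dim_nonneg: "n \<ge> 1 \<Longrightarrow> harmonic_dim n (2 * j) \<ge> 0"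
  by (auto simp: harmonic_dim_def intro!: binomial_right_mono)

text \<open>
  The sum telescopes; the result is the number of monomials of degree \<open>2d\<close> in \<open>n\<close> variables.
\<close>

lemma sum_harmonic_dim: 
  assumes "n \<ge> 1" 
  shows "(\<Sum>j=0..d. harmonic_dim n (2 * j)) = real ((n + 2 * d - 1) choose (2 * d))"
proof -
  have "(\<Sum>j=0..d. harmonic_dim n (2 * j)) = real ((n + 2 * d - 1) choose (n - 1))"
  proof (induction d)
    case 0
    then show ?case by (simp add: harmonic_dim_def)
  next
    case (Suc d)
    have "n + 2 * Suc d - 3 = n + 2 * d - 1" by simp
    then have "harmonic_dim n (2 * Suc d) = real ((n + 2 * Suc d - 1) choose (n - 1)) - real ((n + 2 * d - 1) choose (n - 1))"
      by (simp only: harmonic_dim_def) simp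
    then show ?case using Suc by simp
  qed
  also have "(n + 2 * d - 1) choose (n - 1) = (n + 2 * d - 1) choose (2 * d)"
    using assms by (subst binomial_symmetric) auto
  finally show ?thesis .
qed

text \<open>
  The Taylor polynomial of degree 2 with remainder shows that \<open>cos (8/5) < 0\<close>.
\<close>

lemma pi_less_sixteen_fifths: "pi < 16 / 5"
proof (rule ccontr)
  assume "\<not> ?thesis"
  then have "cos (8/5 :: real) \<ge> 0" by (intro cos_ge_zero) auto
  obtain t where "cos (8/5 :: real) = (\<Sum>m<4. cos_coeff m * (8/5) ^ m) + (cos (t + 1/2 * real 4 * pi) / fact 4) * (8/5) ^ 4"
    using Maclaurin_cos_expansion[of "8/5" 4] by blast
  moreover have "(\<Sum>m<4. cos_coeff m * (8/5 :: real) ^ m) = 1 - 32/25"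
  proof -
    have "(\<Sum>m<4. f m) = f 0 + f 1 + f 2 + f 3" for f :: "nat \<Rightarrow> real" by (simp add: eval_nat_numeral)
    then show ?thesis by (simp add: cos_coeff_def fact_numeral power2_eq_square)
  qed
  moreover have "cos (t + 1/2 * real 4 * pi) \<le> 1" by (rule cos_le_one)
  ultimately show False
    using \<open>cos (8/5 :: real) \<ge> 0\<close> cos_le_one[of t] by (simp add: fact_numeral power_divide)
qed

text \<open>
  Here \<open>s\<close> stands for \<open>1 - \<gamma>\<^sup>2\<close>. The factor decreases in \<open>j\<close>, and for \<open>j = d\<close> the fourth power of the
  claim reads \<open>s (pi (4d + 1))\<^sup>2 \<le> 256\<close>. With \<open>X = d (2d + 1)\<close> one has \<open>(4d + 1)\<^sup>2 = 8X + 1\<close> and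
  \<open>s \<le> 3/X\<close>, so that \<open>pi < 16/5\<close> and \<open>X \<ge> 3\<close> suffice.
\<close>

lemma bound_coefficient_ge_half:
  fixes s :: real
  assumes "d \<ge> 1" "j \<le> d" and s: "0 < s" "s \<le> 3 / (real d * (2 * real d + 1))"
  shows "1 / 2 \<le> 1 / s powr (1 / 4) * sqrt (4 / (pi * (4 * real j + 1)))"
proof -
  define X where "X = real d * (2 * real d + 1)"
  have X: "X \<ge> 3"
  proof -
    have "1 * (2 * 1 + 1) \<le> X" unfolding X_def using assms(1) by (intro mult_mono) auto
    then show ?thesis by simp
  qed
  have pi2: "pi\<^sup>2 \<le> (16/5)\<^sup>2" using pi_less_sixteen_fifths by (intro power_mono) auto
  have key: "s * (pi * (4 * real j + 1))\<^sup>2 \<le> 16\<^sup>2"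
  proof -
    have "(4 * real j + 1)\<^sup>2 \<le> (4 * real d + 1)\<^sup>2" using assms(2) by (intro power_mono) auto
    also have "\<dots> = 8 * X + 1" by (simp add: X_def power2_eq_square algebra_simps)
    finally have "(pi * (4 * real j + 1))\<^sup>2 \<le> (16/5)\<^sup>2 * (8 * X + 1)"
      unfolding power_mult_distrib using pi2 by (intro mult_mono) auto
    then have "s * (pi * (4 * real j + 1))\<^sup>2 \<le> 3 / X * ((16/5)\<^sup>2 * (8 * X + 1))"
      using s X unfolding X_def[symmetric] by (intro mult_mono) auto
    also have "\<dots> \<le> 16\<^sup>2" using X by (simp add: field_simps power2_eq_square)
    finally show ?thesis .
  qed
  have "sqrt s * (pi * (4 * real j + 1)) \<le> 16"
  proof -
    have "sqrt (s * (pi * (4 * real j + 1))\<^sup>2) \<le> sqrt (16\<^sup>2)" using key by (rule real_sqrt_le_mono)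
    then show ?thesis by (simp add: real_sqrt_mult)
  qed
  moreover have "0 < pi * (4 * real j + 1)" by (intro mult_pos_pos) auto
  ultimately have "sqrt s \<le> 16 / (pi * (4 * real j + 1))" by (simp only: pos_le_divide_eq)
  then have "sqrt (sqrt s) \<le> sqrt (4 * (4 / (pi * (4 * real j + 1))))" by (intro real_sqrt_le_mono) simp
  also have "\<dots> = 2 * sqrt (4 / (pi * (4 * real j + 1)))" by (subst real_sqrt_mult) simp
  also have "sqrt (sqrt s) = s powr (1 / 4)" using s by (simp add: powr_half_sqrt[symmetric] powr_powr)
  finally show ?thesis using s by (simp add: field_simps)
qed

lemma dimension_bound:
  assumes "n \<ge> 1" "d \<ge> 1" and s: "0 < s" "s \<le> 3 / (real d * (2 * real d + 1))"
  shows "real ((n + 2 * d - 1) choose (2 * d)) / 2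
     \<le> 1 / s powr (1 / 4) * (\<Sum>j=0..d. harmonic_dim n (2 * j) * sqrt (4 / (pi * (4 * real j + 1))))"
proof -
  have "real ((n + 2 * d - 1) choose (2 * d)) / 2 = (\<Sum>j=0..d. harmonic_dim n (2 * j) * (1 / 2))"
    using sum_harmonic_dim[OF assms(1), of d] by (simp flip: sum_divide_distrib)
  also have "\<dots> \<le> (\<Sum>j=0..d. harmonic_dim n (2 * j) * (1 / s powr (1 / 4) * sqrt (4 / (pi * (4 * real j + 1)))))"
    using bound_coefficient_ge_half[OF assms(2) _ s] harmonic_dim_nonneg[OF assms(1)]
    by (intro sum_mono mult_left_mono) auto
  finally show ?thesis by (simp add: sum_distrib_left mult_ac)
qed

text \<open>
  With \<open>t = \<epsilon> r(\<epsilon>)\<close> the root is \<open>1 - 2t\<close>, and \<open>1 - (1 - 2t)\<^sup>2 = 4 t (1 - t)\<close>, where \<open>r(\<epsilon>) < 3/2\<close>.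
\<close>

lemma Max_root_Legendre_poly_bounds:
  assumes "d \<ge> 1" "g = Max {x. poly (Legendre_poly (2 * d)) x = 0}"
  shows "0 < 1 - g\<^sup>2" "1 - g\<^sup>2 \<le> 3 / (real d * (2 * real d + 1))"
proof -
  define \<epsilon> where "\<epsilon> = 1 / (real (2 * d) * (real (2 * d) + 1))"
  have ad: "admissible \<epsilon>" using assms(1) by (auto simp: admissible_def \<epsilon>_def intro!: exI[of _ "2 * d"])
  have g: "g = 1 - 2 * (\<epsilon> * legendre_root \<epsilon>)"
    using assms Max_root_Legendre_poly[of "2 * d" \<epsilon>] by (simp add: \<epsilon>_def)
  define t where "t = \<epsilon> * legendre_root \<epsilon>"
  have e: "0 < \<epsilon>" "\<epsilon> \<le> 1/6" using admissible_range[OF ad] assms(1) by (auto simp: \<epsilon>_def)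
  have t0: "0 < t" unfolding t_def using e legendre_root[OF ad] by simp
  have t1: "t \<le> \<epsilon> * (3/2)" unfolding t_def using e legendre_root[OF ad] by (intro mult_left_mono) auto
  have eq: "1 - g\<^sup>2 = 4 * t * (1 - t)" unfolding g t_def[symmetric] by (simp add: power2_eq_square algebra_simps)
  show "0 < 1 - g\<^sup>2" unfolding eq using t0 t1 e by simp
  have "1 - g\<^sup>2 \<le> 4 * t" unfolding eq using t0 by simp
  also have "\<dots> \<le> 6 * \<epsilon>" using t1 by simp
  also have "\<dots> = 3 / (real d * (2 * real d + 1))"
  proof -
    have "real (2 * d) * (real (2 * d) + 1) = 2 * (real d * (2 * real d + 1))" by (simp add: algebra_simps)
    then show ?thesis unfolding \<epsilon>_def by simp
  qed
  finally show "1 - g\<^sup>2 \<le> 3 / (real d * (2 * real d + 1))" .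
qed


section \<open>Perturbation of the first root\<close>

definition bessel_coeff :: "nat \<Rightarrow> real" where
  "bessel_coeff k = (-1) ^ k / (fact k)\<^sup>2"

text \<open>
  The Euler operator \<open>y d/dy\<close> multiplies the coefficient of \<open>y^k\<close> by \<open>k\<close>; this is its \<open>i\<close>-th power
  applied to \<open>J\<^sub>0(2 sqrt y)\<close>. The weights are polynomials in \<open>k\<close> at each order in \<open>\<epsilon>\<close>, so these functions
  are the coefficients of the expansion of the series in \<open>\<epsilon>\<close>.
\<close>

definition bessel_moment :: "nat \<Rightarrow> real \<Rightarrow> real" where
  "bessel_moment i y = suminf (\<lambda>k. real k ^ i * bessel_coeff k * y ^ k)"

lemma entire_bessel_moment: "entire (\<lambda>k. real k ^ i * bessel_coeff k)"
  by (rule entire_power_index, rule entire_comparison[OF entire_inverse_fact_sq])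
     (simp add: bessel_coeff_def abs_mult)

lemma bessel_moment_sums: "(\<lambda>k. real k ^ i * bessel_coeff k * y ^ k) sums bessel_moment i y"
  unfolding bessel_moment_def by (rule summable_sums[OF summable_entire[OF entire_bessel_moment]])

lemma bessel_moment_0: "bessel_moment 0 y = legendre_series 0 y"
  by (simp add: bessel_moment_def legendre_series_def bessel_coeff_def)

text \<open>
  The factor \<open>k\<^sup>2\<close> cancels against \<open>(k!)\<^sup>2\<close> and shifts the index by one. This is the differential
  equation of \<open>J\<^sub>0\<close>, differentiated \<open>i\<close> times.
\<close>

lemma bessel_moment_shift:
  assumes s: "(\<lambda>k. real (Suc k) ^ i * bessel_coeff k * y ^ k) sums S"
    and j: "j = i + 2"
  shows "bessel_moment j y = - y * S"
proof -
  have "(\<lambda>k. - y * (real (Suc k) ^ i * bessel_coeff k * y ^ k)) sums (- y * S)"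
    using s by (rule sums_mult)
  also have "(\<lambda>k. - y * (real (Suc k) ^ i * bessel_coeff k * y ^ k))
      = (\<lambda>k. real (Suc k) ^ (i + 2) * bessel_coeff (Suc k) * y ^ Suc k)"
    by (rule ext) (simp add: bessel_coeff_def power2_eq_square power_add divide_simps del: of_nat_Suc)
  finally have "(\<lambda>k. real k ^ (i + 2) * bessel_coeff k * y ^ k) sums (- y * S)"
    by (subst (asm) sums_Suc_iff) simp
  then show ?thesis unfolding j using sums_unique2 bessel_moment_sums by blast
qed

lemma bessel_moment_reduce:
  "bessel_moment 2 y = - y * bessel_moment 0 y"
  "bessel_moment 3 y = - y * (bessel_moment 0 y + bessel_moment 1 y)"
  "bessel_moment 4 y = - y * (bessel_moment 0 y + 2 * bessel_moment 1 y + bessel_moment 2 y)"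
  "bessel_moment 5 y = - y * (bessel_moment 0 y + 3 * bessel_moment 1 y + 3 * bessel_moment 2 y + bessel_moment 3 y)"
  "bessel_moment 6 y = - y * (bessel_moment 0 y + 4 * bessel_moment 1 y + 6 * bessel_moment 2 y + 4 * bessel_moment 3 y + bessel_moment 4 y)"
proof -
  define t where "t i k = real k ^ i * bessel_coeff k * y ^ k" for i k
  have s: "t i sums bessel_moment i y" for i unfolding t_def by (rule bessel_moment_sums)
  show "bessel_moment 2 y = - y * bessel_moment 0 y"
    using s[of 0] unfolding t_def by - (rule bessel_moment_shift[where i = 0], simp_all)
  have "(\<lambda>k. t 0 k + t 1 k) sums
      (bessel_moment 0 y + bessel_moment 1 y)"
    by (intro sums_add sums_mult s)
  moreover have "(\<lambda>k. t 0 k + t 1 k) = (\<lambda>k. real (Suc k) ^ 1 * bessel_coeff k * y ^ k)"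
    by (rule ext) (simp add: t_def eval_nat_numeral algebra_simps)
  ultimately show "bessel_moment 3 y = - y * (bessel_moment 0 y + bessel_moment 1 y)"
    by - (rule bessel_moment_shift[where i = 1], simp_all)
  have "(\<lambda>k. t 0 k + 2 * t 1 k + t 2 k) sums
      (bessel_moment 0 y + 2 * bessel_moment 1 y + bessel_moment 2 y)"
    by (intro sums_add sums_mult s)
  moreover have "(\<lambda>k. t 0 k + 2 * t 1 k + t 2 k) = (\<lambda>k. real (Suc k) ^ 2 * bessel_coeff k * y ^ k)"
    by (rule ext) (simp add: t_def eval_nat_numeral algebra_simps)
  ultimately show "bessel_moment 4 y = - y * (bessel_moment 0 y + 2 * bessel_moment 1 y + bessel_moment 2 y)"
    by - (rule bessel_moment_shift[where i = 2], simp_all)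
  have "(\<lambda>k. t 0 k + 3 * t 1 k + 3 * t 2 k + t 3 k) sums
      (bessel_moment 0 y + 3 * bessel_moment 1 y + 3 * bessel_moment 2 y + bessel_moment 3 y)"
    by (intro sums_add sums_mult s)
  moreover have "(\<lambda>k. t 0 k + 3 * t 1 k + 3 * t 2 k + t 3 k) = (\<lambda>k. real (Suc k) ^ 3 * bessel_coeff k * y ^ k)"
    by (rule ext) (simp add: t_def eval_nat_numeral algebra_simps)
  ultimately show "bessel_moment 5 y = - y * (bessel_moment 0 y + 3 * bessel_moment 1 y + 3 * bessel_moment 2 y + bessel_moment 3 y)"
    by - (rule bessel_moment_shift[where i = 3], simp_all)
  have "(\<lambda>k. t 0 k + 4 * t 1 k + 6 * t 2 k + 4 * t 3 k + t 4 k) sums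
      (bessel_moment 0 y + 4 * bessel_moment 1 y + 6 * bessel_moment 2 y + 4 * bessel_moment 3 y + bessel_moment 4 y)"
    by (intro sums_add sums_mult s)
  moreover have "(\<lambda>k. t 0 k + 4 * t 1 k + 6 * t 2 k + 4 * t 3 k + t 4 k) = (\<lambda>k. real (Suc k) ^ 4 * bessel_coeff k * y ^ k)"
    by (rule ext) (simp add: t_def eval_nat_numeral algebra_simps)
  ultimately show "bessel_moment 6 y = - y * (bessel_moment 0 y + 4 * bessel_moment 1 y + 6 * bessel_moment 2 y + 4 * bessel_moment 3 y + bessel_moment 4 y)"
    by - (rule bessel_moment_shift[where i = 4], simp_all)
qed

text \<open>
  In the variable \<open>s = ln (y / r)\<close>, where \<open>r\<close> is the root of the Bessel series, the Euler operator
  becomes \<open>d/ds\<close>, so that differentiation only raises the index.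
\<close>

definition bessel_log :: "nat \<Rightarrow> real \<Rightarrow> real" where
  "bessel_log i s = bessel_moment i (legendre_root 0 * exp s)"

lemma bessel_log_deriv: "(bessel_log i has_field_derivative bessel_log (Suc i) s) (at s)"
proof -
  let ?a = "\<lambda>k. real k ^ i * bessel_coeff k"
  let ?y = "legendre_root 0 * exp s"
  have "((\<lambda>s. suminf (\<lambda>k. ?a k * (legendre_root 0 * exp s) ^ k)) has_field_derivative
      suminf (\<lambda>k. diffs ?a k * ?y ^ k) * ?y) (at s)"
    by (rule DERIV_chain2[OF entire_has_derivative[OF entire_bessel_moment]])
       (auto intro!: derivative_eq_intros)
  also have "suminf (\<lambda>k. diffs ?a k * ?y ^ k) * ?y = suminf (\<lambda>k. real k * ?a k * ?y ^ k)"
    using entire_euler_derivative[OF entire_bessel_moment, of ?y i] by (simp add: mult.commute)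
  finally show ?thesis
    by (simp add: bessel_log_def[abs_def] bessel_moment_def mult_ac)
qed

lemma bessel_log_bounded: "\<exists>K\<ge>0. \<forall>t. \<bar>t\<bar> \<le> 1 \<longrightarrow> \<bar>bessel_log i t\<bar> \<le> K"
proof -
  have "continuous_on {-1..1} (bessel_log i)"
    using bessel_log_deriv by (metis DERIV_isCont continuous_at_imp_continuous_on)
  then have "compact (bessel_log i ` {-1..1})" by (intro compact_continuous_image) auto
  then have "bounded (bessel_log i ` {-1..1})" by (rule compact_imp_bounded)
  then obtain K where K: "\<And>x. x \<in> bessel_log i ` {-1..1} \<Longrightarrow> norm x \<le> K"
    unfolding bounded_iff by blast
  have "\<bar>bessel_log i t\<bar> \<le> \<bar>K\<bar>" if "\<bar>t\<bar> \<le> 1" for t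
  proof -
    have "t \<in> {-1..1}" using that by auto
    then have "norm (bessel_log i t) \<le> K" by (intro K imageI)
    then show ?thesis by simp
  qed
  then show ?thesis by (intro exI[of _ "\<bar>K\<bar>"]) auto
qed

lemma bessel_log_taylor:
  obtains K where "\<And>i. K i \<ge> 0"
    "\<And>i n s. \<bar>s\<bar> \<le> 1 \<Longrightarrow> \<bar>bessel_log i s - (\<Sum>m<n. bessel_log (i + m) 0 / fact m * s ^ m)\<bar> \<le> K (i + n) * \<bar>s\<bar> ^ n"
proof -
  obtain K where K: "\<And>i. K i \<ge> 0" "\<And>i t. \<bar>t\<bar> \<le> 1 \<Longrightarrow> \<bar>bessel_log i t\<bar> \<le> K i"
    using bessel_log_bounded by metis
  have "\<bar>bessel_log i s - (\<Sum>m<n. bessel_log (i + m) 0 / fact m * s ^ m)\<bar> \<le> K (i + n) * \<bar>s\<bar> ^ n" 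
    if s: "\<bar>s\<bar> \<le> 1" for i n s
  proof -
    obtain t where t: "\<bar>t\<bar> \<le> \<bar>s\<bar>"
      "bessel_log i s = (\<Sum>m<n. bessel_log (i + m) 0 / fact m * s ^ m) + bessel_log (i + n) t / fact n * s ^ n"
      using Maclaurin_all_le[of "\<lambda>m. bessel_log (i + m)" "bessel_log i" s n] bessel_log_deriv by auto
    have "\<bar>bessel_log (i + n) t / fact n\<bar> \<le> K (i + n)"
    proof -
      have "\<bar>bessel_log (i + n) t\<bar> / fact n \<le> \<bar>bessel_log (i + n) t\<bar> / 1"
        by (intro divide_left_mono) (auto simp: fact_ge_1)
      also have "\<dots> \<le> K (i + n)" using K(2)[of t] t(1) s by simp
      finally show ?thesis by simp
    qed
    then have "\<bar>bessel_log (i + n) t / fact n * s ^ n\<bar> \<le> K (i + n) * \<bar>s\<bar> ^ n"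
      unfolding abs_mult power_abs by (rule mult_right_mono) simp
    then show ?thesis using t(2) by simp
  qed
  then show ?thesis using that K(1) by blast
qed

text \<open>
  At a zero of \<open>J\<^sub>0\<close> the recursion expresses all moments through the first one.
\<close>

lemma bessel_log_values:
  defines "r \<equiv> legendre_root 0" and "X \<equiv> bessel_log 1 0"
  shows "bessel_log 0 0 = 0" "bessel_log 2 0 = 0" "bessel_log 3 0 = - r * X" "bessel_log 4 0 = - 2 * r * X"
    "bessel_log 5 0 = (r\<^sup>2 - 3 * r) * X" "bessel_log 6 0 = (6 * r\<^sup>2 - 4 * r) * X"
proof -
  have v0: "bessel_moment 0 r = 0" using legendre_root(3)[OF admissible_zero] by (simp add: bessel_moment_0 r_def)
  have X: "X = bessel_moment 1 r" by (simp add: X_def bessel_log_def r_def)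
  have l: "bessel_log i 0 = bessel_moment i r" for i by (simp add: bessel_log_def r_def)
  note v = bessel_moment_reduce[of r] v0 X l
  show "bessel_log 0 0 = 0" "bessel_log 2 0 = 0" "bessel_log 3 0 = - r * X" "bessel_log 4 0 = - 2 * r * X"
    by (simp_all add: v)
  show "bessel_log 5 0 = (r\<^sup>2 - 3 * r) * X" "bessel_log 6 0 = (6 * r\<^sup>2 - 4 * r) * X"
    by (simp_all add: v power2_eq_square algebra_simps)
qed

text \<open>
  The first and second elementary symmetric polynomials of the numbers \<open>j(j+1)\<close> with \<open>j < k\<close>, which
  are the coefficients of \<open>- \<epsilon>\<close> and \<open>\<epsilon>\<^sup>2\<close> in \<open>legendre_weight \<epsilon> k\<close>.
\<close>

definition weight_e1 :: "nat \<Rightarrow> real" where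
  "weight_e1 k = (real k ^ 3 - real k) / 3"

definition weight_e2 :: "nat \<Rightarrow> real" where
  "weight_e2 k = - real k / 15 + real k ^ 2 / 18 + real k ^ 3 / 6 - real k ^ 4 / 9 - real k ^ 5 / 10 + real k ^ 6 / 18"

lemma weight_e1_Suc: "weight_e1 (Suc k) = weight_e1 k + real k * (real k + 1)"
  by (simp add: weight_e1_def eval_nat_numeral field_simps)

lemma weight_e2_Suc: "weight_e2 (Suc k) = weight_e2 k + real k * (real k + 1) * weight_e1 k"
  by (simp add: weight_e2_def weight_e1_def eval_nat_numeral field_simps)

lemma weight_e_bounds: "0 \<le> weight_e1 k" "weight_e1 k \<le> real k ^ 3" "0 \<le> weight_e2 k" "weight_e2 k \<le> real k ^ 6"
proof -
  have e1: "0 \<le> weight_e1 k \<and> weight_e1 k \<le> real k ^ 3" for k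
  proof (induction k)
    case (Suc k)
    have "real k ^ 3 + real k * (real k + 1) \<le> real (Suc k) ^ 3"
      by (simp add: eval_nat_numeral algebra_simps)
    moreover have "0 \<le> real k * (real k + 1)" by simp
    ultimately show ?case using Suc unfolding weight_e1_Suc by linarith
  qed (simp add: weight_e1_def)
  have e2: "0 \<le> weight_e2 k \<and> weight_e2 k \<le> real k ^ 6" for k
  proof (induction k)
    case (Suc k)
    have "real k * (real k + 1) * weight_e1 k \<le> real k * (real k + 1) * real k ^ 3"
      using e1[of k] by (intro mult_left_mono) auto
    moreover have "real k ^ 6 + real k * (real k + 1) * real k ^ 3 \<le> real (Suc k) ^ 6"
      by (simp add: eval_nat_numeral algebra_simps)
    moreover have "0 \<le> real k * (real k + 1) * weight_e1 k" using e1[of k] by simp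
    ultimately show ?case using Suc unfolding weight_e2_Suc by linarith
  qed (simp add: weight_e2_def)
  show "0 \<le> weight_e1 k" "weight_e1 k \<le> real k ^ 3" "0 \<le> weight_e2 k" "weight_e2 k \<le> real k ^ 6"
    using e1 e2 by auto
qed

text \<open>
  For \<open>k \<le> m\<close> the factors of the weight lie in \<open>[0, 1]\<close>, so that the error grows by at most
  \<open>\<epsilon>\<^sup>3 k (k+1) weight_e2 k\<close> in each step. For \<open>k > m\<close> the weight vanishes while \<open>\<epsilon> k\<^sup>2 \<ge> 1\<close>, and each
  of the three terms of the approximation is at most \<open>\<epsilon>\<^sup>3 k^9\<close>.
\<close>

lemma legendre_weight_expansion:
  assumes ad: "admissible \<epsilon>"
  shows "\<bar>legendre_weight \<epsilon> k - (1 - \<epsilon> * weight_e1 k + \<epsilon>\<^sup>2 * weight_e2 k)\<bar> \<le> 3 * \<epsilon> ^ 3 * real k ^ 9"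
proof (cases "\<epsilon> = 0")
  case False
  then obtain m where m: "m \<ge> 2" "\<epsilon> = 1 / (real m * (real m + 1))" using ad by (auto simp: admissible_def)
  have pos: "\<epsilon> > 0" using m by simp
  have P: "\<epsilon> * (real m * (real m + 1)) = 1" using m by simp
  define \<rho> where "\<rho> k = legendre_weight \<epsilon> k - (1 - \<epsilon> * weight_e1 k + \<epsilon>\<^sup>2 * weight_e2 k)" for k
  have rec: "\<rho> (Suc k) = \<rho> k * (1 - \<epsilon> * (real k * (real k + 1))) - \<epsilon> ^ 3 * (real k * (real k + 1) * weight_e2 k)" for k
    unfolding \<rho>_def legendre_weight_Suc weight_e1_Suc weight_e2_Suc by (simp add: eval_nat_numeral algebra_simps)
  show ?thesis
  proof (cases "k \<le> m")
    case True
    have "\<bar>\<rho> k\<bar> \<le> \<epsilon> ^ 3 * real k ^ 9"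
      using True
    proof (induction k)
      case 0
      then show ?case by (simp add: \<rho>_def weight_e1_def weight_e2_def)
    next
      case (Suc k)
      have "real k * (real k + 1) \<le> real m * (real m + 1)" using Suc.prems by (intro mult_mono) auto
      then have "\<epsilon> * (real k * (real k + 1)) \<le> \<epsilon> * (real m * (real m + 1))" using pos by (intro mult_left_mono) auto
      then have "\<bar>1 - \<epsilon> * (real k * (real k + 1))\<bar> \<le> 1" using P pos by simp
      then have 1: "\<bar>\<rho> k * (1 - \<epsilon> * (real k * (real k + 1)))\<bar> \<le> \<bar>\<rho> k\<bar> * 1"
        unfolding abs_mult by (rule mult_left_mono) simp
      have 2: "\<bar>\<epsilon> ^ 3 * (real k * (real k + 1) * weight_e2 k)\<bar> \<le> \<epsilon> ^ 3 * (real k * (real k + 1) * real k ^ 6)"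
        using weight_e_bounds[of k] pos by (auto simp: abs_mult intro!: mult_left_mono)
      have "\<bar>\<rho> (Suc k)\<bar> \<le> \<epsilon> ^ 3 * real k ^ 9 + \<epsilon> ^ 3 * (real k * (real k + 1) * real k ^ 6)"
        unfolding rec using 1 2 Suc by linarith
      also have "\<dots> = \<epsilon> ^ 3 * (real k ^ 9 + real k * (real k + 1) * real k ^ 6)" by (simp add: distrib_left)
      also have "\<dots> \<le> \<epsilon> ^ 3 * real (Suc k) ^ 9"
        using pos by (intro mult_left_mono) (simp_all add: eval_nat_numeral algebra_simps)
      finally show ?case .
    qed
    also have "\<dots> \<le> 3 * \<epsilon> ^ 3 * real k ^ 9" using pos by simp
    finally show ?thesis by (simp add: \<rho>_def)
  next
    case False
    then have w: "legendre_weight \<epsilon> k = 0" using m legendre_weight_vanish[of m k] by simp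
    define u where "u = \<epsilon> * real k ^ 2"
    have k1: "real k \<ge> 1" using False m by simp
    have "1 \<le> u"
    proof -
      have "real m * (real m + 1) \<le> real k * real k" using False by (intro mult_mono) auto
      then have "\<epsilon> * (real m * (real m + 1)) \<le> \<epsilon> * (real k * real k)" using pos by (intro mult_left_mono) auto
      then show ?thesis using P by (simp add: u_def power2_eq_square)
    qed
    then have u0: "0 \<le> u" by linarith
    have u: "1 \<le> u ^ 3" "u \<le> u ^ 3" "u ^ 2 \<le> u ^ 3"
      using one_le_power[OF \<open>1 \<le> u\<close>, of 3] power_increasing[OF _ \<open>1 \<le> u\<close>, of 1 3]
        power_increasing[OF _ \<open>1 \<le> u\<close>, of 2 3] by simp_all
    have u3: "u ^ 3 * real k ^ 3 = \<epsilon> ^ 3 * real k ^ 9" by (simp add: u_def power_mult_distrib flip: power_mult power_add)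
    have k3: "1 \<le> real k ^ 3" "real k \<le> real k ^ 3" "real k ^ 2 \<le> real k ^ 3"
      using k1 power_increasing[of 1 3 "real k"] power_increasing[of 2 3 "real k"] by auto
    have "\<bar>legendre_weight \<epsilon> k - (1 - \<epsilon> * weight_e1 k + \<epsilon>\<^sup>2 * weight_e2 k)\<bar> \<le> 1 + \<epsilon> * real k ^ 3 + \<epsilon>\<^sup>2 * real k ^ 6"
    proof -
      have "\<epsilon> * weight_e1 k \<le> \<epsilon> * real k ^ 3" "0 \<le> \<epsilon> * weight_e1 k"
        "\<epsilon>\<^sup>2 * weight_e2 k \<le> \<epsilon>\<^sup>2 * real k ^ 6" "0 \<le> \<epsilon>\<^sup>2 * weight_e2 k"
        using weight_e_bounds[of k] pos by (auto intro!: mult_left_mono)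
      then show ?thesis unfolding w by linarith
    qed
    also have "\<dots> = 1 + u * real k + u ^ 2 * real k ^ 2"
      by (simp add: u_def eval_nat_numeral algebra_simps)
    also have "\<dots> \<le> u ^ 3 * real k ^ 3 + u ^ 3 * real k ^ 3 + u ^ 3 * real k ^ 3"
    proof (intro add_mono)
      have "1 * 1 \<le> u ^ 3 * real k ^ 3" using u k3 u0 by (intro mult_mono) auto
      then show "1 \<le> u ^ 3 * real k ^ 3" by simp
      have nn: "0 \<le> u ^ 3" using u0 by simp
      show "u * real k \<le> u ^ 3 * real k ^ 3"
        by (rule mult_mono[OF u(2) k3(2) nn]) simp
      show "u ^ 2 * real k ^ 2 \<le> u ^ 3 * real k ^ 3"
        by (rule mult_mono[OF u(3) k3(3) nn]) simp
    qed
    finally show ?thesis unfolding u3 by simp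
  qed
qed (simp add: weight_e1_def)

text \<open>
  The expansion of the weights to second order in \<open>\<epsilon>\<close>, with \<open>k^i\<close> replaced by \<open>h i\<close>.
\<close>

definition second_order :: "real \<Rightarrow> (nat \<Rightarrow> real) \<Rightarrow> real" where
  "second_order \<epsilon> h = h 0 - \<epsilon> * ((h 3 - h 1) / 3)
     + \<epsilon>\<^sup>2 * (- h 1 / 15 + h 2 / 18 + h 3 / 6 - h 4 / 9 - h 5 / 10 + h 6 / 18)"

lemma legendre_series_expansion:
  obtains C where "\<And>\<epsilon> y. admissible \<epsilon> \<Longrightarrow> 0 \<le> y \<Longrightarrow> y \<le> 5 \<Longrightarrow>
    \<bar>legendre_series \<epsilon> y - second_order \<epsilon> (\<lambda>i. bessel_moment i y)\<bar> \<le> C * \<epsilon> ^ 3"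
proof -
  define D where "D k = 3 * (real k ^ 9 * (1 / (fact k)\<^sup>2) * 5 ^ k)" for k :: nat
  have D: "summable D" unfolding D_def
    by (intro summable_mult summable_entire entire_power_index entire_inverse_fact_sq)
  have "\<bar>legendre_series \<epsilon> y - second_order \<epsilon> (\<lambda>i. bessel_moment i y)\<bar> \<le> suminf D * \<epsilon> ^ 3"
    if ad: "admissible \<epsilon>" and y: "0 \<le> y" "y \<le> 5" for \<epsilon> y
  proof -
    let ?S = "legendre_series \<epsilon> y - second_order \<epsilon> (\<lambda>i. bessel_moment i y)"
    define f where "f k = (legendre_weight \<epsilon> k - (1 - \<epsilon> * weight_e1 k + \<epsilon>\<^sup>2 * weight_e2 k)) * (bessel_coeff k * y ^ k)" for k
    define b where "b i k = real k ^ i * bessel_coeff k * y ^ k" for i k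
    have bs: "b i sums bessel_moment i y" for i unfolding b_def by (rule bessel_moment_sums)
    have ls: "(\<lambda>k. (-1) ^ k * legendre_weight \<epsilon> k / (fact k)\<^sup>2 * y ^ k) sums legendre_series \<epsilon> y"
      unfolding legendre_series_def by (rule summable_sums[OF summable_entire[OF entire_legendre[OF ad]]])
    have "(\<lambda>k. (-1) ^ k * legendre_weight \<epsilon> k / (fact k)\<^sup>2 * y ^ k - second_order \<epsilon> (\<lambda>i. b i k)) sums ?S"
      unfolding second_order_def by (intro sums_diff sums_add sums_mult sums_divide sums_minus ls bs)
    also have "(\<lambda>k. (-1) ^ k * legendre_weight \<epsilon> k / (fact k)\<^sup>2 * y ^ k - second_order \<epsilon> (\<lambda>i. b i k)) = f"
    proof
      fix k
      have "(-1) ^ k * legendre_weight \<epsilon> k / (fact k)\<^sup>2 * y ^ k = legendre_weight \<epsilon> k * (bessel_coeff k * y ^ k)"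
        by (simp add: bessel_coeff_def)
      moreover have "b i k = real k ^ i * (bessel_coeff k * y ^ k)" for i by (simp add: b_def)
      ultimately show "(-1) ^ k * legendre_weight \<epsilon> k / (fact k)\<^sup>2 * y ^ k - second_order \<epsilon> (\<lambda>i. b i k) = f k"
        by (simp add: second_order_def f_def weight_e1_def weight_e2_def field_simps)
    qed
    finally have fS: "f sums ?S" .
    have fD: "norm (f k) \<le> D k * \<epsilon> ^ 3" for k
    proof -
      have "\<bar>bessel_coeff k * y ^ k\<bar> \<le> 1 / (fact k)\<^sup>2 * 5 ^ k"
        using y by (auto simp: bessel_coeff_def abs_mult intro!: divide_right_mono power_mono)
      then have "norm (f k) \<le> (3 * \<epsilon> ^ 3 * real k ^ 9) * (1 / (fact k)\<^sup>2 * 5 ^ k)"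
        unfolding f_def real_norm_def abs_mult[of "legendre_weight \<epsilon> k - _"]
        by (intro mult_mono legendre_weight_expansion ad) (use admissible_range[OF ad] in auto)
      then show ?thesis by (simp add: D_def mult_ac)
    qed
    have "norm (suminf f) \<le> suminf (\<lambda>k. D k * \<epsilon> ^ 3)"
      using D by (intro norm_suminf_le fD summable_mult2)
    then show ?thesis using sums_unique[OF fS] suminf_mult2[OF D, of "\<epsilon> ^ 3"] by simp
  qed
  then show ?thesis using that by blast
qed


text \<open>
  The logarithm of \<open>r(\<epsilon>)/r(0)\<close> up to \<open>O(\<epsilon>\<^sup>3)\<close>. The two coefficients are determined by the vanishing of
  the terms of order \<open>\<epsilon>\<close> and \<open>\<epsilon>\<^sup>2\<close> when this expression is inserted for \<open>s\<close> into the expanded series.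
\<close>

definition root_expansion :: "real \<Rightarrow> real" where
  "root_expansion \<epsilon> = - (legendre_root 0 + 1) / 3 * \<epsilon>
     + (1 / 15 + 4 * legendre_root 0 / 45 - (legendre_root 0)\<^sup>2 / 90) * \<epsilon>\<^sup>2"

lemma root_expansion_range:
  assumes "0 \<le> \<epsilon>" "\<epsilon> \<le> 1 / 6"
  shows "- \<epsilon> \<le> root_expansion \<epsilon>" "root_expansion \<epsilon> \<le> 0"
proof -
  define r where "r = legendre_root 0"
  have r: "0 < r" "r < 3/2" using legendre_root[OF admissible_zero] by (auto simp: r_def)
  define s1 s2 where "s1 = (r + 1) / 3" and "s2 = 1 / 15 + 4 * r / 45 - r\<^sup>2 / 90"
  have s1: "1/3 \<le> s1" "s1 \<le> 1" using r by (auto simp: s1_def)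
  have "r\<^sup>2 \<le> (3/2)\<^sup>2" using r by (intro power_mono) auto
  then have r2: "r\<^sup>2 \<le> 9/4" by (simp add: power2_eq_square)
  have r2': "0 \<le> r\<^sup>2" by simp
  have s2: "0 \<le> s2" "s2 \<le> 2" using r r2 r2' unfolding s2_def by linarith+
  have eq: "root_expansion \<epsilon> = \<epsilon> * (s2 * \<epsilon> - s1)"
    by (simp add: root_expansion_def s1_def s2_def r_def power2_eq_square field_simps)
  have "s2 * \<epsilon> \<le> 2 * (1/6)" using s2 assms by (intro mult_mono) auto
  then have 1: "s2 * \<epsilon> - s1 \<le> 0" using s1 by simp
  have 2: "- 1 \<le> s2 * \<epsilon> - s1" using s1 s2 assms mult_nonneg_nonneg[of s2 \<epsilon>] by linarith
  show "root_expansion \<epsilon> \<le> 0" unfolding eq using 1 assms by (simp add: mult_nonneg_nonpos)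
  show "- \<epsilon> \<le> root_expansion \<epsilon>" unfolding eq using mult_left_mono[OF 2 assms(1)] by simp
qed

text \<open>
  Each function in the expansion of the series is replaced by its Taylor polynomial in \<open>s\<close>, of the
  order that leaves a remainder \<open>O(\<epsilon>\<^sup>3)\<close>. What remains are multiples of the first moment \<open>X\<close>, and they
  cancel up to the term \<open>X (2r/3) s2 \<epsilon>\<^sup>3\<close>.
\<close>

lemma legendre_series_at_expansion:
  obtains C where "\<And>\<epsilon>. admissible \<epsilon> \<Longrightarrow>
    \<bar>legendre_series \<epsilon> (legendre_root 0 * exp (root_expansion \<epsilon>))\<bar> \<le> C * \<epsilon> ^ 3"
proof -
  define r where "r = legendre_root 0"
  define X where "X = bessel_log 1 0"
  define s2 where "s2 = 1 / 15 + 4 * r / 45 - r\<^sup>2 / 90"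
  have r: "0 < r" "r < 3/2" using legendre_root[OF admissible_zero] by (auto simp: r_def)
  obtain C where C: "\<And>\<epsilon> y. admissible \<epsilon> \<Longrightarrow> 0 \<le> y \<Longrightarrow> y \<le> 5 \<Longrightarrow>
    \<bar>legendre_series \<epsilon> y - second_order \<epsilon> (\<lambda>i. bessel_moment i y)\<bar> \<le> C * \<epsilon> ^ 3"
    by (rule legendre_series_expansion) blast
  obtain K where K: "\<And>i. K i \<ge> 0"
    "\<And>i n s. \<bar>s\<bar> \<le> 1 \<Longrightarrow> \<bar>bessel_log i s - (\<Sum>m<n. bessel_log (i + m) 0 / fact m * s ^ m)\<bar> \<le> K (i + n) * \<bar>s\<bar> ^ n"
    by (rule bessel_log_taylor) blast
  note v = bessel_log_values[folded r_def X_def]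
  define L where "L = C + K 3 + K 5 + K 3 + K 2 + K 3 + K 4 + K 5 + K 6 + K 7 + \<bar>X * (2 * r / 3) * s2\<bar>"
  have "\<bar>legendre_series \<epsilon> (r * exp (root_expansion \<epsilon>))\<bar> \<le> L * \<epsilon> ^ 3" if ad: "admissible \<epsilon>" for \<epsilon>
  proof -
    have e: "0 \<le> \<epsilon>" "\<epsilon> \<le> 1/6" using admissible_range[OF ad] by auto
    define s where "s = root_expansion \<epsilon>"
    have s: "- \<epsilon> \<le> s" "s \<le> 0" using root_expansion_range[OF e] by (auto simp: s_def)
    have sa: "\<bar>s\<bar> \<le> \<epsilon>" "\<bar>s\<bar> \<le> 1" using s e by auto
    have s_eq: "s = - (r + 1) / 3 * \<epsilon> + s2 * \<epsilon>\<^sup>2" by (simp add: s_def root_expansion_def s2_def r_def)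
    have T: "\<bar>bessel_log i s - (\<Sum>m<n. bessel_log (i + m) 0 / fact m * s ^ m)\<bar> \<le> K (i + n) * \<epsilon> ^ n" for i n
    proof -
      have "\<bar>s\<bar> ^ n \<le> \<epsilon> ^ n" using sa by (intro power_mono) auto
      then show ?thesis using K(2)[OF sa(2), of i n] mult_left_mono[of "\<bar>s\<bar> ^ n" "\<epsilon> ^ n" "K (i + n)"] K(1)[of "i + n"]
        by linarith
    qed
    have "r * exp s \<le> (3/2) * 1" using s r by (intro mult_mono) auto
    then have y: "0 \<le> r * exp s" "r * exp s \<le> 5" using r by auto
    have bl: "bessel_moment i (r * exp s) = bessel_log i s" for i by (simp add: bessel_log_def r_def)
    define h where "h i = bessel_log i s" for i
    have F: "\<bar>legendre_series \<epsilon> (r * exp s) - second_order \<epsilon> h\<bar> \<le> C * \<epsilon> ^ 3"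
      using C[OF ad y] by (simp only: bl h_def[abs_def])
    have T0: "\<bar>h 0 - X * s\<bar> \<le> K 3 * \<epsilon> ^ 3"
      using T[of 0 3] v by (simp add: h_def eval_nat_numeral X_def)
    have T1: "\<bar>h 1 - X\<bar> \<le> K 3 * \<epsilon>\<^sup>2"
      using T[of 1 2] v by (simp add: h_def eval_nat_numeral X_def)
    have T3: "\<bar>h 3 - (- r * X - 2 * r * X * s)\<bar> \<le> K 5 * \<epsilon>\<^sup>2"
      using T[of 3 2] v by (simp add: h_def eval_nat_numeral)
    have T': "\<bar>h i - bessel_log i 0\<bar> \<le> K (Suc i) * \<epsilon>" for i
      using T[of i 1] by (simp add: h_def)
    define R where "R i = \<epsilon>\<^sup>2 * (h i - bessel_log i 0)" for i
    have R: "\<bar>R i\<bar> \<le> K (Suc i) * \<epsilon> ^ 3" for i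
    proof -
      have "\<epsilon>\<^sup>2 * \<bar>h i - bessel_log i 0\<bar> \<le> \<epsilon>\<^sup>2 * (K (Suc i) * \<epsilon>)" by (intro mult_left_mono T') simp
      then show ?thesis by (simp add: R_def abs_mult eval_nat_numeral mult_ac)
    qed
    define Q1 Q3 where "Q1 = \<epsilon> * (h 1 - X)" and "Q3 = \<epsilon> * (h 3 - (- r * X - 2 * r * X * s))"
    have Q1: "\<bar>Q1\<bar> \<le> K 3 * \<epsilon> ^ 3"
    proof -
      have "\<epsilon> * \<bar>h 1 - X\<bar> \<le> \<epsilon> * (K 3 * \<epsilon>\<^sup>2)" using T1 e by (intro mult_left_mono) auto
      then show ?thesis using e by (simp add: Q1_def abs_mult eval_nat_numeral mult_ac)
    qed
    have Q3: "\<bar>Q3\<bar> \<le> K 5 * \<epsilon> ^ 3"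
    proof -
      have "\<epsilon> * \<bar>h 3 - (- r * X - 2 * r * X * s)\<bar> \<le> \<epsilon> * (K 5 * \<epsilon>\<^sup>2)" using T3 e by (intro mult_left_mono) auto
      then show ?thesis using e by (simp add: Q3_def abs_mult eval_nat_numeral mult_ac)
    qed
    have M: "\<bar>X * (2 * r / 3) * s2 * \<epsilon> ^ 3\<bar> \<le> \<bar>X * (2 * r / 3) * s2\<bar> * \<epsilon> ^ 3"
      using e by (simp add: abs_mult)
    have main: "second_order \<epsilon> h
      = (h 0 - X * s) - Q3 / 3 + Q1 / 3 - R 1 / 15 + R 2 / 18 + R 3 / 6 - R 4 / 9 - R 5 / 10 + R 6 / 18
        + X * (2 * r / 3) * s2 * \<epsilon> ^ 3"
    proof -
      have "second_order \<epsilon> h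
        - ((h 0 - X * s) - Q3 / 3 + Q1 / 3 - R 1 / 15 + R 2 / 18 + R 3 / 6 - R 4 / 9 - R 5 / 10 + R 6 / 18)
        = X * s + \<epsilon> * (r * X + 2 * r * X * s + X) / 3
          + \<epsilon>\<^sup>2 * (- X / 15 + 0 / 18 + (- r * X) / 6 - (- 2 * r * X) / 9 - ((r\<^sup>2 - 3 * r) * X) / 10 + ((6 * r\<^sup>2 - 4 * r) * X) / 18)"
        unfolding second_order_def Q1_def Q3_def R_def v X_def[symmetric] by (simp add: field_simps)
      also have "\<dots> = X * (2 * r / 3) * s2 * \<epsilon> ^ 3"
        unfolding s_eq s2_def by (simp add: power2_eq_square power3_eq_cube field_simps)
      finally show ?thesis by linarith
    qed
    have "\<bar>legendre_series \<epsilon> (r * exp s)\<bar> \<le> C * \<epsilon> ^ 3 + K 3 * \<epsilon> ^ 3 + K 5 * \<epsilon> ^ 3 + K 3 * \<epsilon> ^ 3 + K 2 * \<epsilon> ^ 3 + K 3 * \<epsilon> ^ 3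
       + K 4 * \<epsilon> ^ 3 + K 5 * \<epsilon> ^ 3 + K 6 * \<epsilon> ^ 3 + K 7 * \<epsilon> ^ 3 + \<bar>X * (2 * r / 3) * s2\<bar> * \<epsilon> ^ 3"
    proof -
      have Rs: "\<bar>R 1\<bar> \<le> K 2 * \<epsilon> ^ 3" "\<bar>R 2\<bar> \<le> K 3 * \<epsilon> ^ 3" "\<bar>R 3\<bar> \<le> K 4 * \<epsilon> ^ 3"
        "\<bar>R 4\<bar> \<le> K 5 * \<epsilon> ^ 3" "\<bar>R 5\<bar> \<le> K 6 * \<epsilon> ^ 3" "\<bar>R 6\<bar> \<le> K 7 * \<epsilon> ^ 3"
        using R[of 1] R[of 2] R[of 3] R[of 4] R[of 5] R[of 6] by (simp_all add: eval_nat_numeral)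
      note bounds = F[unfolded main] T0 Q1 Q3 M Rs
      show ?thesis
        by (rule abs_leI; insert bounds[THEN abs_le_D1] bounds[THEN abs_le_D2]; linarith)
    qed
    then show ?thesis by (simp add: L_def s_def distrib_right)
  qed
  then show ?thesis using that unfolding r_def by blast
qed

lemma legendre_root_expansion:
  obtains C where "\<And>\<epsilon>. admissible \<epsilon> \<Longrightarrow>
    \<bar>legendre_root \<epsilon> - legendre_root 0 * exp (root_expansion \<epsilon>)\<bar> \<le> C * \<epsilon> ^ 3"
proof -
  obtain C where C: "\<And>\<epsilon>. admissible \<epsilon> \<Longrightarrow>
    \<bar>legendre_series \<epsilon> (legendre_root 0 * exp (root_expansion \<epsilon>))\<bar> \<le> C * \<epsilon> ^ 3"
    by (rule legendre_series_at_expansion) blast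
  have "\<bar>legendre_root \<epsilon> - legendre_root 0 * exp (root_expansion \<epsilon>)\<bar> \<le> (4 * C) * \<epsilon> ^ 3" if ad: "admissible \<epsilon>" for \<epsilon>
  proof -
    have e: "0 \<le> \<epsilon>" "\<epsilon> \<le> 1/6" using admissible_range[OF ad] by auto
    have r: "0 < legendre_root 0" "legendre_root 0 < 3/2" using legendre_root[OF admissible_zero] by auto
    have "legendre_root 0 * exp (root_expansion \<epsilon>) \<le> (3/2) * 1"
      using root_expansion_range[OF e] r by (intro mult_mono) auto
    then have "\<bar>legendre_root \<epsilon> - legendre_root 0 * exp (root_expansion \<epsilon>)\<bar>
        \<le> 4 * \<bar>legendre_series \<epsilon> (legendre_root 0 * exp (root_expansion \<epsilon>))\<bar>"
      using r by (intro legendre_root_approx ad) auto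
    then show ?thesis using C[OF ad] by simp
  qed
  then show ?thesis using that by blast
qed


section \<open>The cosine in the asymptotic formula\<close>

text \<open>
  The form in which all remainders below are estimated: a power of \<open>x\<close> times a function with a limit.
\<close>

lemma bigo_power_times_bounded:
  fixes h :: "real \<Rightarrow> real"
  assumes "(h \<longlongrightarrow> L) (at_right 0)"
  shows "(\<lambda>x. x ^ n * h x) \<in> O[at_right 0](\<lambda>x. x ^ n)"
proof -
  have "h \<in> O[at_right 0](\<lambda>x. 1)" using assms by (intro bigoI_tendsto[where c = L]) auto
  then have "(\<lambda>x. x ^ n * h x) \<in> O[at_right 0](\<lambda>x. x ^ n * 1)" by (intro landau_o.big.mult) auto
  then show ?thesis by simp
qed

text \<open>
  For \<open>x = 1/(m(m+1))\<close> the quotient \<open>x / (1 + x/3)\<close> is \<open>1/(m(m+1) + 1/3)\<close>, and the first expression is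
  the square of the angle in the asymptotic formula when \<open>b = \<beta>\<^sup>2\<close> and \<open>c = (\<beta>\<^sup>2 - 2)/360\<close>.
\<close>

lemma angle_square_expansion:
  fixes b c :: real
  shows "(\<lambda>x. b * (x / (1 + x/3)) * (1 - c * (x / (1 + x/3))\<^sup>2)\<^sup>2 - b * (x - x\<^sup>2 / 3 + (1/9 - 2 * c) * x ^ 3))
     \<in> O[at_right 0](\<lambda>x. x ^ 4)"
proof -
  let ?h = "\<lambda>x. b * (- (1/27) / (1 + x/3) + 2 * c * (1 + x/3 + x\<^sup>2 / 27) / (1 + x/3) ^ 3 + c\<^sup>2 * x / (1 + x/3) ^ 5)"
  have "(?h \<longlongrightarrow> b * (- (1/27) / (1 + 0/3) + 2 * c * (1 + 0/3 + 0\<^sup>2 / 27) / (1 + 0/3) ^ 3 + c\<^sup>2 * 0 / (1 + 0/3) ^ 5)) (at_right 0)"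
    by (intro tendsto_intros) auto
  then have "(\<lambda>x. x ^ 4 * ?h x) \<in> O[at_right 0](\<lambda>x. x ^ 4)" by (rule bigo_power_times_bounded)
  moreover have "eventually (\<lambda>x. x ^ 4 * ?h x
     = b * (x / (1 + x/3)) * (1 - c * (x / (1 + x/3))\<^sup>2)\<^sup>2 - b * (x - x\<^sup>2 / 3 + (1/9 - 2 * c) * x ^ 3)) (at_right 0)"
    using eventually_at_right_less[of "0::real"]
  proof eventually_elim
    fix x :: real assume "0 < x"
    \<comment> \<open>in terms of \<open>q\<close> all denominators are monomials\<close>
    define q where "q = 1 + x / 3"
    have q: "q \<noteq> 0" "x = 3 * (q - 1)" using \<open>0 < x\<close> by (auto simp: q_def)
    show "x ^ 4 * ?h x
     = b * (x / (1 + x/3)) * (1 - c * (x / (1 + x/3))\<^sup>2)\<^sup>2 - b * (x - x\<^sup>2 / 3 + (1/9 - 2 * c) * x ^ 3)"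
      unfolding q_def[symmetric] using q(1) unfolding q(2)
      by (simp add: eval_nat_numeral divide_simps) (simp add: algebra_simps)
  qed
  ultimately show ?thesis by (rule landau_o.big.ev_eq_trans2[rotated] landau_o.big.in_cong[THEN iffD1, rotated])
qed

lemma abs_cos_taylor:
  fixes w :: real
  shows "\<bar>1 - cos w - (w\<^sup>2 / 2 - (w\<^sup>2)\<^sup>2 / 24 + (w\<^sup>2) ^ 3 / 720)\<bar> \<le> (w\<^sup>2) ^ 4"
proof -
  obtain t where t: "cos w = (\<Sum>m<8. cos_coeff m * w ^ m) + (cos (t + 1/2 * real 8 * pi) / fact 8) * w ^ 8"
    using Maclaurin_cos_expansion[of w 8] by blast
  have "(\<Sum>m<8. f m) = f 0 + f 1 + f 2 + f 3 + f 4 + f 5 + f 6 + f 7" for f :: "nat \<Rightarrow> real"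
    by (simp add: eval_nat_numeral)
  then have S: "(\<Sum>m<8. cos_coeff m * w ^ m) = 1 - w\<^sup>2 / 2 + w ^ 4 / 24 - w ^ 6 / 720"
    by (simp add: cos_coeff_def fact_numeral)
  have e: "(w\<^sup>2)\<^sup>2 = w ^ 4" "(w\<^sup>2) ^ 3 = w ^ 6" "(w\<^sup>2) ^ 4 = w ^ 8" by (simp_all flip: power_mult)
  define \<rho> where "\<rho> = (cos (t + 1/2 * real 8 * pi) / fact 8) * w ^ 8"
  have "\<bar>\<rho>\<bar> \<le> 1 * w ^ 8"
  proof -
    have "\<bar>cos (t + 1/2 * real 8 * pi)\<bar> / fact 8 \<le> 1 / 1"
      by (intro frac_le abs_cos_le_one) (auto simp: fact_ge_1)
    then show ?thesis unfolding \<rho>_def abs_mult by (intro mult_mono) auto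
  qed
  then show ?thesis unfolding e t S \<rho>_def[symmetric] by linarith
qed

lemma exp_quadratic_expansion:
  fixes s1 s2 :: real
  shows "(\<lambda>x. exp (s1 * x + s2 * x\<^sup>2) - (1 + s1 * x + (s2 + s1\<^sup>2 / 2) * x\<^sup>2)) \<in> O[at_right 0](\<lambda>x. x ^ 3)"
proof -
  let ?u = "\<lambda>x. s1 * x + s2 * x\<^sup>2"
  have u: "?u \<in> O[at_right 0](\<lambda>x. x)"
  proof -
    have "((\<lambda>x. s1 + s2 * x) \<longlongrightarrow> s1 + s2 * 0) (at_right 0)" by (intro tendsto_intros)
    from bigo_power_times_bounded[OF this, of 1] show ?thesis by (simp add: algebra_simps power2_eq_square)
  qed
  have u3: "(\<lambda>x. ?u x ^ 3) \<in> O[at_right 0](\<lambda>x. x ^ 3)" by (rule landau_o.big_power[OF u])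
  have lim: "(?u \<longlongrightarrow> s1 * 0 + s2 * 0\<^sup>2) (at_right 0)" by (intro tendsto_intros)
  have small: "eventually (\<lambda>x. \<bar>?u x\<bar> < 1) (at_right 0)"
    using tendstoD[OF lim, of 1] by (simp add: dist_real_def)
  have "(\<lambda>x. exp (?u x) - (1 + ?u x + (?u x)\<^sup>2 / 2)) \<in> O[at_right 0](\<lambda>x. ?u x ^ 3)"
  proof (rule bigoI[of _ "exp 1"])
    show "eventually (\<lambda>x. norm (exp (?u x) - (1 + ?u x + (?u x)\<^sup>2 / 2)) \<le> exp 1 * norm (?u x ^ 3)) (at_right 0)"
      using small
    proof eventually_elim
      fix x assume x: "\<bar>?u x\<bar> < 1"
      obtain t where t: "\<bar>t\<bar> \<le> \<bar>?u x\<bar>" "exp (?u x) = (\<Sum>m<3. ?u x ^ m / fact m) + exp t / fact 3 * ?u x ^ 3"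
        using Maclaurin_exp_le[of "?u x" 3] by blast
      have s: "(\<Sum>m<3. ?u x ^ m / fact m) = 1 + ?u x + (?u x)\<^sup>2 / 2" by (simp add: eval_nat_numeral)
      have "exp t / fact 3 \<le> exp 1 / 1" using t(1) x by (intro frac_le) (auto simp: fact_numeral)
      then have "\<bar>exp t / fact 3 * ?u x ^ 3\<bar> \<le> exp 1 * \<bar>?u x ^ 3\<bar>"
        unfolding abs_mult by (intro mult_right_mono) auto
      then show "norm (exp (?u x) - (1 + ?u x + (?u x)\<^sup>2 / 2)) \<le> exp 1 * norm (?u x ^ 3)"
        unfolding t(2) s by simp
    qed
  qed
  then have 1: "(\<lambda>x. exp (?u x) - (1 + ?u x + (?u x)\<^sup>2 / 2)) \<in> O[at_right 0](\<lambda>x. x ^ 3)"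
    using u3 by (rule landau_o.big_trans)
  have 2: "(\<lambda>x. x ^ 3 * (s1 * s2 + s2\<^sup>2 / 2 * x)) \<in> O[at_right 0](\<lambda>x. x ^ 3)"
    by (rule bigo_power_times_bounded[where L = "s1 * s2 + s2\<^sup>2 / 2 * 0"]) (intro tendsto_intros)
  have "(\<lambda>x. exp (?u x) - (1 + s1 * x + (s2 + s1\<^sup>2 / 2) * x\<^sup>2))
      = (\<lambda>x. (exp (?u x) - (1 + ?u x + (?u x)\<^sup>2 / 2)) + x ^ 3 * (s1 * s2 + s2\<^sup>2 / 2 * x))"
    by (rule ext) (simp add: power2_eq_square power3_eq_cube field_simps)
  then show ?thesis using sum_in_bigo(1)[OF 1 2] by simp
qed

text \<open>
  Here \<open>z\<close> is the square of the angle and \<open>b q\<close> its cubic Taylor polynomial. The terms of order \<open>x\<close>,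
  \<open>x\<^sup>2\<close> and \<open>x\<^sup>3\<close> cancel by the choice of \<open>b\<close>, \<open>c\<close> and of the coefficients in the exponential; powers of
  \<open>z\<close> are compared with those of \<open>b q\<close>, or of \<open>b x\<close> for the cube, by factoring the differences.
\<close>

lemma cos_angle_expansion:
  fixes r :: real
  assumes "r > 0"
  defines "b \<equiv> 4 * r"
  defines "c \<equiv> (b - 2) / 360"
  shows "(\<lambda>x. 1 - cos (sqrt b * sqrt (x / (1 + x/3)) * (1 - c * (x / (1 + x/3))\<^sup>2))
     - 2 * x * r * exp (- (r + 1) / 3 * x + (1/15 + 4 * r / 45 - r\<^sup>2 / 90) * x\<^sup>2)) \<in> O[at_right 0](\<lambda>x. x ^ 4)"
proof -
  define z where "z x = b * (x / (1 + x/3)) * (1 - c * (x / (1 + x/3))\<^sup>2)\<^sup>2" for x :: real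
  define q where "q x = x - x\<^sup>2 / 3 + (1/9 - 2 * c) * x ^ 3" for x :: real
  define w where "w x = sqrt b * sqrt (x / (1 + x/3)) * (1 - c * (x / (1 + x/3))\<^sup>2)" for x :: real
  define s1 s2 where "s1 = - (r + 1) / 3" and "s2 = 1/15 + 4 * r / 45 - r\<^sup>2 / 90"
  let ?O = "\<lambda>n. O[at_right 0](\<lambda>x::real. x ^ n)"
  have zq: "(\<lambda>x. z x - b * q x) \<in> ?O 4" unfolding z_def q_def by (rule angle_square_expansion)
  have q1: "q \<in> ?O 1"
  proof -
    have "((\<lambda>x. 1 - x / 3 + (1/9 - 2 * c) * x\<^sup>2) \<longlongrightarrow> 1 - 0 / 3 + (1/9 - 2 * c) * 0\<^sup>2) (at_right 0)"
      by (intro tendsto_intros) auto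
    from bigo_power_times_bounded[OF this, of 1] show ?thesis
      by (simp add: q_def[abs_def] power2_eq_square power3_eq_cube algebra_simps)
  qed
  have z1: "z \<in> ?O 1"
  proof -
    have "((\<lambda>x. b * (1 / (1 + x/3)) * (1 - c * (x / (1 + x/3))\<^sup>2)\<^sup>2) \<longlongrightarrow> b * (1 / (1 + 0/3)) * (1 - c * (0 / (1 + 0/3))\<^sup>2)\<^sup>2) (at_right 0)"
      by (intro tendsto_intros) auto
    from bigo_power_times_bounded[OF this, of 1] show ?thesis by (simp add: z_def[abs_def] mult_ac)
  qed
  have lift: "f \<in> ?O 4" if "f \<in> ?O n" "n \<ge> 4" for f :: "real \<Rightarrow> real" and n
  proof -
    have "(\<lambda>x::real. x ^ 4 * x ^ (n - 4)) \<in> ?O 4"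
      by (rule bigo_power_times_bounded[where L = "0 ^ (n - 4)"]) (intro tendsto_intros)
    then have "(\<lambda>x::real. x ^ n) \<in> ?O 4" using that(2) by (simp flip: power_add)
    with that(1) show ?thesis by (rule landau_o.big_trans)
  qed
  have mul: "(\<lambda>x. f x * g x) \<in> ?O (m + n)" if "f \<in> ?O m" "g \<in> ?O n" for f g :: "real \<Rightarrow> real" and m n
    using landau_o.big.mult[OF that] by (simp add: power_add)
  have bq: "(\<lambda>x. b * q x) \<in> ?O 1" using q1 by simp
  have z2: "(\<lambda>x. (z x)\<^sup>2 - b\<^sup>2 * (x\<^sup>2 - 2 / 3 * x ^ 3)) \<in> ?O 4"
  proof -
    have "(\<lambda>x. (z x - b * q x) * (z x + b * q x)) \<in> ?O (4 + 1)" by (intro mul zq sum_in_bigo z1 bq)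
    then have 1: "(\<lambda>x. (z x - b * q x) * (z x + b * q x)) \<in> ?O 4" by (rule lift) simp
    have 2: "(\<lambda>x. x ^ 4 * (b\<^sup>2 * (1/9 + 2 * (1/9 - 2*c) - 2/3 * (1/9 - 2*c) * x + (1/9 - 2*c)\<^sup>2 * x\<^sup>2))) \<in> ?O 4"
      by (rule bigo_power_times_bounded[where L = "b\<^sup>2 * (1/9 + 2 * (1/9 - 2*c) - 2/3 * (1/9 - 2*c) * 0 + (1/9 - 2*c)\<^sup>2 * 0\<^sup>2)"])
         (intro tendsto_intros)
    have "(\<lambda>x. (z x)\<^sup>2 - b\<^sup>2 * (x\<^sup>2 - 2 / 3 * x ^ 3)) = (\<lambda>x. (z x - b * q x) * (z x + b * q x)
        + x ^ 4 * (b\<^sup>2 * (1/9 + 2 * (1/9 - 2*c) - 2/3 * (1/9 - 2*c) * x + (1/9 - 2*c)\<^sup>2 * x\<^sup>2)))"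
    proof
      fix x
      define e where "e = 1/9 - 2 * c"
      have "(b * q x)\<^sup>2 = b\<^sup>2 * (x\<^sup>2 - 2 / 3 * x ^ 3) + x ^ 4 * (b\<^sup>2 * (1/9 + 2 * e - 2/3 * e * x + e\<^sup>2 * x\<^sup>2))"
        unfolding q_def e_def[symmetric] by (simp add: eval_nat_numeral field_simps)
      moreover have "(z x)\<^sup>2 = (z x - b * q x) * (z x + b * q x) + (b * q x)\<^sup>2"
        by (simp add: power2_eq_square algebra_simps)
      ultimately show "(z x)\<^sup>2 - b\<^sup>2 * (x\<^sup>2 - 2 / 3 * x ^ 3) = (z x - b * q x) * (z x + b * q x)
        + x ^ 4 * (b\<^sup>2 * (1/9 + 2 * (1/9 - 2*c) - 2/3 * (1/9 - 2*c) * x + (1/9 - 2*c)\<^sup>2 * x\<^sup>2))"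
        by (simp add: e_def)
    qed
    then show ?thesis using sum_in_bigo(1)[OF 1 2] by simp
  qed
  have z3: "(\<lambda>x. z x ^ 3 - b ^ 3 * x ^ 3) \<in> ?O 4"
  proof -
    have zx: "(\<lambda>x. z x - b * x) \<in> ?O 2"
    proof -
      have "(\<lambda>x::real. x ^ 2 * (x ^ 2)) \<in> ?O 2"
        by (rule bigo_power_times_bounded[where L = "0 ^ 2"]) (intro tendsto_intros)
      then have "(\<lambda>x::real. x ^ 4) \<in> ?O 2" by (simp flip: power_add)
      with zq have 1: "(\<lambda>x. z x - b * q x) \<in> ?O 2" by (rule landau_o.big_trans)
      have 2: "(\<lambda>x. x ^ 2 * (b * (- 1 / 3 + (1/9 - 2 * c) * x))) \<in> ?O 2"
        by (rule bigo_power_times_bounded[where L = "b * (- 1 / 3 + (1/9 - 2 * c) * 0)"]) (intro tendsto_intros)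
      have "(\<lambda>x. z x - b * x) = (\<lambda>x. (z x - b * q x) + x ^ 2 * (b * (- 1 / 3 + (1/9 - 2 * c) * x)))"
        by (rule ext) (simp add: q_def power2_eq_square power3_eq_cube algebra_simps)
      then show ?thesis using sum_in_bigo(1)[OF 1 2] by simp
    qed
    have bx: "(\<lambda>x. b * x) \<in> ?O 1" by simp
    have "(\<lambda>x. (z x - b * x) * (z x * z x + z x * (b * x) + (b * x) * (b * x))) \<in> ?O (2 + (1 + 1))"
      by (intro mul zx sum_in_bigo z1 bx)
    moreover have "(\<lambda>x. (z x - b * x) * (z x * z x + z x * (b * x) + (b * x) * (b * x))) = (\<lambda>x. z x ^ 3 - b ^ 3 * x ^ 3)"
      by (rule ext) (simp add: power3_eq_cube algebra_simps)
    ultimately show ?thesis by simp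
  qed
  have z4: "(\<lambda>x. z x ^ 4) \<in> ?O 4" using landau_o.big_power[OF z1, of 4] by simp
  have cosO: "(\<lambda>x. 1 - cos (w x) - (z x / 2 - (z x)\<^sup>2 / 24 + z x ^ 3 / 720)) \<in> ?O 4"
  proof -
    have "(\<lambda>x. 1 - cos (w x) - (z x / 2 - (z x)\<^sup>2 / 24 + z x ^ 3 / 720)) \<in> O[at_right 0](\<lambda>x. z x ^ 4)"
    proof (rule bigoI[of _ 1])
      show "eventually (\<lambda>x. norm (1 - cos (w x) - (z x / 2 - (z x)\<^sup>2 / 24 + z x ^ 3 / 720)) \<le> 1 * norm (z x ^ 4)) (at_right 0)"
        using eventually_at_right_less[of "0::real"]
      proof eventually_elim
        fix x :: real assume "0 < x"
        then have "(w x)\<^sup>2 = z x" using assms(1) by (simp add: w_def z_def b_def power_mult_distrib)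
        then show "norm (1 - cos (w x) - (z x / 2 - (z x)\<^sup>2 / 24 + z x ^ 3 / 720)) \<le> 1 * norm (z x ^ 4)"
          using abs_cos_taylor[of "w x"] by simp
      qed
    qed
    then show ?thesis using z4 by (rule landau_o.big_trans)
  qed
  have expO: "(\<lambda>x. 2 * r * (x * (exp (s1 * x + s2 * x\<^sup>2) - (1 + s1 * x + (s2 + s1\<^sup>2 / 2) * x\<^sup>2)))) \<in> ?O 4"
  proof -
    have "(\<lambda>x::real. x) \<in> ?O 1" by simp
    from mul[OF this exp_quadratic_expansion[of s1 s2]] show ?thesis by simp
  qed
  have "(\<lambda>x. 1 - cos (w x) - 2 * x * r * exp (s1 * x + s2 * x\<^sup>2))
     = (\<lambda>x. (1 - cos (w x) - (z x / 2 - (z x)\<^sup>2 / 24 + z x ^ 3 / 720))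
        + (1/2 * (z x - b * q x) - 1/24 * ((z x)\<^sup>2 - b\<^sup>2 * (x\<^sup>2 - 2 / 3 * x ^ 3)) + 1/720 * (z x ^ 3 - b ^ 3 * x ^ 3))
        - 2 * r * (x * (exp (s1 * x + s2 * x\<^sup>2) - (1 + s1 * x + (s2 + s1\<^sup>2 / 2) * x\<^sup>2))))"
    (is "_ = (\<lambda>x. ?A x + ?B x - ?C x)")
  proof
    fix x
    have "b * q x / 2 - b\<^sup>2 * (x\<^sup>2 - 2 / 3 * x ^ 3) / 24 + b ^ 3 * x ^ 3 / 720
        = 2 * r * (x * (1 + s1 * x + (s2 + s1\<^sup>2 / 2) * x\<^sup>2))"
      unfolding q_def c_def s1_def s2_def b_def by (simp add: eval_nat_numeral field_simps)
    then show "1 - cos (w x) - 2 * x * r * exp (s1 * x + s2 * x\<^sup>2) = ?A x + ?B x - ?C x"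
      by (simp add: right_diff_distrib field_simps)
  qed
  also have "\<dots> \<in> ?O 4"
  proof -
    have "(\<lambda>x. 1/2 * (z x - b * q x)) \<in> ?O 4" using zq by simp
    moreover have "(\<lambda>x. 1/24 * ((z x)\<^sup>2 - b\<^sup>2 * (x\<^sup>2 - 2 / 3 * x ^ 3))) \<in> ?O 4" using z2 by simp
    moreover have "(\<lambda>x. 1/720 * (z x ^ 3 - b ^ 3 * x ^ 3)) \<in> ?O 4" using z3 by simp
    ultimately have "?B \<in> ?O 4" by (intro sum_in_bigo(1) sum_in_bigo(2))
    then show ?thesis by (intro sum_in_bigo(2)[OF sum_in_bigo(1)[OF cosO]] expO)
  qed
  finally show ?thesis unfolding w_def s1_def s2_def .
qed


section \<open>The bound on the scaling constant and the asymptotics of the root\<close>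

text \<open>
  With \<open>\<epsilon> = 1/(2d(2d+1))\<close> the difference splits into the error of the cosine against
  \<open>1 - 2 \<epsilon> r exp (root_expansion \<epsilon>)\<close> and \<open>2\<epsilon>\<close> times the error of the approximate root. Both are
  \<open>O(\<epsilon>\<^sup>4)\<close>, that is, \<open>O(1/d^8)\<close>.
\<close>

lemma Max_root_Legendre_poly_asymptotics:
  fixes \<gamma> :: "nat \<Rightarrow> real"
  assumes gamma: "\<And>d. \<gamma> d = Max {x. poly (Legendre_poly (2 * d)) x = 0}"
  defines "\<beta> \<equiv> 2 * sqrt (legendre_root 0)"
  shows "(\<lambda>d. \<gamma> d -
             cos (\<beta> / sqrt (4 * real d ^ 2 + 2 * real d + 1 / 3) *
               (1 - (\<beta>\<^sup>2 - 2) / (360 * (4 * real d ^ 2 + 2 * real d + 1 / 3)\<^sup>2))))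
           \<in> O(\<lambda>d. 1 / real d ^ 7)"
proof -
  define r where "r = legendre_root 0"
  have r: "r > 0" using legendre_root[OF admissible_zero] by (simp add: r_def)
  define \<epsilon> where "\<epsilon> d = 1 / (real (2 * d) * (real (2 * d) + 1))" for d
  define W where "W x = sqrt (4 * r) * sqrt (x / (1 + x/3)) * (1 - (4 * r - 2) / 360 * (x / (1 + x/3))\<^sup>2)" for x :: real
  have ad: "admissible (\<epsilon> d)" if "d \<ge> 1" for d
    using that by (auto simp: admissible_def \<epsilon>_def intro!: exI[of _ "2 * d"])
  have \<epsilon>_le: "0 < \<epsilon> d" "\<epsilon> d \<le> 1 / real d ^ 2" if "d \<ge> 1" for d
  proof -
    have "real d * real d \<le> real (2 * d) * (real (2 * d) + 1)" by (intro mult_mono) auto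
    moreover have "0 < real d * real d" using that by simp
    ultimately show "0 < \<epsilon> d" "\<epsilon> d \<le> 1 / real d ^ 2"
      using that by (auto simp: \<epsilon>_def power2_eq_square simp del: of_nat_mult intro!: divide_left_mono)
  qed
  have ev1: "eventually (\<lambda>d::nat. d \<ge> 1) at_top" by (rule eventually_ge_at_top)
  have lim: "filterlim \<epsilon> (at_right 0) at_top"
    unfolding filterlim_at
  proof
    show "eventually (\<lambda>d. \<epsilon> d \<in> {0<..} \<and> \<epsilon> d \<noteq> 0) at_top"
      using ev1 by eventually_elim (use \<epsilon>_le in force)
    show "\<epsilon> \<longlonglongrightarrow> 0"
    proof (rule tendsto_sandwich[of "\<lambda>_. 0" _ _ "\<lambda>d. 1 / real d"])
      show "eventually (\<lambda>d. 0 \<le> \<epsilon> d) at_top" using ev1 by eventually_elim (use \<epsilon>_le in force)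
      show "eventually (\<lambda>d. \<epsilon> d \<le> 1 / real d) at_top"
        using ev1
      proof eventually_elim
        fix d :: nat assume d: "d \<ge> 1"
        have "1 / real d ^ 2 \<le> 1 / real d ^ 1" using d by (intro divide_left_mono power_increasing) auto
        then show "\<epsilon> d \<le> 1 / real d" using \<epsilon>_le(2)[OF d] by simp
      qed
    qed (auto intro: lim_1_over_n)
  qed
  have O4: "(\<lambda>d. \<epsilon> d ^ 4) \<in> O(\<lambda>d. 1 / real d ^ 7)"
  proof (rule bigoI[of _ 1])
    show "eventually (\<lambda>d. norm (\<epsilon> d ^ 4) \<le> 1 * norm (1 / real d ^ 7)) at_top"
      using ev1
    proof eventually_elim
      fix d :: nat assume d: "d \<ge> 1"
      have "\<epsilon> d ^ 4 \<le> (1 / real d ^ 2) ^ 4" using \<epsilon>_le[OF d] by (intro power_mono) auto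
      also have "\<dots> = 1 / real d ^ 8" by (simp add: power_divide flip: power_mult)
      also have "\<dots> \<le> 1 / real d ^ 7" using d by (intro divide_left_mono power_increasing) auto
      finally show "norm (\<epsilon> d ^ 4) \<le> 1 * norm (1 / real d ^ 7)" using \<epsilon>_le(1)[OF d] by simp
    qed
  qed
  have 1: "(\<lambda>d. 1 - cos (W (\<epsilon> d)) - 2 * \<epsilon> d * r * exp (root_expansion (\<epsilon> d))) \<in> O(\<lambda>d. 1 / real d ^ 7)"
    using landau_o.big.compose[OF cos_angle_expansion[OF r] lim] O4
    unfolding W_def root_expansion_def r_def[symmetric] by (rule landau_o.big_trans)
  have 2: "(\<lambda>d. 2 * \<epsilon> d * (legendre_root (\<epsilon> d) - r * exp (root_expansion (\<epsilon> d)))) \<in> O(\<lambda>d. 1 / real d ^ 7)"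
  proof -
    obtain C where C: "\<And>\<epsilon>. admissible \<epsilon> \<Longrightarrow>
      \<bar>legendre_root \<epsilon> - legendre_root 0 * exp (root_expansion \<epsilon>)\<bar> \<le> C * \<epsilon> ^ 3"
      by (rule legendre_root_expansion) blast
    have "(\<lambda>d. 2 * \<epsilon> d * (legendre_root (\<epsilon> d) - r * exp (root_expansion (\<epsilon> d)))) \<in> O(\<lambda>d. \<epsilon> d ^ 4)"
    proof (rule bigoI[of _ "2 * C"])
      show "eventually (\<lambda>d. norm (2 * \<epsilon> d * (legendre_root (\<epsilon> d) - r * exp (root_expansion (\<epsilon> d))))
          \<le> 2 * C * norm (\<epsilon> d ^ 4)) at_top"
        using ev1
      proof eventually_elim
        fix d :: nat assume d: "d \<ge> 1"
        have "2 * \<epsilon> d * \<bar>legendre_root (\<epsilon> d) - r * exp (root_expansion (\<epsilon> d))\<bar> \<le> 2 * \<epsilon> d * (C * \<epsilon> d ^ 3)"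
          using C[OF ad[OF d]] \<epsilon>_le(1)[OF d] unfolding r_def by (intro mult_left_mono) auto
        then show "norm (2 * \<epsilon> d * (legendre_root (\<epsilon> d) - r * exp (root_expansion (\<epsilon> d)))) \<le> 2 * C * norm (\<epsilon> d ^ 4)"
          using \<epsilon>_le(1)[OF d] by (simp add: abs_mult eval_nat_numeral mult_ac)
      qed
    qed
    then show ?thesis using O4 by (rule landau_o.big_trans)
  qed
  have "eventually (\<lambda>d. (1 - cos (W (\<epsilon> d)) - 2 * \<epsilon> d * r * exp (root_expansion (\<epsilon> d)))
        - 2 * \<epsilon> d * (legendre_root (\<epsilon> d) - r * exp (root_expansion (\<epsilon> d)))
      = \<gamma> d - cos (\<beta> / sqrt (4 * real d ^ 2 + 2 * real d + 1 / 3) *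
               (1 - (\<beta>\<^sup>2 - 2) / (360 * (4 * real d ^ 2 + 2 * real d + 1 / 3)\<^sup>2)))) at_top"
    using ev1
  proof eventually_elim
    fix d :: nat assume d: "d \<ge> 1"
    define M where "M = 4 * real d ^ 2 + 2 * real d + 1 / 3"
    have g: "\<gamma> d = 1 - 2 * (\<epsilon> d * legendre_root (\<epsilon> d))"
      unfolding gamma using d by (intro Max_root_Legendre_poly) (auto simp: \<epsilon>_def)
    have \<eta>: "\<epsilon> d / (1 + \<epsilon> d / 3) = 1 / M"
    proof -
      have "1 / \<epsilon> d = M - 1 / 3" by (simp add: \<epsilon>_def M_def power2_eq_square algebra_simps)
      then have "M = (1 + \<epsilon> d / 3) / \<epsilon> d" using \<epsilon>_le(1)[OF d] by (simp add: field_simps)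
      then show ?thesis by simp
    qed
    have "\<beta> = sqrt (4 * r)" "\<beta>\<^sup>2 = 4 * r" using r by (simp_all add: \<beta>_def real_sqrt_mult power_mult_distrib flip: r_def)
    then have Wd: "W (\<epsilon> d) = \<beta> / sqrt M * (1 - (\<beta>\<^sup>2 - 2) / (360 * M\<^sup>2))"
      unfolding W_def \<eta> by (simp add: real_sqrt_divide power_divide)
    show "(1 - cos (W (\<epsilon> d)) - 2 * \<epsilon> d * r * exp (root_expansion (\<epsilon> d)))
        - 2 * \<epsilon> d * (legendre_root (\<epsilon> d) - r * exp (root_expansion (\<epsilon> d)))
      = \<gamma> d - cos (\<beta> / sqrt (4 * real d ^ 2 + 2 * real d + 1 / 3) *
               (1 - (\<beta>\<^sup>2 - 2) / (360 * (4 * real d ^ 2 + 2 * real d + 1 / 3)\<^sup>2)))"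
      unfolding g M_def[symmetric] Wd by (simp add: algebra_simps)
  qed
  then show ?thesis
    using sum_in_bigo(2)[OF 1 2] by (rule landau_o.big.in_cong[THEN iffD1])
qed


theorem corollary1p9:
  fixes \<gamma> :: "nat \<Rightarrow> real" and \<beta> :: real
  assumes gamma: "\<And>d. \<gamma> d = Max {x. poly (Legendre_poly (2 * d)) x = 0}"
    and beta: "\<beta> = (LEAST x. 0 < x \<and> Bessel_J0 x = 0)"
  shows "(\<forall>d\<ge>1. scaling_const d (form_space d :: (real ^ 'n::finite \<Rightarrow> real) set)
             \<le> ereal (1 + 1 / (1 - (\<gamma> d)\<^sup>2) powr (1 / 4) *
                 (\<Sum>j=0..d. harmonic_dim CARD('n) (2 * j) * sqrt (4 / (pi * (4 * real j + 1))))))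
       \<and> (\<lambda>d. \<gamma> d -
             cos (\<beta> / sqrt (4 * real d ^ 2 + 2 * real d + 1 / 3) *
               (1 - (\<beta>\<^sup>2 - 2) / (360 * (4 * real d ^ 2 + 2 * real d + 1 / 3)\<^sup>2))))
           \<in> O(\<lambda>d. 1 / real d ^ 7)
       \<and> \<bar>\<beta> - 2.4048\<bar> < 0.00005"
proof (intro conjI allI impI)
  have \<beta>: "\<beta> = 2 * sqrt (legendre_root 0)" by (simp add: beta Bessel_J0_first_root)
  show "\<bar>\<beta> - 2.4048\<bar> < 0.00005" unfolding \<beta> by (rule Bessel_J0_first_root_bounds)
  show "scaling_const d (form_space d :: (real ^ 'n \<Rightarrow> real) set)
      \<le> ereal (1 + 1 / (1 - (\<gamma> d)\<^sup>2) powr (1 / 4) *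
          (\<Sum>j=0..d. harmonic_dim CARD('n) (2 * j) * sqrt (4 / (pi * (4 * real j + 1)))))"
    if d: "d \<ge> 1" for d
  proof -
    have bound: "real ((CARD('n) + 2 * d - 1) choose (2 * d)) / 2
      \<le> 1 / (1 - (\<gamma> d)\<^sup>2) powr (1 / 4) *
        (\<Sum>j=0..d. harmonic_dim CARD('n) (2 * j) * sqrt (4 / (pi * (4 * real j + 1))))" (is "_ \<le> ?c")
      using Max_root_Legendre_poly_bounds[OF d gamma] by (intro dimension_bound d) auto
    show ?thesis
    proof (rule scaling_const_le)
      have "0 \<le> real ((CARD('n) + 2 * d - 1) choose (2 * d)) / 2" by simp
      then show "0 \<le> ?c" using bound by (rule order_trans)
      fix p :: "'n mpoly" and v :: "real ^ 'n"
      assume "p \<in> dual_cone_approx d (form_space d) \<inter> dual_slice d" "v \<in> unit_sphere"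
      then show "- ?c \<le> mpoly_eval p v" using sphere_lower_bound[of p d v] bound by linarith
    qed
  qed
  show "(\<lambda>d. \<gamma> d -
             cos (\<beta> / sqrt (4 * real d ^ 2 + 2 * real d + 1 / 3) *
               (1 - (\<beta>\<^sup>2 - 2) / (360 * (4 * real d ^ 2 + 2 * real d + 1 / 3)\<^sup>2))))
           \<in> O(\<lambda>d. 1 / real d ^ 7)"
    unfolding \<beta> by (rule Max_root_Legendre_poly_asymptotics[OF gamma])
qed


end
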